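(* Let $d\ge 2$ and let $\theta$ be a real antisymmetric $d\times d$ matrix. If $T\in\Pi(C(\mathbb{T}^d_\theta),C(\mathbb{S}^{d-1}))$, then for any continuous normalised trace $\varphi$ on $\mathcal{L}_{1,\infty}(L_2(\mathbb{T}^d_\theta))$, $$\varphi(T(1-\Delta)^{-d/2})=\frac1d\Big(\tau_\theta\otimes\int_{\mathbb{S}^{d-1}}\Big)(\mathrm{sym}(T)).$$
   Context: Noncommutative torus: $C(\mathbb{T}^d_\theta)$ is the universal $C^*$-algebra generated by unitaries $\{u_n\}_{n\in\mathbb{Z}^d}$ with $u_nu_m=e^{\frac i2(n,\theta m)}u_{n+m}$. $\tau_\theta$ is the tracial state on $C(\mathbb{T}^d_\theta)$ which is the continuous extension of $\sum_k c_ku_k\mapsto c_0$. $L_2(\mathbb{T}^d_\theta)$ is the GNS Hilbert space of $\tau_\theta$, with inner product $\langle x,y\rangle=\tau_\theta(x^*y)$; $\{u_n\}$ is an orthonormal basis. $\pi_1(x)$ is the operator of left multiplication by $x\in C(\mathbb{T}^d_\theta)$ on $L_2(\mathbb{T}^d_\theta)$. The self-adjoint operators $D_j$ are given by $D_ju_n=n_ju_n$, $\nabla=(D_1,\dots,D_d)$, and $-\Delta=\sum_jD_j^2$, so $-\Delta u_n=|n|^2u_n$. For $g\in C(\mathbb{S}^{d-1})$, $\pi_2(g)=g(\nabla/(-\Delta)^{1/2})$, i.e. $\pi_2(g)u_n=g(n/|n|)u_n$ for $n\neq0$, and $\pi_2(g)u_0=g(\omega_0)u_0$ for a fixed (arbitrary)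 point $\omega_0\in\mathbb{S}^{d-1}$. $\Pi(C(\mathbb{T}^d_\theta),C(\mathbb{S}^{d-1}))$ is the $C^*$-algebra of bounded operators on $L_2(\mathbb{T}^d_\theta)$ generated by $\pi_1(C(\mathbb{T}^d_\theta))$ and $\pi_2(C(\mathbb{S}^{d-1}))$. The map $\mathrm{sym}:\Pi(C(\mathbb{T}^d_\theta),C(\mathbb{S}^{d-1}))\to C(\mathbb{T}^d_\theta)\otimes_{\min}C(\mathbb{S}^{d-1})$ is the unique continuous $*$-homomorphism with $\mathrm{sym}(\pi_1(x))=x\otimes1$ and $\mathrm{sym}(\pi_2(g))=1\otimes g$. $\int_{\mathbb{S}^{d-1}}$ is integration with respect to the (unnormalised) surface measure, and $\tau_\theta\otimes\int_{\mathbb{S}^{d-1}}$ is the continuous extension of the tensor product functional to the minimal tensor product. For a separable Hilbert space $H$, $\mathcal{L}_{1,\infty}(H)$ is the ideal of compact operators whose singular values satisfy $\|T\|_{1,\infty}=\sup_{n\ge0}(n+1)\mu(n,T)<\infty$. A continuous trace on $\mathcal{L}_{1,\infty}(H)$ is a linear functional $\varphi$ with $\varphi([A,B])=0$ for all bounded $A$ and all $B\in\mathcal{L}_{1,\infty}(H)$, and $|\varphi(B)|\le C\|B\|_{1,\infty}$ for some constant $C$; it is normalised if $\varphi(\mathrm{diag}\{\frac1{n+1}\}_{n\ge0})=1$, where $\mathrm{diag}$ denotes the diagonal operator in some orthonormal basis. *)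

theory Defs
  imports "HOL-Analysis.Analysis"
begin

section \<open>Complex normed spaces, C*-algebras and Hilbert spaces\<close>

class complex_normed_vector = real_normed_vector +
  fixes scaleC :: "complex \<Rightarrow> 'a \<Rightarrow> 'a"  (infixr \<open>*\<^sub>C\<close> 75)
  assumes scaleC_add_right: "a *\<^sub>C (x + y) = a *\<^sub>C x + a *\<^sub>C y"
    and scaleC_add_left: "(a + b) *\<^sub>C x = a *\<^sub>C x + b *\<^sub>C x"
    and scaleC_scaleC [simp]: "a *\<^sub>C b *\<^sub>C x = (a * b) *\<^sub>C x"
    and scaleR_scaleC: "r *\<^sub>R x = complex_of_real r *\<^sub>C x"
    and norm_scaleC [simp]: "norm (a *\<^sub>C x) = norm a * norm x"

text \<open>Unital C*-algebras; the zero algebra is not excluded, hence \<^class>\<open>monoid_mult\<close>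
  rather than \<^class>\<open>real_normed_algebra_1\<close>.\<close>

class cstar_algebra = complex_normed_vector + banach + real_normed_algebra + monoid_mult +
  fixes star :: "'a \<Rightarrow> 'a"
  assumes mult_scaleC_left [simp]: "(a *\<^sub>C x) * y = a *\<^sub>C (x * y)"
    and mult_scaleC_right [simp]: "x * (a *\<^sub>C y) = a *\<^sub>C (x * y)"
    and star_add: "star (x + y) = star x + star y"
    and star_scaleC: "star (a *\<^sub>C x) = cnj a *\<^sub>C star x"
    and star_mult: "star (x * y) = star y * star x"
    and star_star [simp]: "star (star x) = x"
    and cstar_identity: "norm (star x * x) = (norm x)\<^sup>2"

text \<open>Inner products are conjugate-linear in the first argument.\<close>

class chilbert_space = complex_normed_vector + banach +
  fixes cinner :: "'a \<Rightarrow> 'a \<Rightarrow> complex"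
  assumes cinner_commute: "cinner x y = cnj (cinner y x)"
    and cinner_add_right: "cinner x (y + z) = cinner x y + cinner x z"
    and cinner_scaleC_right [simp]: "cinner x (a *\<^sub>C y) = a * cinner x y"
    and cinner_same: "cinner x x = complex_of_real ((norm x)\<^sup>2)"

lemma scaleC_one [simp]: "1 *\<^sub>C (x::'a::complex_normed_vector) = x"
  using scaleR_scaleC[of 1 x] by simp

lemma scaleC_zero_left [simp]: "0 *\<^sub>C (x::'a::complex_normed_vector) = 0"
  using scaleR_scaleC[of 0 x] by simp

lemma scaleC_zero_right [simp]: "a *\<^sub>C (0::'a::complex_normed_vector) = 0"
  using scaleC_add_right[of a 0 "0::'a"] by simp

lemma scaleC_minus_one: "(-1) *\<^sub>C (x::'a::complex_normed_vector) = - x"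
  using scaleR_scaleC[of "-1" x] by simp

lemma scaleC_minus_right: "a *\<^sub>C (- x) = - (a *\<^sub>C (x::'a::complex_normed_vector))"
  using scaleC_add_right[of a x "- x"] by (simp add: eq_neg_iff_add_eq_0 add.commute)

lemma scaleC_diff_right: "a *\<^sub>C (x - y) = a *\<^sub>C x - a *\<^sub>C (y::'a::complex_normed_vector)"
  using scaleC_add_right[of a x "- y"] by (simp add: scaleC_minus_right)

lemma bounded_linear_scaleC: "bounded_linear (\<lambda>x::'a::complex_normed_vector. a *\<^sub>C x)"
proof
  show "a *\<^sub>C (r *\<^sub>R x) = r *\<^sub>R (a *\<^sub>C x)" for r and x :: 'a
    by (simp add: scaleR_scaleC mult.commute)
  show "\<exists>K. \<forall>x::'a. norm (a *\<^sub>C x) \<le> norm x * K"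
    by (rule exI[of _ "norm a"]) (simp add: mult.commute)
qed (rule scaleC_add_right)

definition clinear :: "('a::complex_normed_vector \<Rightarrow> 'b::complex_normed_vector) \<Rightarrow> bool" where
  "clinear f \<longleftrightarrow> (\<forall>x y. f (x + y) = f x + f y) \<and> (\<forall>a x. f (a *\<^sub>C x) = a *\<^sub>C f x)"

definition bounded_clinear :: "('a::complex_normed_vector \<Rightarrow> 'b::complex_normed_vector) \<Rightarrow> bool" where
  "bounded_clinear f \<longleftrightarrow> clinear f \<and> (\<exists>K. \<forall>x. norm (f x) \<le> K * norm x)"

definition cspan :: "'a::complex_normed_vector set \<Rightarrow> 'a set" where
  "cspan X = {\<Sum>x\<in>F. a x *\<^sub>C x | F a. finite F \<and> F \<subseteq> X}"

definition star_subalgebra :: "'a::cstar_algebra set \<Rightarrow> bool" where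
  "star_subalgebra S \<longleftrightarrow> 0 \<in> S \<and> (\<forall>x\<in>S. \<forall>y\<in>S. x + y \<in> S \<and> x * y \<in> S) \<and>
     (\<forall>a. \<forall>x\<in>S. a *\<^sub>C x \<in> S) \<and> (\<forall>x\<in>S. star x \<in> S)"

definition cstar_generated :: "'a::cstar_algebra set \<Rightarrow> 'a set" where
  "cstar_generated X = \<Inter>{S. X \<subseteq> S \<and> star_subalgebra S \<and> closed S}"

definition star_hom_on :: "'a::cstar_algebra set \<Rightarrow> ('a \<Rightarrow> 'b::cstar_algebra) \<Rightarrow> bool" where
  "star_hom_on S f \<longleftrightarrow> (\<forall>x\<in>S. \<forall>y\<in>S. f (x + y) = f x + f y \<and> f (x * y) = f x * f y) \<and>
     (\<forall>a. \<forall>x\<in>S. f (a *\<^sub>C x) = a *\<^sub>C f x) \<and> (\<forall>x\<in>S. f (star x) = star (f x))"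

definition unitary_element :: "'a::cstar_algebra \<Rightarrow> bool" where
  "unitary_element x \<longleftrightarrow> star x * x = 1 \<and> x * star x = 1"

definition tracial_state :: "('a::cstar_algebra \<Rightarrow> complex) \<Rightarrow> bool" where
  "tracial_state \<tau> \<longleftrightarrow>
     (\<forall>x y. \<tau> (x + y) = \<tau> x + \<tau> y) \<and> (\<forall>a x. \<tau> (a *\<^sub>C x) = a * \<tau> x) \<and>
     (\<forall>x. \<tau> (star x * x) \<in> \<real> \<and> 0 \<le> Re (\<tau> (star x * x))) \<and> \<tau> 1 = 1 \<and>
     (\<forall>x y. \<tau> (x * y) = \<tau> (y * x))"


section \<open>Instances: complex numbers and continuous functions\<close>

instantiation complex :: cstar_algebra
begin

definition scaleC_complex :: "complex \<Rightarrow> complex \<Rightarrow> complex" where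
  "scaleC_complex a x = a * x"

definition star_complex :: "complex \<Rightarrow> complex" where
  "star_complex x = cnj x"

instance
  by standard
     (auto simp: scaleC_complex_def star_complex_def algebra_simps scaleR_conv_of_real norm_mult
                 power2_eq_square)

end

lemma scaleC_complex [simp]: "a *\<^sub>C (x::complex) = a * x"
  by (simp add: scaleC_complex_def)

lemma norm_star [simp]: "norm (star (x::'a::cstar_algebra)) = norm x"
proof -
  have le: "norm y \<le> norm (star y)" for y :: 'a
  proof (cases "y = 0")
    case False
    have "norm y * norm y \<le> norm (star y) * norm y"
      using norm_mult_ineq[of "star y" y] by (simp add: cstar_identity power2_eq_square)
    then show ?thesis
      using False by simp
  qed simp
  from le[of x] le[of "star x"] show ?thesis
    by simp
qed

lemma bounded_linear_star: "bounded_linear (star :: 'a::cstar_algebra \<Rightarrow> 'a)"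
proof
  show "star (r *\<^sub>R x) = r *\<^sub>R star x" for r and x :: 'a
    by (simp add: scaleR_scaleC star_scaleC)
  show "\<exists>K. \<forall>x::'a. norm (star x) \<le> norm x * K"
    by (rule exI[of _ 1]) simp
qed (rule star_add)

instance bcontfun :: (metric_space, banach) banach ..

text \<open>For a compact space \<^typ>\<open>'s\<close>, \<^typ>\<open>'s \<Rightarrow>\<^sub>C complex\<close> is the C*-algebra of all continuous
  functions with pointwise operations and the supremum norm.\<close>

instantiation bcontfun :: (metric_space, cstar_algebra) cstar_algebra
begin

definition scaleC_bcontfun :: "complex \<Rightarrow> ('a \<Rightarrow>\<^sub>C 'b) \<Rightarrow> 'a \<Rightarrow>\<^sub>C 'b" where
  "scaleC_bcontfun a f = Bcontfun (\<lambda>s. a *\<^sub>C apply_bcontfun f s)"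

definition times_bcontfun :: "('a \<Rightarrow>\<^sub>C 'b) \<Rightarrow> ('a \<Rightarrow>\<^sub>C 'b) \<Rightarrow> 'a \<Rightarrow>\<^sub>C 'b" where
  "times_bcontfun f g = Bcontfun (\<lambda>s. apply_bcontfun f s * apply_bcontfun g s)"

definition one_bcontfun :: "'a \<Rightarrow>\<^sub>C 'b" where
  "one_bcontfun = Bcontfun (\<lambda>_. 1)"

definition star_bcontfun :: "('a \<Rightarrow>\<^sub>C 'b) \<Rightarrow> 'a \<Rightarrow>\<^sub>C 'b" where
  "star_bcontfun f = Bcontfun (\<lambda>s. star (apply_bcontfun f s))"

lemma apply_bcontfun_scaleC [simp]:
  fixes f :: "'a \<Rightarrow>\<^sub>C 'b"
  shows "apply_bcontfun (a *\<^sub>C f) s = a *\<^sub>C apply_bcontfun f s"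
proof -
  have "continuous_on UNIV (\<lambda>s. a *\<^sub>C apply_bcontfun f s)"
    by (rule bounded_linear.continuous_on[OF bounded_linear_scaleC]) simp
  then have "(\<lambda>s. a *\<^sub>C apply_bcontfun f s) \<in> bcontfun"
    by (rule bcontfun_normI[where b = "norm a * norm f"])
       (simp add: mult_left_mono norm_bounded)
  then show ?thesis
    by (simp add: scaleC_bcontfun_def Bcontfun_inverse)
qed

lemma apply_bcontfun_times [simp]:
  fixes f g :: "'a \<Rightarrow>\<^sub>C 'b"
  shows "apply_bcontfun (f * g) s = apply_bcontfun f s * apply_bcontfun g s"
proof -
  have "norm (apply_bcontfun f s * apply_bcontfun g s) \<le> norm f * norm g" for s
    by (rule order_trans[OF norm_mult_ineq]) (simp add: mult_mono norm_bounded)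
  moreover have "continuous_on UNIV (\<lambda>s. apply_bcontfun f s * apply_bcontfun g s)"
    by (intro continuous_on_mult continuous_on_apply_bcontfun)
  ultimately have "(\<lambda>s. apply_bcontfun f s * apply_bcontfun g s) \<in> bcontfun"
    by (intro bcontfun_normI)
  then show ?thesis
    by (simp add: times_bcontfun_def Bcontfun_inverse)
qed

lemma apply_bcontfun_one [simp]: "apply_bcontfun (1 :: 'a \<Rightarrow>\<^sub>C 'b) s = 1"
  by (simp add: one_bcontfun_def Bcontfun_inverse const_bcontfun)

lemma apply_bcontfun_star [simp]:
  fixes f :: "'a \<Rightarrow>\<^sub>C 'b"
  shows "apply_bcontfun (star f) s = star (apply_bcontfun f s)"
proof -
  have "continuous_on UNIV (\<lambda>s. star (apply_bcontfun f s))"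
    by (rule bounded_linear.continuous_on[OF bounded_linear_star]) simp
  then have "(\<lambda>s. star (apply_bcontfun f s)) \<in> bcontfun"
    by (rule bcontfun_normI[where b = "norm f"]) (simp add: norm_bounded)
  then show ?thesis
    by (simp add: star_bcontfun_def Bcontfun_inverse)
qed

instance
proof
  fix a b :: complex and r :: real and f g h :: "'a \<Rightarrow>\<^sub>C 'b"
  show "a *\<^sub>C (f + g) = a *\<^sub>C f + a *\<^sub>C g" "(a + b) *\<^sub>C f = a *\<^sub>C f + b *\<^sub>C f"
    "a *\<^sub>C b *\<^sub>C f = (a * b) *\<^sub>C f" "r *\<^sub>R f = complex_of_real r *\<^sub>C f"
    by (auto intro!: bcontfun_eqI simp: scaleC_add_right scaleC_add_left scaleR_scaleC)
  show "f * g * h = f * (g * h)" "(f + g) * h = f * h + g * h" "f * (g + h) = f * g + f * h"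
    "r *\<^sub>R f * g = r *\<^sub>R (f * g)" "f * r *\<^sub>R g = r *\<^sub>R (f * g)"
    "1 * f = f" "f * 1 = f" "a *\<^sub>C f * g = a *\<^sub>C (f * g)" "f * a *\<^sub>C g = a *\<^sub>C (f * g)"
    by (auto intro!: bcontfun_eqI simp: algebra_simps)
  show "star (f + g) = star f + star g" "star (a *\<^sub>C f) = cnj a *\<^sub>C star f"
    "star (f * g) = star g * star f" "star (star f) = f"
    by (auto intro!: bcontfun_eqI simp: star_add star_scaleC star_mult)
  have le: "norm (c *\<^sub>C k) \<le> norm c * norm k" for c and k :: "'a \<Rightarrow>\<^sub>C 'b"
    by (rule norm_bound) (simp add: mult_left_mono norm_bounded)
  show "norm (a *\<^sub>C f) = norm a * norm f"
  proof (cases "a = 0")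
    case True
    then have "a *\<^sub>C f = 0"
      by (intro bcontfun_eqI) simp
    then show ?thesis
      using True by simp
  next
    case False
    have "inverse a *\<^sub>C a *\<^sub>C f = f"
      using False by (intro bcontfun_eqI) simp
    then have "norm f \<le> inverse (norm a) * norm (a *\<^sub>C f)"
      using le[of "inverse a" "a *\<^sub>C f"] by (simp add: norm_inverse)
    then have "norm a * norm f \<le> norm (a *\<^sub>C f)"
      using False by (simp add: field_simps)
    with le[of a f] show ?thesis
      by simp
  qed
  show times_le: "norm (f * g) \<le> norm f * norm g"
    by (rule norm_bound, simp, rule order_trans[OF norm_mult_ineq])
       (simp add: mult_mono norm_bounded)
  have le_star: "norm (star f) \<le> norm f"
    by (rule norm_bound) (simp add: norm_bounded)
  have "norm (star f * f) \<le> norm (star f) * norm f"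
    by (rule norm_bound, simp, rule order_trans[OF norm_mult_ineq])
       (metis apply_bcontfun_star mult_mono norm_bounded norm_ge_zero norm_star)
  also have "\<dots> \<le> (norm f)\<^sup>2"
    using le_star by (simp add: power2_eq_square mult_right_mono)
  finally have upper: "norm (star f * f) \<le> (norm f)\<^sup>2" .
  have "norm f \<le> sqrt (norm (star f * f))"
  proof (rule norm_bound)
    fix s
    have "(norm (apply_bcontfun f s))\<^sup>2 \<le> norm (star f * f)"
      using norm_bounded[of "star f * f" s] by (simp add: cstar_identity)
    then show "norm (apply_bcontfun f s) \<le> sqrt (norm (star f * f))"
      by (simp add: real_le_rsqrt)
  qed
  then have "(norm f)\<^sup>2 \<le> norm (star f * f)"
    by (metis norm_ge_zero power_mono real_sqrt_pow2)
  with upper show "norm (star f * f) = (norm f)\<^sup>2"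
    by simp
qed

end


section \<open>Bounded operators on a Hilbert space\<close>

lemma cinner_add_left: "cinner (x + y) (z::'a::chilbert_space) = cinner x z + cinner y z"
  by (metis cinner_commute cinner_add_right complex_cnj_add)

lemma cinner_scaleC_left [simp]: "cinner (a *\<^sub>C x) (z::'a::chilbert_space) = cnj a * cinner x z"
  by (metis cinner_commute cinner_scaleC_right complex_cnj_mult)

lemma cinner_minus_right: "cinner x (- y) = - cinner x (y::'a::chilbert_space)"
  using cinner_scaleC_right[of x "-1" y] by (simp add: scaleC_minus_one)

lemma cinner_minus_left: "cinner (- x) (y::'a::chilbert_space) = - cinner x y"
  using cinner_scaleC_left[of "-1" x y] by (simp add: scaleC_minus_one)

lemma cinner_diff_right: "cinner x (y - z) = cinner x y - cinner x (z::'a::chilbert_space)"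
  using cinner_add_right[of x y "- z"] by (simp add: cinner_minus_right)

lemma cinner_diff_left: "cinner (x - y) z = cinner x z - cinner y (z::'a::chilbert_space)"
  using cinner_add_left[of x "- y" z] by (simp add: cinner_minus_left)

lemma norm_add_sq: "(norm (x + y))\<^sup>2 = (norm x)\<^sup>2 + (norm y)\<^sup>2 + 2 * Re (cinner x (y::'a::chilbert_space))"
proof -
  have "cinner (x + y) (x + y) = cinner x x + cinner y y + (cinner x y + cnj (cinner x y))"
    by (simp add: cinner_add_left cinner_add_right cinner_commute[of y x])
  also have "\<dots> = complex_of_real ((norm x)\<^sup>2 + (norm y)\<^sup>2 + 2 * Re (cinner x y))"
    by (simp only: cinner_same complex_add_cnj of_real_add)
  finally show ?thesis
    unfolding cinner_same by (simp only: of_real_eq_iff)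
qed

lemma cinner_cauchy_schwarz: "norm (cinner x (y::'a::chilbert_space)) \<le> norm x * norm y"
proof (cases "x = 0")
  case True
  then show ?thesis
    using cinner_scaleC_left[of 0 x y] by simp
next
  case False
  define c where "c = cinner x y"
  define n where "n = (norm x)\<^sup>2"
  have n: "n > 0"
    using False by (simp add: n_def)
  have "0 \<le> (norm (y + (- c / n) *\<^sub>C x))\<^sup>2"
    by simp
  also have "\<dots> = (norm y)\<^sup>2 + (norm (- c / n) * norm x)\<^sup>2 + 2 * Re (cinner y ((- c / n) *\<^sub>C x))"
    by (simp only: norm_add_sq norm_scaleC)
  also have "cinner y ((- c / n) *\<^sub>C x) = complex_of_real (- (norm c)\<^sup>2 / n)"
    by (simp add: cinner_commute[of y x] c_def complex_mult_cnj cmod_power2 flip: of_real_power)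
       (simp add: add_divide_distrib diff_divide_distrib)
  also have "(norm (- c / n) * norm x)\<^sup>2 = (norm c)\<^sup>2 / n"
    using n by (simp add: norm_divide power_mult_distrib power_divide flip: n_def)
       (simp add: power2_eq_square)
  finally have "(norm c)\<^sup>2 / n \<le> (norm y)\<^sup>2"
    by simp
  then have "(norm c)\<^sup>2 \<le> (norm x * norm y)\<^sup>2"
    using n by (simp add: field_simps n_def power_mult_distrib)
  then show ?thesis
    by (simp add: c_def power2_le_iff_abs_le)
qed

lemma cinner_ext: "(\<And>z. cinner x z = cinner y z) \<Longrightarrow> x = (y::'a::chilbert_space)"
  using cinner_same[of "x - y"] by (simp add: cinner_diff_left)

lemma parallelogram:
  "(norm (x + y))\<^sup>2 + (norm (x - y))\<^sup>2 = 2 * (norm x)\<^sup>2 + 2 * (norm (y::'a::chilbert_space))\<^sup>2"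
  using norm_add_sq[of x y] norm_add_sq[of x "- y"] by (simp add: cinner_minus_right)

lemma riesz_representation:
  fixes f :: "'a::chilbert_space \<Rightarrow> complex"
  assumes bl: "bounded_linear f" and sc: "\<And>a x. f (a *\<^sub>C x) = a * f x"
  shows "\<exists>z. \<forall>x. f x = cinner z x"
proof (cases "\<forall>x. f x = 0")
  case True
  have "cinner 0 x = 0" for x :: 'a
    using cinner_scaleC_left[of 0 0 x] by simp
  with True show ?thesis
    by (intro exI[of _ 0]) simp
next
  case False
  interpret bounded_linear f by fact
  define M where "M = {x. f x = 1}"
  define \<delta> where "\<delta> = (INF x\<in>M. norm x)"
  obtain x0 where "f x0 \<noteq> 0"
    using False by blast
  then have "inverse (f x0) *\<^sub>C x0 \<in> M"
    by (simp add: M_def sc)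
  then have ne: "M \<noteq> {}"
    by blast
  have bdd: "bdd_below (norm ` M)"
    by (rule bdd_belowI[of _ 0]) auto
  have \<delta>_le: "\<delta> \<le> norm x" if "x \<in> M" for x
    unfolding \<delta>_def using bdd that by (rule cINF_lower)
  have \<delta>0: "0 \<le> \<delta>"
    unfolding \<delta>_def using ne by (intro cINF_greatest) auto
  have "\<exists>x\<in>M. norm x < \<delta> + inverse (Suc n)" for n
    using cINF_less_iff[OF ne bdd, of "\<delta> + inverse (Suc n)"] by (simp add: \<delta>_def)
  then obtain X where XM: "\<And>n. X n \<in> M" and X: "\<And>n. norm (X n) < \<delta> + inverse (Suc n)"
    by metis
  have half: "4 * \<delta>\<^sup>2 \<le> (norm (x + y))\<^sup>2" if "x \<in> M" "y \<in> M" for x y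
  proof -
    have "(1/2) *\<^sub>R (x + y) \<in> M"
      using that by (simp add: M_def add scaleR scaleR_conv_of_real)
    from \<delta>_le[OF this] have "2 * \<delta> \<le> norm (x + y)"
      by simp
    then have "(2 * \<delta>)\<^sup>2 \<le> (norm (x + y))\<^sup>2"
      using \<delta>0 by (intro power_mono) auto
    then show ?thesis
      by (simp add: power_mult_distrib)
  qed
  have lim: "(\<lambda>n. norm (X n)) \<longlonglongrightarrow> \<delta>"
  proof (rule tendsto_sandwich)
    show "\<forall>\<^sub>F n in sequentially. \<delta> \<le> norm (X n)"
      using \<delta>_le XM by simp
    show "\<forall>\<^sub>F n in sequentially. norm (X n) \<le> \<delta> + inverse (Suc n)"
      using X by (simp add: less_imp_le)
    show "(\<lambda>n. \<delta> + inverse (real (Suc n))) \<longlonglongrightarrow> \<delta>"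
      using tendsto_add[OF tendsto_const LIMSEQ_inverse_real_of_nat] by simp
  qed simp
  have "Cauchy X"
  proof (rule CauchyI)
    fix e :: real assume e: "0 < e"
    have "(\<lambda>n. (norm (X n))\<^sup>2) \<longlonglongrightarrow> \<delta>\<^sup>2"
      using lim by (rule tendsto_power)
    then have "\<forall>\<^sub>F n in sequentially. (norm (X n))\<^sup>2 < \<delta>\<^sup>2 + e\<^sup>2 / 4"
      by (rule order_tendstoD) (use e in simp)
    then obtain N where N: "\<And>n. n \<ge> N \<Longrightarrow> (norm (X n))\<^sup>2 < \<delta>\<^sup>2 + e\<^sup>2 / 4"
      by (auto simp: eventually_sequentially)
    show "\<exists>N. \<forall>m\<ge>N. \<forall>n\<ge>N. norm (X m - X n) < e"
    proof (intro exI allI impI)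
      fix m n assume "N \<le> m" "N \<le> n"
      then have "(norm (X m - X n))\<^sup>2 < e\<^sup>2"
        using parallelogram[of "X m" "X n"] half[OF XM XM, of m n] N[of m] N[of n] by simp
      then show "norm (X m - X n) < e"
        using e by (simp add: power2_less_imp_less)
    qed
  qed
  then obtain z where z: "X \<longlonglongrightarrow> z"
    using Cauchy_convergent convergent_def by blast
  have "norm z = \<delta>"
    using tendsto_norm[OF z] lim by (rule LIMSEQ_unique)
  have "(\<lambda>n. f (X n)) \<longlonglongrightarrow> f z"
    using z by (rule tendsto)
  then have fz: "f z = 1"
    using XM by (simp add: M_def LIMSEQ_const_iff)
  then have z0: "z \<noteq> 0"
    by auto
  have orth: "cinner z y = 0" if "f y = 0" for y
  proof (rule ccontr)
    assume *: "cinner z y \<noteq> 0"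
    define c where "c = cinner z y"
    define n where "n = (norm y)\<^sup>2"
    have "y \<noteq> 0"
      using * cinner_scaleC_right[of z 0 y] by auto
    then have n: "n > 0"
      by (simp add: n_def)
    define w where "w = (- cnj c / n) *\<^sub>C y"
    have "z + w \<in> M"
      using fz that by (simp add: M_def w_def add sc)
    then have "(norm z)\<^sup>2 \<le> (norm (z + w))\<^sup>2"
      using \<delta>_le \<open>norm z = \<delta>\<close> \<delta>0 by (intro power_mono) auto
    also have "\<dots> = (norm z)\<^sup>2 + (norm w)\<^sup>2 + 2 * Re (cinner z w)"
      by (rule norm_add_sq)
    also have "cinner z w = complex_of_real (- (norm c)\<^sup>2 / n)"
      by (simp add: w_def complex_mult_cnj cmod_power2 mult.commute flip: c_def of_real_power)
         (simp add: add_divide_distrib diff_divide_distrib)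
    also have "(norm w)\<^sup>2 = (norm c)\<^sup>2 / n"
      using n by (simp add: w_def norm_divide power_mult_distrib power_divide flip: n_def)
         (simp add: power2_eq_square)
    finally have "(norm c)\<^sup>2 / n \<le> 0"
      by simp
    then show False
      using n * by (simp add: c_def divide_le_0_iff)
  qed
  show ?thesis
  proof (intro exI allI)
    fix x
    have "cinner z (x - f x *\<^sub>C z) = 0"
      by (rule orth) (simp add: diff sc fz)
    then have "cinner z x = f x * complex_of_real ((norm z)\<^sup>2)"
      by (simp add: cinner_diff_right cinner_same)
    then show "f x = cinner (complex_of_real (inverse ((norm z)\<^sup>2)) *\<^sub>C z) x"
      using z0 by simp
  qed
qed

typedef (overloaded) 'h bop =
  "{A :: 'h::complex_normed_vector \<Rightarrow>\<^sub>L 'h. \<forall>a x. A (a *\<^sub>C x) = a *\<^sub>C A x}"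
  by (rule exI[of _ 0]) simp

setup_lifting type_definition_bop

lift_definition bop_apply :: "'h::complex_normed_vector bop \<Rightarrow> 'h \<Rightarrow> 'h"
  is blinfun_apply .

lemma bop_eqI: "(\<And>x. bop_apply A x = bop_apply B x) \<Longrightarrow> A = B"
  by transfer (rule blinfun_eqI)

lemma Rep_bop_scaleC: "Rep_bop A (a *\<^sub>C x) = a *\<^sub>C Rep_bop A x"
  using Rep_bop[of A] by simp

lemma bop_apply_scaleC [simp]: "bop_apply A (a *\<^sub>C x) = a *\<^sub>C bop_apply A x"
  by transfer simp

lemma bounded_linear_bop_apply: "bounded_linear (bop_apply A)"
  by transfer (rule blinfun.bounded_linear_right)

instantiation bop :: (complex_normed_vector) complex_normed_vector
begin

lift_definition norm_bop :: "'a bop \<Rightarrow> real" is norm .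
lift_definition zero_bop :: "'a bop" is 0 by simp
lift_definition plus_bop :: "'a bop \<Rightarrow> 'a bop \<Rightarrow> 'a bop" is "(+)"
  by (simp add: blinfun.add_left scaleC_add_right)
lift_definition minus_bop :: "'a bop \<Rightarrow> 'a bop \<Rightarrow> 'a bop" is "(-)"
  by (simp add: blinfun.diff_left scaleC_diff_right)
lift_definition uminus_bop :: "'a bop \<Rightarrow> 'a bop" is uminus
  by (simp add: blinfun.minus_left scaleC_minus_right)
lift_definition scaleR_bop :: "real \<Rightarrow> 'a bop \<Rightarrow> 'a bop" is scaleR
  by (simp add: blinfun.scaleR_left scaleR_scaleC mult.commute)
lift_definition scaleC_bop :: "complex \<Rightarrow> 'a bop \<Rightarrow> 'a bop"
  is "\<lambda>a A. Blinfun (\<lambda>x. a *\<^sub>C blinfun_apply A x)"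
  by (subst (1 2) bounded_linear_Blinfun_apply)
     (auto intro: bounded_linear_compose[OF bounded_linear_scaleC blinfun.bounded_linear_right]
           simp: mult.commute)

definition dist_bop :: "'a bop \<Rightarrow> 'a bop \<Rightarrow> real" where
  "dist_bop A B = norm (A - B)"
definition sgn_bop :: "'a bop \<Rightarrow> 'a bop" where
  "sgn_bop A = inverse (norm A) *\<^sub>R A"
definition uniformity_bop :: "('a bop \<times> 'a bop) filter" where
  "uniformity_bop = (INF e\<in>{0 <..}. principal {(x, y). dist x y < e})"
definition open_bop :: "'a bop set \<Rightarrow> bool" where
  "open_bop S \<longleftrightarrow> (\<forall>x\<in>S. \<forall>\<^sub>F (x', y) in uniformity. x' = x \<longrightarrow> y \<in> S)"

lemma bop_apply_scaleC_left [simp]: "bop_apply (a *\<^sub>C A) x = a *\<^sub>C bop_apply A x" for A :: "'a bop"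
  by transfer
     (subst bounded_linear_Blinfun_apply,
      auto intro: bounded_linear_compose[OF bounded_linear_scaleC blinfun.bounded_linear_right])

lemma bop_apply_add [simp]: "bop_apply (A + B) x = bop_apply A x + bop_apply B x" for A :: "'a bop"
  by transfer (rule blinfun.add_left)

lemma bop_apply_scaleR [simp]: "bop_apply (r *\<^sub>R A) x = r *\<^sub>R bop_apply A x" for A :: "'a bop"
  by transfer (rule blinfun.scaleR_left)

lemma norm_bop_apply: "norm (bop_apply A x) \<le> norm A * norm x" for A :: "'a bop"
  by transfer (rule norm_blinfun)

lemma norm_bop_bound:
  "0 \<le> b \<Longrightarrow> (\<And>x. norm (bop_apply A x) \<le> b * norm x) \<Longrightarrow> norm A \<le> b" for A :: "'a bop"
  by transfer (rule norm_blinfun_bound)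

instance
proof
  fix a b :: complex and r s :: real and A B C :: "'a bop"
  show "A + B + C = A + (B + C)" "A + B = B + A" "0 + A = A" "- A + A = 0" "A - B = A + - B"
    by (transfer, simp)+
  show "r *\<^sub>R (A + B) = r *\<^sub>R A + r *\<^sub>R B" "(r + s) *\<^sub>R A = r *\<^sub>R A + s *\<^sub>R A"
    "r *\<^sub>R s *\<^sub>R A = (r * s) *\<^sub>R A" "1 *\<^sub>R A = A"
    by (transfer, simp add: algebra_simps)+
  show "norm A = 0 \<longleftrightarrow> A = 0" "norm (A + B) \<le> norm A + norm B" "norm (r *\<^sub>R A) = \<bar>r\<bar> * norm A"
    by (transfer, simp add: norm_triangle_ineq)+
  show "a *\<^sub>C (A + B) = a *\<^sub>C A + a *\<^sub>C B" "(a + b) *\<^sub>C A = a *\<^sub>C A + b *\<^sub>C A"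
    "a *\<^sub>C b *\<^sub>C A = (a * b) *\<^sub>C A" "r *\<^sub>R A = complex_of_real r *\<^sub>C A"
    by (auto intro!: bop_eqI simp: scaleC_add_right scaleC_add_left scaleR_scaleC)
  have le: "norm (c *\<^sub>C D) \<le> norm c * norm D" for c and D :: "'a bop"
  proof (rule norm_bop_bound)
    show "0 \<le> norm c * norm D"
      by (simp add: norm_bop.rep_eq)
    have "norm (bop_apply (c *\<^sub>C D) x) = norm c * norm (bop_apply D x)" for x
      by simp
    also have "\<dots> x \<le> norm c * (norm D * norm x)" for x
      by (intro mult_left_mono norm_bop_apply norm_ge_zero)
    finally show "norm (bop_apply (c *\<^sub>C D) x) \<le> norm c * norm D * norm x" for x
      by (simp add: mult.assoc)
  qed
  show "norm (a *\<^sub>C A) = norm a * norm A"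
  proof (cases "a = 0")
    case True
    then show ?thesis
      using le[of a A] by (simp add: norm_bop.rep_eq)
  next
    case False
    have "inverse a *\<^sub>C a *\<^sub>C A = A"
      using False by (intro bop_eqI) simp
    then have "norm A \<le> inverse (norm a) * norm (a *\<^sub>C A)"
      using le[of "inverse a" "a *\<^sub>C A"] by (simp add: norm_inverse)
    then have "norm a * norm A \<le> norm (a *\<^sub>C A)"
      using False by (simp add: field_simps)
    with le[of a A] show ?thesis
      by simp
  qed
qed (simp_all add: dist_bop_def sgn_bop_def uniformity_bop_def open_bop_def)

end

instance bop :: (chilbert_space) banach
proof
  fix X :: "nat \<Rightarrow> 'a bop"
  assume X: "Cauchy X"
  have dist: "dist (Rep_bop A) (Rep_bop B) = dist A B" for A B :: "'a bop"
    by (simp add: dist_norm norm_bop.rep_eq minus_bop.rep_eq)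
  have "Cauchy (\<lambda>n. Rep_bop (X n))"
    using X by (simp add: Cauchy_def dist)
  then obtain L where L: "(\<lambda>n. Rep_bop (X n)) \<longlonglongrightarrow> L"
    using Cauchy_convergent convergent_def by blast
  have lim: "(\<lambda>n. Rep_bop (X n) x) \<longlonglongrightarrow> L x" for x
    by (rule bounded_linear.tendsto[OF blinfun.bounded_linear_left L])
  have "L (a *\<^sub>C x) = a *\<^sub>C L x" for a x
  proof (rule LIMSEQ_unique)
    show "(\<lambda>n. Rep_bop (X n) (a *\<^sub>C x)) \<longlonglongrightarrow> L (a *\<^sub>C x)"
      by (rule lim)
    have "(\<lambda>n. a *\<^sub>C Rep_bop (X n) x) \<longlonglongrightarrow> a *\<^sub>C L x"
      by (rule bounded_linear.tendsto[OF bounded_linear_scaleC lim])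
    then show "(\<lambda>n. Rep_bop (X n) (a *\<^sub>C x)) \<longlonglongrightarrow> a *\<^sub>C L x"
      by (simp add: Rep_bop_scaleC)
  qed
  then have "Rep_bop (Abs_bop L) = L"
    by (simp add: Abs_bop_inverse)
  then have "dist (X n) (Abs_bop L) = dist (Rep_bop (X n)) L" for n
    by (simp flip: dist)
  with L have "X \<longlonglongrightarrow> Abs_bop L"
    by (simp add: tendsto_iff)
  then show "convergent X"
    by (rule convergentI)
qed

lemma adjoint_exists: "\<exists>B :: 'h::chilbert_space bop. \<forall>x y. cinner (bop_apply B x) y = cinner x (bop_apply A y)"
proof -
  have "\<exists>z. \<forall>y. cinner x (bop_apply A y) = cinner z y" for x
  proof (rule riesz_representation)
    interpret A: bounded_linear "bop_apply A"
      by (rule bounded_linear_bop_apply)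
    show "bounded_linear (\<lambda>y. cinner x (bop_apply A y))"
    proof
      fix r :: real and y z
      show "cinner x (bop_apply A (y + z)) = cinner x (bop_apply A y) + cinner x (bop_apply A z)"
        by (simp add: A.add cinner_add_right)
      show "cinner x (bop_apply A (r *\<^sub>R y)) = r *\<^sub>R cinner x (bop_apply A y)"
        by (simp add: scaleR_scaleC)
      have "norm (cinner x (bop_apply A y)) \<le> norm y * (norm x * norm A)" for y
      proof -
        have "norm (cinner x (bop_apply A y)) \<le> norm x * norm (bop_apply A y)"
          by (rule cinner_cauchy_schwarz)
        also have "\<dots> \<le> norm x * (norm A * norm y)"
          by (intro mult_left_mono norm_bop_apply norm_ge_zero)
        finally show ?thesis
          by (simp add: mult_ac)
      qed
      then show "\<exists>K. \<forall>y. norm (cinner x (bop_apply A y)) \<le> norm y * K"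
        by blast
    qed
  qed simp
  then obtain f where f: "\<And>x y. cinner x (bop_apply A y) = cinner (f x) y"
    by metis
  have scale: "f (a *\<^sub>C x) = a *\<^sub>C f x" for a x
    by (rule cinner_ext) (simp flip: f)
  have bl: "bounded_linear f"
  proof
    fix r :: real and x y
    show "f (x + y) = f x + f y"
      by (rule cinner_ext) (simp add: cinner_add_left flip: f)
    show "f (r *\<^sub>R x) = r *\<^sub>R f x"
      by (simp add: scaleR_scaleC scale)
    have "norm (f x) \<le> norm x * norm A" for x
    proof (cases "f x = 0")
      case False
      have "(norm (f x))\<^sup>2 = norm (cinner x (bop_apply A (f x)))"
        by (simp add: f cinner_same norm_power)
      also have "\<dots> \<le> norm x * norm (bop_apply A (f x))"
        by (rule cinner_cauchy_schwarz)
      also have "\<dots> \<le> norm x * (norm A * norm (f x))"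
        by (intro mult_left_mono norm_bop_apply norm_ge_zero)
      finally have "norm (f x) * norm (f x) \<le> (norm x * norm A) * norm (f x)"
        by (simp add: power2_eq_square mult_ac)
      then show ?thesis
        using False by simp
    qed simp
    then show "\<exists>K. \<forall>x. norm (f x) \<le> norm x * K"
      by blast
  qed
  have "bop_apply (Abs_bop (Blinfun f)) = f"
    using scale by (simp add: bop_apply.rep_eq Abs_bop_inverse bounded_linear_Blinfun_apply[OF bl])
  then show ?thesis
    by (intro exI[of _ "Abs_bop (Blinfun f)"]) (simp add: f)
qed

instantiation bop :: (chilbert_space) cstar_algebra
begin

lift_definition one_bop :: "'a bop" is id_blinfun by simp
lift_definition times_bop :: "'a bop \<Rightarrow> 'a bop \<Rightarrow> 'a bop" is blinfun_compose by simp

definition star_bop :: "'a bop \<Rightarrow> 'a bop" where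
  "star_bop A = (THE B. \<forall>x y. cinner (bop_apply B x) y = cinner x (bop_apply A y))"

lemma bop_apply_one [simp]: "bop_apply (1 :: 'a bop) x = x"
  by transfer simp

lemma bop_apply_times [simp]: "bop_apply (A * B) x = bop_apply A (bop_apply B x)" for A :: "'a bop"
  by transfer simp

lemma norm_bop_times: "norm (A * B) \<le> norm A * norm B" for A :: "'a bop"
  by transfer (rule norm_blinfun_compose)

lemma cinner_star: "cinner (bop_apply (star A) x) y = cinner x (bop_apply A y)" for A :: "'a bop"
proof -
  obtain B :: "'a bop" where B: "\<forall>x y. cinner (bop_apply B x) y = cinner x (bop_apply A y)"
    using adjoint_exists by blast
  have "star A = B"
    unfolding star_bop_def
  proof (rule the_equality)
    fix C :: "'a bop"
    assume C: "\<forall>x y. cinner (bop_apply C x) y = cinner x (bop_apply A y)"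
    show "C = B"
      by (rule bop_eqI, rule cinner_ext) (simp only: B[rule_format] C[rule_format])
  qed (rule B)
  then show ?thesis
    by (simp only: B[rule_format])
qed

lemma cinner_star_right: "cinner x (bop_apply (star A) y) = cinner (bop_apply A x) y" for A :: "'a bop"
  by (metis cinner_commute cinner_star)

lemma bop_star_eqI: "(\<And>x y. cinner (bop_apply B x) y = cinner x (bop_apply A y)) \<Longrightarrow> star A = B"
  for A :: "'a bop"
  by (intro bop_eqI cinner_ext) (simp add: cinner_star)

instance
proof
  fix a :: complex and r :: real and A B C :: "'a bop"
  interpret A: bounded_linear "bop_apply A"
    by (rule bounded_linear_bop_apply)
  show "A * B * C = A * (B * C)" "1 * A = A" "A * 1 = A" "(A + B) * C = A * C + B * C"
    "A * (B + C) = A * B + A * C" "r *\<^sub>R A * B = r *\<^sub>R (A * B)" "A * r *\<^sub>R B = r *\<^sub>R (A * B)"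
    "a *\<^sub>C A * B = a *\<^sub>C (A * B)" "A * a *\<^sub>C B = a *\<^sub>C (A * B)"
    by (auto intro!: bop_eqI simp: A.add A.scaleR)
  show "norm (A * B) \<le> norm A * norm B"
    by (rule norm_bop_times)
  show "star (A + B) = star A + star B"
    by (rule bop_star_eqI) (simp add: cinner_add_left cinner_add_right cinner_star)
  show "star (a *\<^sub>C A) = cnj a *\<^sub>C star A"
    by (rule bop_star_eqI) (simp add: cinner_star)
  show "star (A * B) = star B * star A"
    by (rule bop_star_eqI) (simp add: cinner_star)
  show "star (star A) = A"
    by (rule bop_star_eqI) (simp add: cinner_star_right)
  have star_le: "norm (star D) \<le> norm D" and sq: "(norm D)\<^sup>2 \<le> norm (star D * D)" for D :: "'a bop"
  proof -
    have "norm (bop_apply D x) \<le> sqrt (norm (star D * D)) * norm x" for x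
    proof -
      have "(norm (bop_apply D x))\<^sup>2 = norm (cinner (bop_apply (star D * D) x) x)"
        by (simp add: cinner_star cinner_same norm_power)
      also have "\<dots> \<le> norm (bop_apply (star D * D) x) * norm x"
        by (rule cinner_cauchy_schwarz)
      also have "\<dots> \<le> (norm (star D * D) * norm x) * norm x"
        by (intro mult_right_mono norm_bop_apply norm_ge_zero)
      finally have "norm (bop_apply D x) \<le> sqrt (norm (star D * D) * (norm x)\<^sup>2)"
        by (intro real_le_rsqrt) (simp add: power2_eq_square mult.assoc)
      then show ?thesis
        by (simp add: real_sqrt_mult)
    qed
    then have "norm D \<le> sqrt (norm (star D * D))"
      by (intro norm_bop_bound) auto
    then show "(norm D)\<^sup>2 \<le> norm (star D * D)"
      by (metis norm_ge_zero power_mono real_sqrt_pow2)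
    show "norm (star D) \<le> norm D"
    proof (rule norm_bop_bound)
      fix x
      show "norm (bop_apply (star D) x) \<le> norm D * norm x"
      proof (cases "bop_apply (star D) x = 0")
        case False
        let ?y = "bop_apply (star D) x"
        have "(norm ?y)\<^sup>2 = norm (cinner x (bop_apply D ?y))"
          by (simp add: cinner_same norm_power flip: cinner_star)
        also have "\<dots> \<le> norm x * norm (bop_apply D ?y)"
          by (rule cinner_cauchy_schwarz)
        also have "\<dots> \<le> norm x * (norm D * norm ?y)"
          by (intro mult_left_mono norm_bop_apply norm_ge_zero)
        finally have "norm ?y * norm ?y \<le> (norm D * norm x) * norm ?y"
          by (simp add: power2_eq_square mult_ac)
        then show ?thesis
          using False by simp
      qed simp
    qed simp
  qed
  have "norm (star A * A) \<le> norm (star A) * norm A"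
    by (rule norm_bop_times)
  also have "\<dots> \<le> (norm A)\<^sup>2"
    using star_le by (simp add: power2_eq_square mult_right_mono)
  finally show "norm (star A * A) = (norm A)\<^sup>2"
    using sq[of A] by (rule antisym)
qed

end


text \<open>\<open>diag_op e f\<close> is the operator that is diagonal in the orthonormal basis \<open>e\<close>
  with (bounded) eigenvalues \<open>f\<close>.\<close>

definition orthonormal_basis :: "('i \<Rightarrow> 'h::chilbert_space) \<Rightarrow> bool" where
  "orthonormal_basis e \<longleftrightarrow>
     (\<forall>i j. cinner (e i) (e j) = (if i = j then 1 else 0)) \<and> closure (cspan (range e)) = UNIV"

definition diag_op :: "('i \<Rightarrow> 'h::chilbert_space) \<Rightarrow> ('i \<Rightarrow> complex) \<Rightarrow> 'h bop" where
  "diag_op e f = (THE A. \<forall>i. bop_apply A (e i) = f i *\<^sub>C e i)"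


section \<open>Traces on the weak trace class\<close>

definition rank_le :: "nat \<Rightarrow> 'h::chilbert_space bop \<Rightarrow> bool" where
  "rank_le n A \<longleftrightarrow> (\<exists>F. finite F \<and> card F \<le> n \<and> range (bop_apply A) \<subseteq> cspan F)"

definition singular_value :: "nat \<Rightarrow> 'h::chilbert_space bop \<Rightarrow> real" where
  "singular_value n A = (INF R\<in>{R. rank_le n R}. norm (A - R))"

definition compact_operator :: "'h::chilbert_space bop \<Rightarrow> bool" where
  "compact_operator A \<longleftrightarrow> compact (closure (bop_apply A ` cball 0 1))"

definition weak_trace_class :: "'h::chilbert_space bop set" where
  "weak_trace_class =
     {A. compact_operator A \<and> bdd_above (range (\<lambda>n. real (n + 1) * singular_value n A))}"

definition weak_norm :: "'h::chilbert_space bop \<Rightarrow> real" where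
  "weak_norm A = (SUP n. real (n + 1) * singular_value n A)"

text \<open>Traces live on \<open>weak_trace_class\<close>; their values elsewhere are irrelevant.\<close>

definition continuous_trace :: "('h::chilbert_space bop \<Rightarrow> complex) \<Rightarrow> bool" where
  "continuous_trace \<phi> \<longleftrightarrow>
     (\<forall>A\<in>weak_trace_class. \<forall>B\<in>weak_trace_class. \<phi> (A + B) = \<phi> A + \<phi> B) \<and>
     (\<forall>a. \<forall>A\<in>weak_trace_class. \<phi> (a *\<^sub>C A) = a * \<phi> A) \<and>
     (\<forall>A. \<forall>B\<in>weak_trace_class. \<phi> (A * B - B * A) = 0) \<and>
     (\<exists>C. \<forall>B\<in>weak_trace_class. norm (\<phi> B) \<le> C * weak_norm B)"

definition normalised_trace :: "('h::chilbert_space bop \<Rightarrow> complex) \<Rightarrow> bool" where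
  "normalised_trace \<phi> \<longleftrightarrow>
     (\<exists>e :: nat \<Rightarrow> 'h. orthonormal_basis e \<and>
        \<phi> (diag_op e (\<lambda>n. complex_of_real (1 / real (n + 1)))) = 1)"


section \<open>The sphere and its surface measure\<close>

typedef 'd sphere = "{x :: real ^ 'd::finite. norm x = 1}"
  by (rule exI[of _ "axis undefined 1"]) simp

instantiation sphere :: (finite) metric_space
begin

definition dist_sphere :: "'a sphere \<Rightarrow> 'a sphere \<Rightarrow> real" where
  "dist_sphere x y = dist (Rep_sphere x) (Rep_sphere y)"
definition uniformity_sphere :: "('a sphere \<times> 'a sphere) filter" where
  "uniformity_sphere = (INF e\<in>{0 <..}. principal {(x, y). dist x y < e})"
definition open_sphere :: "'a sphere set \<Rightarrow> bool" where
  "open_sphere S \<longleftrightarrow> (\<forall>x\<in>S. \<forall>\<^sub>F (x', y) in uniformity. x' = x \<longrightarrow> y \<in> S)"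

instance
  by standard
     (simp_all add: dist_sphere_def uniformity_sphere_def open_sphere_def Rep_sphere_inject
        dist_triangle2)

end

definition direction :: "real ^ 'd::finite \<Rightarrow> 'd sphere" where
  "direction x = Abs_sphere (x /\<^sub>R norm x)"

text \<open>Polar coordinates: the unnormalised surface measure of a Borel set is \<open>d\<close> times the Lebesgue
  measure of the cone over it inside the unit ball.\<close>

definition surface_measure :: "'d::finite sphere measure" where
  "surface_measure =
     scale_measure (of_nat CARD('d)) (distr (restrict_space lborel (ball 0 1 - {0})) borel direction)"

type_synonym 'd csphere = "'d sphere \<Rightarrow>\<^sub>C complex"


section \<open>The noncommutative torus\<close>

definition real_vec :: "int ^ 'd::finite \<Rightarrow> real ^ 'd" where
  "real_vec n = (\<chi> j. real_of_int (n $ j))"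

definition twist :: "real ^ 'd ^ 'd::finite \<Rightarrow> int ^ 'd \<Rightarrow> int ^ 'd \<Rightarrow> complex" where
  "twist \<theta> n m = exp (\<i> / 2 * complex_of_real (real_vec n \<bullet> (\<theta> *v real_vec m)))"

text \<open>
  For antisymmetric \<open>\<theta>\<close>, unitaries with \<open>u n * u m = twist \<theta> n m *\<^sub>C u (n + m)\<close> satisfy
  \<open>u 0 = 1\<close> and \<open>star (u n) = u (- n)\<close>.  Hence the universal *-algebra on these generators and
  relations consists of the finitely supported families of coefficients
  \<open>c\<close>, standing for \<open>\<Sum>k. c k *\<^sub>C u k\<close>, with the following product and involution.
\<close>

definition coeff_mult ::
    "real ^ 'd ^ 'd::finite \<Rightarrow> (int ^ 'd \<Rightarrow> complex) \<Rightarrow> (int ^ 'd \<Rightarrow> complex) \<Rightarrow> int ^ 'd \<Rightarrow> complex" where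
  "coeff_mult \<theta> a b k = (\<Sum>n | a n \<noteq> 0. a n * b (k - n) * twist \<theta> n (k - n))"

definition coeff_star :: "(int ^ 'd::finite \<Rightarrow> complex) \<Rightarrow> int ^ 'd \<Rightarrow> complex" where
  "coeff_star a k = cnj (a (- k))"

definition finite_support :: "('i \<Rightarrow> complex) \<Rightarrow> bool" where
  "finite_support a \<longleftrightarrow> finite {k. a k \<noteq> 0}"

definition torus_cstar_seminorm ::
    "real ^ 'd ^ 'd::finite \<Rightarrow> ((int ^ 'd \<Rightarrow> complex) \<Rightarrow> real) \<Rightarrow> bool" where
  "torus_cstar_seminorm \<theta> p \<longleftrightarrow>
     (\<forall>a. finite_support a \<longrightarrow>
        0 \<le> p a \<and> (\<forall>z. p (\<lambda>k. z * a k) = norm z * p a) \<and>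
        p (coeff_mult \<theta> (coeff_star a) a) = (p a)\<^sup>2 \<and>
        (\<forall>b. finite_support b \<longrightarrow>
           p (\<lambda>k. a k + b k) \<le> p a + p b \<and> p (coeff_mult \<theta> a b) \<le> p a * p b))"

definition torus_poly :: "(int ^ 'd::finite \<Rightarrow> 'a::complex_normed_vector) \<Rightarrow> (int ^ 'd \<Rightarrow> complex) \<Rightarrow> 'a" where
  "torus_poly u a = (\<Sum>k | a k \<noteq> 0. a k *\<^sub>C u k)"

text \<open>The type \<open>'a\<close> together with \<open>u\<close> is the universal C*-algebra generated by the unitaries
  \<open>u n\<close> subject to the relations.  As usual, universality means that the norm
  dominates every C*-seminorm of the universal *-algebra, i.e. that every *-homomorphism of the latter
  into a C*-algebra extends to \<open>'a\<close>.\<close>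

definition noncommutative_torus ::
    "real ^ 'd ^ 'd::finite \<Rightarrow> (int ^ 'd \<Rightarrow> 'a::cstar_algebra) \<Rightarrow> bool" where
  "noncommutative_torus \<theta> u \<longleftrightarrow>
     (\<forall>n. unitary_element (u n)) \<and>
     (\<forall>n m. u n * u m = twist \<theta> n m *\<^sub>C u (n + m)) \<and>
     cstar_generated (range u) = UNIV \<and>
     (\<forall>p. torus_cstar_seminorm \<theta> p \<longrightarrow> (\<forall>a. finite_support a \<longrightarrow> p a \<le> norm (torus_poly u a)))"

definition torus_trace :: "(int ^ 'd::finite \<Rightarrow> 'a::cstar_algebra) \<Rightarrow> ('a \<Rightarrow> complex) \<Rightarrow> bool" where
  "torus_trace u \<tau> \<longleftrightarrow> tracial_state \<tau> \<and> bounded_clinear \<tau> \<and>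
     (\<forall>a. finite_support a \<longrightarrow> \<tau> (torus_poly u a) = a 0)"

text \<open>\<open>'h\<close> is the GNS Hilbert space of \<open>\<tau>\<close>; \<open>\<Lambda> x\<close> is the vector given by \<open>x\<close>.\<close>

definition gns_space :: "('a::cstar_algebra \<Rightarrow> complex) \<Rightarrow> ('a \<Rightarrow> 'h::chilbert_space) \<Rightarrow> bool" where
  "gns_space \<tau> \<Lambda> \<longleftrightarrow> clinear \<Lambda> \<and> (\<forall>x y. cinner (\<Lambda> x) (\<Lambda> y) = \<tau> (star x * y)) \<and>
     closure (range \<Lambda>) = UNIV"

definition left_mult_op :: "('a::cstar_algebra \<Rightarrow> 'h::chilbert_space) \<Rightarrow> 'a \<Rightarrow> 'h bop" where
  "left_mult_op \<Lambda> x = (THE A. \<forall>y. bop_apply A (\<Lambda> y) = \<Lambda> (x * y))"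

text \<open>\<open>f(\<nabla>)\<close> for bounded \<open>f\<close>, i.e. the joint functional calculus of the operators
  \<open>D j\<close> with \<open>D j (u n) = n j u n\<close>; the unitaries \<open>u n\<close> are regarded as elements
  \<open>\<Lambda> (u n)\<close> of the GNS space.\<close>

definition nabla_calculus ::
    "('a::cstar_algebra \<Rightarrow> 'h::chilbert_space) \<Rightarrow> (int ^ 'd::finite \<Rightarrow> 'a) \<Rightarrow>
     (real ^ 'd \<Rightarrow> complex) \<Rightarrow> 'h bop" where
  "nabla_calculus \<Lambda> u f = diag_op (\<lambda>n. \<Lambda> (u n)) (\<lambda>n. f (real_vec n))"

definition homogeneous_op ::
    "('a::cstar_algebra \<Rightarrow> 'h::chilbert_space) \<Rightarrow> (int ^ 'd::finite \<Rightarrow> 'a) \<Rightarrow> 'd sphere \<Rightarrow>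
     'd csphere \<Rightarrow> 'h bop" where
  "homogeneous_op \<Lambda> u \<omega>\<^sub>0 g =
     nabla_calculus \<Lambda> u (\<lambda>\<xi>. apply_bcontfun g (if \<xi> = 0 then \<omega>\<^sub>0 else direction \<xi>))"

text \<open>\<open>(1 - \<Delta>)\<close> to the power \<open>-d/2\<close>, where \<open>-\<Delta>\<close> is the sum of the squares of the \<open>D j\<close>.\<close>

definition bessel_op ::
    "('a::cstar_algebra \<Rightarrow> 'h::chilbert_space) \<Rightarrow> (int ^ 'd::finite \<Rightarrow> 'a) \<Rightarrow> 'h bop" where
  "bessel_op \<Lambda> u = nabla_calculus \<Lambda> u
     (\<lambda>\<xi>. complex_of_real ((1 + (\<Sum>j\<in>UNIV. (\<xi> $ j)\<^sup>2)) powr (- real CARD('d) / 2)))"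

definition symbol_algebra ::
    "('a::cstar_algebra \<Rightarrow> 'h::chilbert_space) \<Rightarrow> (int ^ 'd::finite \<Rightarrow> 'a) \<Rightarrow> 'd sphere \<Rightarrow> 'h bop set" where
  "symbol_algebra \<Lambda> u \<omega>\<^sub>0 =
     cstar_generated (range (left_mult_op \<Lambda>) \<union> range (homogeneous_op \<Lambda> u \<omega>\<^sub>0))"


section \<open>Minimal tensor products and the principal symbol\<close>

text \<open>A C*-norm on a *-subalgebra (not assumed to be complete).\<close>

definition cstar_norm_on :: "'a::cstar_algebra set \<Rightarrow> ('a \<Rightarrow> real) \<Rightarrow> bool" where
  "cstar_norm_on S p \<longleftrightarrow>
     (\<forall>x\<in>S. 0 \<le> p x \<and> (p x = 0 \<longrightarrow> x = 0) \<and> (\<forall>a. p (a *\<^sub>C x) = norm a * p x) \<and>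
        p (star x * x) = (p x)\<^sup>2 \<and> (\<forall>y\<in>S. p (x + y) \<le> p x + p y \<and> p (x * y) \<le> p x * p y))"

text \<open>\<open>'b\<close>, with the simple tensors \<open>t x y\<close>, is the minimal tensor product of \<open>'a\<close> and \<open>'c\<close>: the span
  of the simple tensors is a copy of the algebraic tensor product, by bilinearity and the
  independence condition, and \<open>'b\<close> is its completion in the smallest C*-norm.\<close>

definition min_tensor_product ::
    "('a::cstar_algebra \<Rightarrow> 'c::cstar_algebra \<Rightarrow> 'b::cstar_algebra) \<Rightarrow> bool" where
  "min_tensor_product t \<longleftrightarrow>
     (\<forall>x. clinear (t x)) \<and> (\<forall>y. clinear (\<lambda>x. t x y)) \<and>
     (\<forall>x y x' y'. t x y * t x' y' = t (x * x') (y * y')) \<and>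
     (\<forall>x y. star (t x y) = t (star x) (star y)) \<and>
     (\<forall>F x. finite F \<and> (\<forall>a. (\<Sum>y\<in>F. a y *\<^sub>C y) = 0 \<longrightarrow> (\<forall>y\<in>F. a y = 0)) \<and>
        (\<Sum>y\<in>F. t (x y) y) = 0 \<longrightarrow> (\<forall>y\<in>F. x y = 0)) \<and>
     closure (cspan {t x y | x y. True}) = UNIV \<and>
     (\<forall>p. cstar_norm_on (cspan {t x y | x y. True}) p \<longrightarrow>
        (\<forall>z\<in>cspan {t x y | x y. True}. norm z \<le> p z))"

definition principal_symbol ::
    "('a::cstar_algebra \<Rightarrow> 'h::chilbert_space) \<Rightarrow> (int ^ 'd::finite \<Rightarrow> 'a) \<Rightarrow> 'd sphere \<Rightarrow>
     ('a \<Rightarrow> 'd csphere \<Rightarrow> 'b::cstar_algebra) \<Rightarrow> ('h bop \<Rightarrow> 'b) \<Rightarrow> bool" where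
  "principal_symbol \<Lambda> u \<omega>\<^sub>0 t symb \<longleftrightarrow>
     star_hom_on (symbol_algebra \<Lambda> u \<omega>\<^sub>0) symb \<and> continuous_on (symbol_algebra \<Lambda> u \<omega>\<^sub>0) symb \<and>
     (\<forall>x. symb (left_mult_op \<Lambda> x) = t x 1) \<and> (\<forall>g. symb (homogeneous_op \<Lambda> u \<omega>\<^sub>0 g) = t 1 g)"

definition trace_tensor_integral ::
    "('a::cstar_algebra \<Rightarrow> complex) \<Rightarrow> ('a \<Rightarrow> 'd::finite csphere \<Rightarrow> 'b::cstar_algebra) \<Rightarrow>
     ('b \<Rightarrow> complex) \<Rightarrow> bool" where
  "trace_tensor_integral \<tau> t \<Phi> \<longleftrightarrow> bounded_clinear \<Phi> \<and>
     (\<forall>x g. \<Phi> (t x g) = \<tau> x * (LINT s|surface_measure. apply_bcontfun g s))"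

end

theory Submission
  imports Defs
begin

text \<open>
  Write \<open>\<pi>1 x\<close> for left multiplication by \<open>x\<close>, \<open>\<pi>2 g\<close> for the homogeneous operator of \<open>g\<close>, and \<open>e m\<close> for the vector of the GNS space given by \<open>u m\<close>; these vectors form an orthonormal
  basis in which \<open>J = (1 - \<Delta>) powr (-d/2)\<close> and all \<open>\<pi>2 g\<close> are diagonal.  Since \<open>T * J\<close> is of weak
  trace class, with weak norm at most \<open>norm T\<close> times a constant, \<open>F T = \<phi> (T * J)\<close> is a bounded linear
  functional of the bounded operator \<open>T\<close>.  Both \<open>F\<close> and \<open>\<Phi> \<circ> symb / d\<close> are continuous on the symbol
  algebra, so it is enough to compare them on a dense subset.

  A commutator \<open>\<pi>2 g * \<pi>1 x - \<pi>1 x * \<pi>2 g\<close> is compact: for \<open>x = u n\<close> it is \<open>\<pi>1 (u n)\<close>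
  times a diagonal operator whose eigenvalues \<open>g ((n + m) / |n + m|) - g (m / |m|)\<close> tend to zero, and
  the case of general \<open>x\<close> follows by approximation (\<open>commutator_null_ideal\<close>).  The functional \<open>F\<close>
  vanishes on compact operators because \<open>\<phi>\<close> vanishes on rank-one projections
  (\<open>mode_projection_null_ideal\<close>), and the symbol of a commutator vanishes because the two tensor
  factors commute.  Modulo operators that contribute to neither side, the algebra generated by
  \<open>\<pi>1\<close> and \<open>\<pi>2\<close> is therefore spanned by the products \<open>\<pi>1 x * \<pi>2 g\<close>
  (\<open>symbol_core_star_subalgebra\<close>, \<open>symbol_core_dense\<close>).

  It remains to see that \<open>F (\<pi>1 x * \<pi>2 g)\<close> is \<open>\<tau> x\<close> times the integral of \<open>g\<close> over the sphere,
  divided by \<open>d\<close>, and by density one may take \<open>x = u n\<close>.  For \<open>n \<noteq> 0\<close> both sides are zero: a diagonal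
  unitary that commutes with \<open>\<pi>2 g * J\<close> and anticommutes with \<open>\<pi>1 (u n)\<close> shows that the trace is its
  own negative (\<open>bessel_trace_off_diagonal\<close>).  For \<open>n = 0\<close> the operator is diagonal with eigenvalues
  \<open>g (m / |m|) * (1 + |m|^2) powr (-d/2)\<close>.  By linearity \<open>g\<close> may be assumed positive.  Then the
  number of eigenvalues above \<open>1 / t\<close> is asymptotically the number of lattice points in the dilation by
  \<open>t powr (1/d)\<close> of the solid \<open>{x. |x| ^ d < g (x / |x|)}\<close>, that is \<open>t\<close> times the volume of this solid
  (\<open>lattice_point_asymptotics\<close>), and that volume is the integral of \<open>g\<close> over the sphere divided by
  \<open>d\<close> (\<open>measure_radial_solid\<close>).  So the eigenvalues in decreasing order behave like \<open>c / (k + 1)\<close>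
  with \<open>c\<close> equal to this number (\<open>homogeneous_eigenvalue_asymptotics\<close>).

  As to traces of diagonal operators, if \<open>(k + 1) * b k\<close> tends to \<open>c\<close>, the diagonal operator with
  eigenvalues \<open>b k\<close> has trace \<open>c\<close> (\<open>trace_diag_asymptotic\<close>).  Indeed that operator differs from \<open>c\<close> times the
  diagonal operator with eigenvalues \<open>1 / (k + 1)\<close>, whose trace is one in every orthonormal basis, by
  an operator that finite rank operators approximate in the weak norm.  Finite rank diagonal operators
  have trace zero, since otherwise the truncations of the operator with eigenvalues \<open>1 / (k + 1)\<close>,
  which have weak norm at most one, would have traces growing like the harmonic numbers
  (\<open>trace_diag_finite\<close>).
\<close>


section \<open>Complex subspaces and operators determined by a dense subspace\<close>

definition csubspace :: "'a::complex_normed_vector set \<Rightarrow> bool" where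
  "csubspace S \<longleftrightarrow> 0 \<in> S \<and> (\<forall>x\<in>S. \<forall>y\<in>S. x + y \<in> S) \<and> (\<forall>a. \<forall>x\<in>S. a *\<^sub>C x \<in> S)"

lemma csubspaceD:
  assumes "csubspace S"
  shows "0 \<in> S" "x \<in> S \<Longrightarrow> y \<in> S \<Longrightarrow> x + y \<in> S" "x \<in> S \<Longrightarrow> a *\<^sub>C x \<in> S"
  using assms by (auto simp: csubspace_def)

lemma csubspace_diff: "csubspace S \<Longrightarrow> x \<in> S \<Longrightarrow> y \<in> S \<Longrightarrow> x - y \<in> S"
  using csubspaceD(2)[of S x "- y"] csubspaceD(3)[of S y "-1"] by (simp add: scaleC_minus_one)

lemma csubspace_sum: "csubspace S \<Longrightarrow> (\<And>i. i \<in> I \<Longrightarrow> f i \<in> S) \<Longrightarrow> (\<Sum>i\<in>I. f i) \<in> S"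
  by (induction I rule: infinite_finite_induct) (auto simp: csubspaceD)

lemma scaleC_sum_right: "a *\<^sub>C (\<Sum>i\<in>I. f i) = (\<Sum>i\<in>I. a *\<^sub>C (f i :: 'a::complex_normed_vector))"
  by (induction I rule: infinite_finite_induct) (auto simp: scaleC_add_right)

lemma scaleC_diff_left: "(a - b) *\<^sub>C x = a *\<^sub>C x - b *\<^sub>C (x::'a::complex_normed_vector)"
  using scaleC_add_left[of "a - b" b x] by simp

lemma csubspace_cspan: "csubspace (cspan X)"
  unfolding csubspace_def
proof (intro conjI ballI allI)
  show "0 \<in> cspan X"
    unfolding cspan_def by (intro CollectI exI[of _ "{}"]) auto
next
  fix x y assume "x \<in> cspan X" "y \<in> cspan X"
  then obtain F a G b where F: "finite F" "F \<subseteq> X" "x = (\<Sum>z\<in>F. a z *\<^sub>C z)"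
    and G: "finite G" "G \<subseteq> X" "y = (\<Sum>z\<in>G. b z *\<^sub>C z)"
    by (auto simp: cspan_def)
  let ?a = "\<lambda>z. if z \<in> F then a z else 0" and ?b = "\<lambda>z. if z \<in> G then b z else 0"
  have "x = (\<Sum>z\<in>F \<union> G. ?a z *\<^sub>C z)"
    unfolding F(3) using F(1) G(1) by (intro sum.mono_neutral_cong_left) auto
  moreover have "y = (\<Sum>z\<in>F \<union> G. ?b z *\<^sub>C z)"
    unfolding G(3) using F(1) G(1) by (intro sum.mono_neutral_cong_left) auto
  ultimately have "x + y = (\<Sum>z\<in>F \<union> G. (?a z + ?b z) *\<^sub>C z)"
    by (simp add: scaleC_add_left sum.distrib)
  then show "x + y \<in> cspan X"
    unfolding cspan_def using F G
    by (intro CollectI exI[of _ "F \<union> G"] exI[of _ "\<lambda>z. ?a z + ?b z"]) auto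
next
  fix c x assume "x \<in> cspan X"
  then obtain F a where F: "finite F" "F \<subseteq> X" "x = (\<Sum>z\<in>F. a z *\<^sub>C z)"
    by (auto simp: cspan_def)
  then have "c *\<^sub>C x = (\<Sum>z\<in>F. (c * a z) *\<^sub>C z)"
    by (simp add: scaleC_sum_right)
  then show "c *\<^sub>C x \<in> cspan X"
    unfolding cspan_def using F by (intro CollectI exI[of _ F] exI[of _ "\<lambda>z. c * a z"]) auto
qed

lemma cspan_superset: "X \<subseteq> cspan X"
proof
  fix x assume "x \<in> X"
  then show "x \<in> cspan X"
    unfolding cspan_def by (intro CollectI exI[of _ "{x}"] exI[of _ "\<lambda>_. 1"]) auto
qed

lemma cspan_minimal:
  assumes "X \<subseteq> S" "csubspace S"
  shows "cspan X \<subseteq> S"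
proof
  fix x assume "x \<in> cspan X"
  then obtain F a where F: "finite F" "F \<subseteq> X" "x = (\<Sum>z\<in>F. a z *\<^sub>C z)"
    by (auto simp: cspan_def)
  with assms show "x \<in> S"
    by (auto intro!: csubspace_sum csubspaceD(3))
qed

lemma cspan_induct [consumes 1, case_names base zero add scale]:
  assumes "x \<in> cspan X" "\<And>x. x \<in> X \<Longrightarrow> P x" "P 0" "\<And>x y. P x \<Longrightarrow> P y \<Longrightarrow> P (x + y)"
    "\<And>a x. P x \<Longrightarrow> P (a *\<^sub>C x)"
  shows "P x"
proof -
  have "cspan X \<subseteq> {x. P x}"
    by (rule cspan_minimal) (auto simp: csubspace_def assms)
  with assms(1) show ?thesis
    by blast
qed

lemma csubspace_closure:
  assumes "csubspace S"
  shows "csubspace (closure S)"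
  unfolding csubspace_def
proof (intro conjI ballI allI)
  show "0 \<in> closure S"
    using csubspaceD(1)[OF assms] closure_subset by blast
next
  fix x y assume "x \<in> closure S" "y \<in> closure S"
  then obtain f g where "\<And>n. f n \<in> S" "f \<longlonglongrightarrow> x" "\<And>n. g n \<in> S" "g \<longlonglongrightarrow> y"
    by (auto simp: closure_sequential)
  then show "x + y \<in> closure S"
    using assms by (auto simp: closure_sequential csubspace_def
        intro!: exI[of _ "\<lambda>n. f n + g n"] tendsto_add)
next
  fix a x assume "x \<in> closure S"
  then obtain f where "\<And>n. f n \<in> S" "f \<longlonglongrightarrow> x"
    by (auto simp: closure_sequential)
  then show "a *\<^sub>C x \<in> closure S"
    using assms by (auto simp: closure_sequential csubspace_def
        intro!: exI[of _ "\<lambda>n. a *\<^sub>C f n"] bounded_linear.tendsto[OF bounded_linear_scaleC])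
qed

lemma bop_apply_linear [simp]:
  fixes A B :: "'h::complex_normed_vector bop"
  shows "bop_apply A (x + y) = bop_apply A x + bop_apply A y"
    "bop_apply A (x - y) = bop_apply A x - bop_apply A y"
    "bop_apply A (- x) = - bop_apply A x"
    "bop_apply A 0 = 0"
    "bop_apply A (\<Sum>i\<in>I. f i) = (\<Sum>i\<in>I. bop_apply A (f i))"
    "bop_apply (A - B) x = bop_apply A x - bop_apply B x"
    "bop_apply (- A) x = - bop_apply A x"
    "bop_apply 0 x = 0"
proof -
  interpret bounded_linear "bop_apply A" by (rule bounded_linear_bop_apply)
  show "bop_apply A (x + y) = bop_apply A x + bop_apply A y" by (rule add)
  show "bop_apply A (x - y) = bop_apply A x - bop_apply A y" by (rule diff)
  show "bop_apply A (- x) = - bop_apply A x" by (rule neg)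
  show "bop_apply A 0 = 0" by (rule zero)
  show "bop_apply A (\<Sum>i\<in>I. f i) = (\<Sum>i\<in>I. bop_apply A (f i))" by (rule sum)
  show "bop_apply (A - B) x = bop_apply A x - bop_apply B x"
    by transfer (rule blinfun.diff_left)
  show "bop_apply (- A) x = - bop_apply A x"
    by transfer (rule blinfun.minus_left)
  show "bop_apply 0 x = 0"
    by transfer simp
qed

lemma bop_apply_sum_left:
  fixes A :: "'i \<Rightarrow> 'h::complex_normed_vector bop"
  shows "bop_apply (\<Sum>i\<in>I. A i) x = (\<Sum>i\<in>I. bop_apply (A i) x)"
  by (induction I rule: infinite_finite_induct) auto

lemma bop_tendsto_apply: "X \<longlonglongrightarrow> x \<Longrightarrow> (\<lambda>n. bop_apply A (X n)) \<longlonglongrightarrow> bop_apply A x"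
  by (rule bounded_linear.tendsto[OF bounded_linear_bop_apply])

lemma bop_eq_on_dense:
  assumes "closure S = UNIV" "\<And>x. x \<in> S \<Longrightarrow> bop_apply A x = bop_apply B x"
  shows "A = B"
proof (rule bop_eqI)
  fix x
  have "x \<in> closure S" using assms(1) by simp
  then obtain X where X: "\<And>n. X n \<in> S" "X \<longlonglongrightarrow> x"
    by (auto simp: closure_sequential)
  have "(\<lambda>n. bop_apply A (X n)) \<longlonglongrightarrow> bop_apply B x"
    using bop_tendsto_apply[OF X(2), of B] assms(2) X(1) by simp
  with bop_tendsto_apply[OF X(2), of A] show "bop_apply A x = bop_apply B x"
    by (rule LIMSEQ_unique)
qed

text \<open>A bounded complex linear map on a dense subspace is Lipschitz, hence extends continuously;
  linearity and the bound pass to the limit.\<close>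

lemma bop_extension:
  fixes f :: "'h::chilbert_space \<Rightarrow> 'h"
  assumes S: "csubspace S" "closure S = UNIV"
    and add: "\<And>x y. x \<in> S \<Longrightarrow> y \<in> S \<Longrightarrow> f (x + y) = f x + f y"
    and scale: "\<And>a x. x \<in> S \<Longrightarrow> f (a *\<^sub>C x) = a *\<^sub>C f x"
    and M: "0 \<le> M" "\<And>x. x \<in> S \<Longrightarrow> norm (f x) \<le> M * norm x"
  obtains A where "\<And>x. x \<in> S \<Longrightarrow> bop_apply A x = f x" "norm A \<le> M"
proof -
  have diff: "f (x - y) = f x - f y" if "x \<in> S" "y \<in> S" for x y
    using add[of "x - y" y] csubspace_diff[OF S(1) that] that by simp
  have lip: "M-lipschitz_on S f"
  proof (rule lipschitz_onI)
    show "dist (f x) (f y) \<le> M * dist x y" if "x \<in> S" "y \<in> S" for x y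
      using M(2)[OF csubspace_diff[OF S(1) that]] that by (simp add: dist_norm diff)
  qed (rule M)
  obtain g where g: "continuous_on (closure S) g" "\<And>x. x \<in> S \<Longrightarrow> g x = f x"
    using uniformly_continuous_on_extension_on_closure[OF lipschitz_on_uniformly_continuous[OF lip]]
      uniformly_continuous_imp_continuous by metis
  have lim: "(\<lambda>n. g (X n)) \<longlonglongrightarrow> g x" if "X \<longlonglongrightarrow> x" for X x
    using g(1) that by (auto simp: S(2) continuous_on_sequentially comp_def)
  have seq: "\<exists>X. (\<forall>n. X n \<in> S) \<and> X \<longlonglongrightarrow> x" for x
    using S(2) closure_sequential[of x S] by auto
  have gadd: "g (x + y) = g x + g y" for x y
  proof -
    obtain X Y where X: "\<And>n. X n \<in> S" "X \<longlonglongrightarrow> x" and Y: "\<And>n. Y n \<in> S" "Y \<longlonglongrightarrow> y"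
      using seq by metis
    have "(\<lambda>n. g (X n + Y n)) \<longlonglongrightarrow> g (x + y)"
      by (intro lim tendsto_add X Y)
    moreover have "g (X n + Y n) = g (X n) + g (Y n)" for n
      using X Y csubspaceD(2)[OF S(1)] by (simp add: g add)
    ultimately have "(\<lambda>n. g (X n) + g (Y n)) \<longlonglongrightarrow> g (x + y)"
      by simp
    moreover have "(\<lambda>n. g (X n) + g (Y n)) \<longlonglongrightarrow> g x + g y"
      by (intro tendsto_add lim X Y)
    ultimately show ?thesis
      by (rule LIMSEQ_unique)
  qed
  have gscale: "g (a *\<^sub>C x) = a *\<^sub>C g x" for a x
  proof -
    obtain X where X: "\<And>n. X n \<in> S" "X \<longlonglongrightarrow> x"
      using seq by metis
    have "(\<lambda>n. g (a *\<^sub>C X n)) \<longlonglongrightarrow> g (a *\<^sub>C x)"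
      by (intro lim bounded_linear.tendsto[OF bounded_linear_scaleC] X)
    moreover have "g (a *\<^sub>C X n) = a *\<^sub>C g (X n)" for n
      using X csubspaceD(3)[OF S(1)] by (simp add: g scale)
    ultimately have "(\<lambda>n. a *\<^sub>C g (X n)) \<longlonglongrightarrow> g (a *\<^sub>C x)"
      by simp
    moreover have "(\<lambda>n. a *\<^sub>C g (X n)) \<longlonglongrightarrow> a *\<^sub>C g x"
      by (intro bounded_linear.tendsto[OF bounded_linear_scaleC] lim X)
    ultimately show ?thesis
      by (rule LIMSEQ_unique)
  qed
  have gbound: "norm (g x) \<le> M * norm x" for x
  proof -
    obtain X where X: "\<And>n. X n \<in> S" "X \<longlonglongrightarrow> x"
      using seq by metis
    show ?thesis
    proof (rule LIMSEQ_le)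
      show "(\<lambda>n. norm (g (X n))) \<longlonglongrightarrow> norm (g x)"
        by (intro tendsto_norm lim X)
      show "(\<lambda>n. M * norm (X n)) \<longlonglongrightarrow> M * norm x"
        by (intro tendsto_mult_left tendsto_norm X)
    qed (use M(2) X(1) g(2) in auto)
  qed
  have bl: "bounded_linear g"
    by (rule bounded_linear_intro[where K = M])
       (auto simp: gadd gscale scaleR_scaleC gbound mult.commute)
  have app: "bop_apply (Abs_bop (Blinfun g)) = g"
    using gscale by (simp add: bop_apply.rep_eq Abs_bop_inverse bounded_linear_Blinfun_apply[OF bl])
  show ?thesis
  proof
    show "bop_apply (Abs_bop (Blinfun g)) x = f x" if "x \<in> S" for x
      using that by (simp add: app g)
    show "norm (Abs_bop (Blinfun g)) \<le> M"
      by (rule norm_bop_bound) (simp_all add: M app gbound)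
  qed
qed


section \<open>Operators given on an orthonormal basis\<close>

lemma cinner_zero [simp]: "cinner (x::'h::chilbert_space) 0 = 0" "cinner 0 (x::'h) = 0"
  using cinner_scaleC_right[of x 0 0] cinner_scaleC_left[of 0 0 x] by auto

lemma cinner_sum_right: "cinner x (\<Sum>i\<in>I. f i) = (\<Sum>i\<in>I. cinner x (f i :: 'h::chilbert_space))"
  by (induction I rule: infinite_finite_induct) (auto simp: cinner_add_right)

lemma pythagoras_sum:
  fixes v :: "'i \<Rightarrow> 'h::chilbert_space"
  assumes "finite I" "\<And>i j. i \<noteq> j \<Longrightarrow> cinner (v i) (v j) = 0"
  shows "(norm (\<Sum>i\<in>I. c i *\<^sub>C v i))\<^sup>2 = (\<Sum>i\<in>I. (norm (c i) * norm (v i))\<^sup>2)"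
  using assms(1)
proof (induction I rule: finite_induct)
  case (insert i I)
  have "cinner (v i) (c j *\<^sub>C v j) = 0" if "j \<in> I" for j
    using insert.hyps assms(2)[of i j] that by auto
  then have "cinner (c i *\<^sub>C v i) (\<Sum>j\<in>I. c j *\<^sub>C v j) = 0"
    by (simp add: cinner_sum_right del: cinner_scaleC_right)
  moreover have "(\<Sum>j\<in>insert i I. c j *\<^sub>C v j) = c i *\<^sub>C v i + (\<Sum>j\<in>I. c j *\<^sub>C v j)"
    using insert.hyps by simp
  ultimately have "(norm (\<Sum>j\<in>insert i I. c j *\<^sub>C v j))\<^sup>2 =
      (norm (c i *\<^sub>C v i))\<^sup>2 + (norm (\<Sum>j\<in>I. c j *\<^sub>C v j))\<^sup>2"
    by (simp only: norm_add_sq) simp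
  then show ?case
    using insert by simp
qed simp

lemma orthonormal_basisD:
  assumes "orthonormal_basis e"
  shows "cinner (e i) (e j) = (if i = j then 1 else 0)" "closure (cspan (range e)) = UNIV"
    "norm (e i) = 1" "inj e"
proof -
  show *: "cinner (e i) (e j) = (if i = j then 1 else 0)" for i j
    using assms by (simp add: orthonormal_basis_def)
  show "closure (cspan (range e)) = UNIV"
    using assms by (simp add: orthonormal_basis_def)
  have "complex_of_real ((norm (e i))\<^sup>2) = 1"
    using *[of i i] by (simp add: cinner_same)
  then have "(norm (e i))\<^sup>2 = 1"
    using of_real_eq_1_iff by blast
  then show "norm (e i) = 1"
    by (metis abs_norm_cancel real_sqrt_abs real_sqrt_one)
  show "inj e"
    by (rule injI) (metis * zero_neq_one)
qed

lemma cspan_basis_expansion: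
  assumes e: "orthonormal_basis e" and x: "x \<in> cspan (range e)"
  obtains I where "finite I" "\<And>i. i \<notin> I \<Longrightarrow> cinner (e i) x = 0"
    "x = (\<Sum>i\<in>I. cinner (e i) x *\<^sub>C e i)"
proof -
  have "\<exists>I. finite I \<and> (\<forall>i. i \<notin> I \<longrightarrow> cinner (e i) x = 0) \<and> x = (\<Sum>i\<in>I. cinner (e i) x *\<^sub>C e i)"
    using x
  proof (induction rule: cspan_induct)
    case (base x)
    then obtain k where "x = e k" by blast
    then show ?case
      by (intro exI[of _ "{k}"]) (auto simp: orthonormal_basisD[OF e])
  next
    case zero
    then show ?case
      by (intro exI[of _ "{}"]) auto
  next
    case (add x y)
    then obtain I J where I: "finite I" "\<And>i. i \<notin> I \<Longrightarrow> cinner (e i) x = 0"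
        "x = (\<Sum>i\<in>I. cinner (e i) x *\<^sub>C e i)"
      and J: "finite J" "\<And>i. i \<notin> J \<Longrightarrow> cinner (e i) y = 0"
        "y = (\<Sum>i\<in>J. cinner (e i) y *\<^sub>C e i)"
      by blast
    have "x = (\<Sum>i\<in>I \<union> J. cinner (e i) x *\<^sub>C e i)"
      by (subst I(3), rule sum.mono_neutral_left) (use I J in auto)
    moreover have "y = (\<Sum>i\<in>I \<union> J. cinner (e i) y *\<^sub>C e i)"
      by (subst J(3), rule sum.mono_neutral_left) (use I J in auto)
    ultimately have *: "(\<Sum>i\<in>I \<union> J. cinner (e i) (x + y) *\<^sub>C e i) = x + y"
      by (simp only: cinner_add_right scaleC_add_left sum.distrib)
    show ?case
    proof (intro exI conjI allI impI)
      show "finite (I \<union> J)"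
        using I J by blast
      show "cinner (e i) (x + y) = 0" if "i \<notin> I \<union> J" for i
        using I(2) J(2) that by (simp add: cinner_add_right)
    qed (rule *[symmetric])
  next
    case (scale a x)
    then obtain I where I: "finite I" "\<And>i. i \<notin> I \<Longrightarrow> cinner (e i) x = 0"
        "x = (\<Sum>i\<in>I. cinner (e i) x *\<^sub>C e i)"
      by blast
    have "a *\<^sub>C x = (\<Sum>i\<in>I. a *\<^sub>C (cinner (e i) x *\<^sub>C e i))"
      by (subst I(3)) (rule scaleC_sum_right)
    moreover have "(\<Sum>i\<in>I. cinner (e i) (a *\<^sub>C x) *\<^sub>C e i) = (\<Sum>i\<in>I. a *\<^sub>C (cinner (e i) x *\<^sub>C e i))"
      by simp
    ultimately have *: "(\<Sum>i\<in>I. cinner (e i) (a *\<^sub>C x) *\<^sub>C e i) = a *\<^sub>C x"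
      by (simp only:)
    show ?case
    proof (intro exI conjI allI impI)
      show "cinner (e i) (a *\<^sub>C x) = 0" if "i \<notin> I" for i
        using I(2) that by simp
    qed (rule I *[symmetric])+
  qed
  with that show ?thesis by blast
qed

text \<open>On finite combinations of the basis vectors the estimate is the theorem of Pythagoras, for
  \<open>e\<close> and for \<open>v\<close>; the operator extends by density.\<close>

lemma basis_op_exists:
  fixes e v :: "'i \<Rightarrow> 'h::chilbert_space"
  assumes e: "orthonormal_basis e" and orth: "\<And>i j. i \<noteq> j \<Longrightarrow> cinner (v i) (v j) = 0"
    and M: "\<And>i. norm (v i) \<le> M"
  obtains A where "\<And>i. bop_apply A (e i) = v i" "norm A \<le> M"
proof -
  define f where "f x = (\<Sum>i | cinner (e i) x \<noteq> 0. cinner (e i) x *\<^sub>C v i)" for x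
  have f_eq: "f x = (\<Sum>i\<in>I. cinner (e i) x *\<^sub>C v i)"
    if "finite I" "\<And>i. i \<notin> I \<Longrightarrow> cinner (e i) x = 0" for I x
    unfolding f_def by (rule sum.mono_neutral_left) (use that in auto)
  have M0: "0 \<le> M"
    using M norm_ge_zero order_trans by blast
  have sp: "csubspace (cspan (range e))" "closure (cspan (range e)) = UNIV"
    by (rule csubspace_cspan, rule orthonormal_basisD[OF e])
  obtain A where A: "\<And>x. x \<in> cspan (range e) \<Longrightarrow> bop_apply A x = f x" "norm A \<le> M"
  proof (rule bop_extension[OF sp, of f M])
    fix x y assume x: "x \<in> cspan (range e)" and y: "y \<in> cspan (range e)"
    obtain I where I: "finite I" "\<And>i. i \<notin> I \<Longrightarrow> cinner (e i) x = 0"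
      by (rule cspan_basis_expansion[OF e x]) (rule that)
    obtain J where J: "finite J" "\<And>i. i \<notin> J \<Longrightarrow> cinner (e i) y = 0"
      by (rule cspan_basis_expansion[OF e y]) (rule that)
    have "f (x + y) = (\<Sum>i\<in>I \<union> J. cinner (e i) (x + y) *\<^sub>C v i)"
      using I J by (intro f_eq) (auto simp: cinner_add_right)
    also have "\<dots> = (\<Sum>i\<in>I \<union> J. cinner (e i) x *\<^sub>C v i) + (\<Sum>i\<in>I \<union> J. cinner (e i) y *\<^sub>C v i)"
      by (simp add: cinner_add_right scaleC_add_left sum.distrib)
    also have "\<dots> = f x + f y"
      using I J by (intro arg_cong2[where f = "(+)"] f_eq[symmetric]) auto
    finally show "f (x + y) = f x + f y" .
  next
    fix a x assume x: "x \<in> cspan (range e)"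
    obtain I where I: "finite I" "\<And>i. i \<notin> I \<Longrightarrow> cinner (e i) x = 0"
      by (rule cspan_basis_expansion[OF e x]) (rule that)
    then show "f (a *\<^sub>C x) = a *\<^sub>C f x"
      using f_eq[of I x] f_eq[of I "a *\<^sub>C x"] by (simp add: scaleC_sum_right)
  next
    fix x assume x: "x \<in> cspan (range e)"
    obtain I where I: "finite I" "\<And>i. i \<notin> I \<Longrightarrow> cinner (e i) x = 0"
        "x = (\<Sum>i\<in>I. cinner (e i) x *\<^sub>C e i)"
      by (rule cspan_basis_expansion[OF e x]) (rule that)
    have "(norm (f x))\<^sup>2 = (\<Sum>i\<in>I. (norm (cinner (e i) x) * norm (v i))\<^sup>2)"
      using I(1) by (simp add: f_eq[OF I(1,2)] pythagoras_sum orth)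
    also have "\<dots> \<le> (\<Sum>i\<in>I. M\<^sup>2 * (norm (cinner (e i) x) * norm (e i))\<^sup>2)"
    proof (rule sum_mono)
      fix i
      have "norm (cinner (e i) x) * norm (v i) \<le> M * (norm (cinner (e i) x) * norm (e i))"
        using mult_left_mono[OF M[of i], of "norm (cinner (e i) x)"]
        by (simp add: orthonormal_basisD[OF e] mult.commute)
      then have "(norm (cinner (e i) x) * norm (v i))\<^sup>2 \<le> (M * (norm (cinner (e i) x) * norm (e i)))\<^sup>2"
        by (intro power_mono) auto
      then show "(norm (cinner (e i) x) * norm (v i))\<^sup>2 \<le> M\<^sup>2 * (norm (cinner (e i) x) * norm (e i))\<^sup>2"
        by (simp only: power_mult_distrib)
    qed
    also have "\<dots> = M\<^sup>2 * (norm (\<Sum>i\<in>I. cinner (e i) x *\<^sub>C e i))\<^sup>2"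
      using I(1) by (subst pythagoras_sum) (auto simp: orthonormal_basisD[OF e] sum_distrib_left)
    also have "\<dots> = (M * norm x)\<^sup>2"
      by (simp only: I(3)[symmetric] power_mult_distrib)
    finally show "norm (f x) \<le> M * norm x"
      by (rule power2_le_imp_le) (simp add: M0)
  qed (rule M0, rule that)
  show ?thesis
  proof
    show "bop_apply A (e i) = v i" for i
    proof -
      have "e i \<in> cspan (range e)"
        by (rule subsetD[OF cspan_superset rangeI])
      then have "bop_apply A (e i) = f (e i)"
        by (rule A)
      moreover have "cinner (e j) (e i) = 0" if "j \<notin> {i}" for j
        using that orthonormal_basisD(1)[OF e, of j i] by simp
      then have "f (e i) = (\<Sum>j\<in>{i}. cinner (e j) (e i) *\<^sub>C v j)"
        by (intro f_eq) simp_all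
      ultimately show ?thesis
        by (simp add: orthonormal_basisD(1)[OF e])
    qed
  qed (rule A)
qed

lemma bop_eq_on_basis:
  assumes e: "orthonormal_basis e" and eq: "\<And>i. bop_apply A (e i) = bop_apply B (e i)"
  shows "A = B"
proof (rule bop_eq_on_dense)
  show "closure (cspan (range e)) = UNIV"
    by (rule orthonormal_basisD[OF e])
  show "bop_apply A x = bop_apply B x" if "x \<in> cspan (range e)" for x
    using that by (induction rule: cspan_induct) (auto simp: eq)
qed

lemma cinner_basis_ext:
  assumes e: "orthonormal_basis e" and eq: "\<And>i. cinner (e i) x = cinner (e i) y"
  shows "x = y"
proof (rule cinner_ext)
  fix z
  have "z \<in> closure (cspan (range e))"
    by (simp add: orthonormal_basisD[OF e])
  then obtain X where X: "\<And>n. X n \<in> cspan (range e)" "X \<longlonglongrightarrow> z"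
    by (auto simp: closure_sequential)
  have span: "cinner w (x - y) = 0" if "w \<in> cspan (range e)" for w
    using that by (induction rule: cspan_induct) (auto simp: eq cinner_diff_right cinner_add_left)
  have "norm (cinner z (x - y)) \<le> norm (X n - z) * norm (x - y)" for n
    using cinner_cauchy_schwarz[of "X n - z" "x - y"] span[OF X(1)[of n]]
    by (simp add: cinner_diff_left[of "X n"])
  moreover have "(\<lambda>n. norm (X n - z) * norm (x - y)) \<longlonglongrightarrow> 0"
    by (intro tendsto_mult_left_zero tendsto_norm_zero) (simp add: X LIM_zero)
  ultimately have "norm (cinner z (x - y)) \<le> 0"
    by (intro LIMSEQ_le_const) auto
  then have "cinner z (x - y) = 0" by simp
  then have "cinner z x = cinner z y"
    by (simp add: cinner_diff_right)
  then show "cinner x z = cinner y z"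
    by (metis cinner_commute)
qed

lemma diag_op_basis:
  fixes e :: "'i \<Rightarrow> 'h::chilbert_space"
  assumes e: "orthonormal_basis e" and M: "\<And>i. norm (f i) \<le> M"
  shows "bop_apply (diag_op e f) (e i) = f i *\<^sub>C e i" "norm (diag_op e f) \<le> M"
proof -
  obtain A where A: "\<And>i. bop_apply A (e i) = f i *\<^sub>C e i" "norm A \<le> M"
    by (rule basis_op_exists[OF e, of "\<lambda>i. f i *\<^sub>C e i" M])
       (auto simp: orthonormal_basisD[OF e] M)
  have "diag_op e f = A"
    unfolding diag_op_def
  proof (rule the_equality)
    show "B = A" if "\<forall>i. bop_apply B (e i) = f i *\<^sub>C e i" for B
      using that A by (intro bop_eq_on_basis[OF e]) simp
  qed (use A in simp)
  with A show "bop_apply (diag_op e f) (e i) = f i *\<^sub>C e i" "norm (diag_op e f) \<le> M"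
    by auto
qed

lemma diag_op_apply:
  assumes "orthonormal_basis e" "bounded (range f)"
  shows "bop_apply (diag_op e f) (e i) = f i *\<^sub>C e i"
proof -
  obtain M where "\<And>i. norm (f i) \<le> M"
    using assms(2) by (auto simp: bounded_iff)
  with assms(1) show ?thesis by (rule diag_op_basis)
qed

lemma diag_op_eqI:
  assumes "orthonormal_basis e" "bounded (range f)" "\<And>i. bop_apply A (e i) = f i *\<^sub>C e i"
  shows "diag_op e f = A"
  using assms by (intro bop_eq_on_basis[OF assms(1)]) (simp add: diag_op_apply)

lemma bounded_range_mult:
  "bounded (range f) \<Longrightarrow> bounded (range g) \<Longrightarrow> bounded (range (\<lambda>i. f i * g i :: complex))"
proof -
  assume "bounded (range f)" "bounded (range g)"
  then obtain M N where "\<And>i. norm (f i) \<le> M" "\<And>i. norm (g i) \<le> N"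
    by (auto simp: bounded_iff)
  then have "norm (f i * g i) \<le> M * N" for i
    by (simp add: norm_mult) (meson mult_mono norm_ge_zero order_trans)
  then show ?thesis
    by (auto simp: bounded_iff)
qed

lemma diag_op_algebra:
  assumes "orthonormal_basis e" "bounded (range f)" "bounded (range g)"
  shows "diag_op e f * diag_op e g = diag_op e (\<lambda>i. f i * g i)"
    "diag_op e f + diag_op e g = diag_op e (\<lambda>i. f i + g i)"
    "diag_op e f - diag_op e g = diag_op e (\<lambda>i. f i - g i)"
    "a *\<^sub>C diag_op e f = diag_op e (\<lambda>i. a * f i)"
    "star (diag_op e f) = diag_op e (\<lambda>i. cnj (f i))"
proof -
  note e = assms(1)
  show "diag_op e f * diag_op e g = diag_op e (\<lambda>i. f i * g i)"
    using assms
    by (intro diag_op_eqI[symmetric] bounded_range_mult) (auto simp: diag_op_apply mult.commute)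
  show "diag_op e f + diag_op e g = diag_op e (\<lambda>i. f i + g i)"
    using assms
    by (intro diag_op_eqI[symmetric] bounded_plus_comp) (auto simp: diag_op_apply scaleC_add_left)
  show "diag_op e f - diag_op e g = diag_op e (\<lambda>i. f i - g i)"
    using assms
    by (intro diag_op_eqI[symmetric] bounded_minus_comp) (auto simp: diag_op_apply scaleC_diff_left)
  show "a *\<^sub>C diag_op e f = diag_op e (\<lambda>i. a * f i)"
    using assms
    by (intro diag_op_eqI[symmetric] bounded_range_mult) (auto simp: diag_op_apply)
  have bc: "bounded (range (\<lambda>i. cnj (f i)))"
    using assms(2) by (simp add: bounded_iff)
  show "star (diag_op e f) = diag_op e (\<lambda>i. cnj (f i))"
  proof (rule diag_op_eqI[symmetric, OF e bc])
    fix i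
    show "bop_apply (star (diag_op e f)) (e i) = cnj (f i) *\<^sub>C e i"
      by (rule cinner_basis_ext[OF e])
         (simp add: cinner_star_right diag_op_apply assms orthonormal_basisD[OF e])
  qed
qed

lemma diag_op_one: "orthonormal_basis e \<Longrightarrow> diag_op e (\<lambda>_. 1) = 1"
  by (rule diag_op_eqI) auto

lemma orthonormal_basis_reindex:
  assumes "orthonormal_basis e" "bij \<beta>"
  shows "orthonormal_basis (e \<circ> \<beta>)" "diag_op (e \<circ> \<beta>) (f \<circ> \<beta>) = diag_op e f"
proof -
  have r: "range (e \<circ> \<beta>) = range e"
    using assms(2) by (metis bij_is_surj image_comp)
  show "orthonormal_basis (e \<circ> \<beta>)"
    using assms r inj_eq[OF bij_is_inj[OF assms(2)]]
    unfolding orthonormal_basis_def by (auto simp: comp_def)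
  have "(\<forall>i. P (\<beta> i)) \<longleftrightarrow> (\<forall>i. P i)" for P
    using assms(2) by (metis bij_pointE)
  from this[of "\<lambda>i. bop_apply A (e i) = f i *\<^sub>C e i" for A]
  show "diag_op (e \<circ> \<beta>) (f \<circ> \<beta>) = diag_op e f"
    by (simp add: diag_op_def)
qed


section \<open>Operators of weak trace class\<close>

text \<open>Approximation by operators of rank \<open>n\<close> to within \<open>C / (n + 1)\<close> is the form in which the weak
  norm is estimated here: it passes to products with bounded operators, because these do not
  increase the rank of the approximants.\<close>

definition weak_bound :: "real \<Rightarrow> 'h::chilbert_space bop \<Rightarrow> bool" where
  "weak_bound C A \<longleftrightarrow> compact_operator A \<and>
     (\<forall>n. \<exists>R. rank_le n R \<and> norm (A - R) \<le> C / real (n + 1))"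

lemma rank_le_zero: "rank_le n 0"
  unfolding rank_le_def
  by (rule exI[of _ "{}"]) (auto simp: csubspaceD(1)[OF csubspace_cspan])

lemma rank_le_mult:
  assumes "rank_le n R"
  shows "rank_le n (T * R)" "rank_le n (R * T)"
proof -
  obtain F where F: "finite F" "card F \<le> n" "range (bop_apply R) \<subseteq> cspan F"
    using assms by (auto simp: rank_le_def)
  have sub: "bop_apply T y \<in> cspan (bop_apply T ` F)" if "y \<in> cspan F" for y
    using that
  proof (induction rule: cspan_induct)
    case (base x)
    then show ?case
      by (intro subsetD[OF cspan_superset] imageI)
  qed (auto intro: csubspaceD[OF csubspace_cspan])
  have "range (bop_apply (T * R)) \<subseteq> cspan (bop_apply T ` F)"
    using F(3) by (auto intro!: sub)
  then show "rank_le n (T * R)"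
    unfolding rank_le_def using F(1,2) card_image_le[OF F(1), of "bop_apply T"]
    by (intro exI[of _ "bop_apply T ` F"]) auto
  have "range (bop_apply (R * T)) \<subseteq> cspan F"
    using F(3) by auto
  then show "rank_le n (R * T)"
    unfolding rank_le_def using F(1,2) by (intro exI[of _ F]) auto
qed

lemma singular_value_le: "rank_le n R \<Longrightarrow> singular_value n A \<le> norm (A - R)"
  unfolding singular_value_def by (rule cINF_lower) (auto intro!: bdd_belowI[of _ 0])

lemma singular_value_nonneg: "0 \<le> singular_value n A"
  unfolding singular_value_def by (rule cINF_greatest) (use rank_le_zero in auto)

lemma weak_boundD:
  assumes "weak_bound C A"
  shows "A \<in> weak_trace_class" "0 \<le> weak_norm A" "weak_norm A \<le> C" "0 \<le> C"
proof -
  have sv: "real (n + 1) * singular_value n A \<le> C" for n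
  proof -
    obtain R where R: "rank_le n R" "norm (A - R) \<le> C / real (n + 1)"
      using assms by (auto simp: weak_bound_def)
    then have "singular_value n A \<le> C / real (n + 1)"
      using singular_value_le[OF R(1), of A] by linarith
    then show ?thesis
      by (simp add: field_simps)
  qed
  then have bdd: "bdd_above (range (\<lambda>n. real (n + 1) * singular_value n A))"
    by (intro bdd_aboveI[of _ C]) auto
  with assms show "A \<in> weak_trace_class"
    by (simp add: weak_trace_class_def weak_bound_def)
  show "weak_norm A \<le> C"
    unfolding weak_norm_def by (intro cSUP_least) (use sv in auto)
  have "real (0 + 1) * singular_value 0 A \<le> weak_norm A"
    unfolding weak_norm_def by (rule cSUP_upper[OF _ bdd]) simp
  with singular_value_nonneg[of 0 A] show "0 \<le> weak_norm A"
    by simp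
  with \<open>weak_norm A \<le> C\<close> show "0 \<le> C"
    by simp
qed

lemma compact_operatorI:
  assumes "bop_apply A ` cball 0 1 \<subseteq> K" "compact K"
  shows "compact_operator A"
proof -
  have "closure (bop_apply A ` cball 0 1) \<subseteq> K"
    using assms by (simp add: closure_minimal compact_imp_closed)
  then have "closure (bop_apply A ` cball 0 1) = K \<inter> closure (bop_apply A ` cball 0 1)"
    by blast
  with assms(2) show ?thesis
    unfolding compact_operator_def by (metis closed_closure compact_Int_closed)
qed

lemma compact_operator_mult:
  assumes "compact_operator A"
  shows "compact_operator (T * A)" "compact_operator (A * T)"
proof -
  let ?K = "closure (bop_apply A ` cball 0 1)"
  have K: "compact ?K"
    using assms by (simp add: compact_operator_def)
  show "compact_operator (T * A)"
  proof (rule compact_operatorI)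
    show "bop_apply (T * A) ` cball 0 1 \<subseteq> bop_apply T ` ?K"
      by (auto intro!: imageI subsetD[OF closure_subset])
    show "compact (bop_apply T ` ?K)"
      by (intro compact_continuous_image K linear_continuous_on bounded_linear_bop_apply)
  qed
  show "compact_operator (A * T)"
  proof (rule compact_operatorI)
    let ?M = "norm T + 1"
    have M: "?M > 0"
      using norm_ge_zero[of T] by linarith
    show "bop_apply (A * T) ` cball 0 1 \<subseteq> (*\<^sub>R) ?M ` ?K"
    proof safe
      fix x :: 'a assume "x \<in> cball 0 1"
      then have "norm (bop_apply T x) \<le> norm T * 1"
        by (intro order_trans[OF norm_bop_apply] mult_left_mono) auto
      then have "inverse ?M *\<^sub>R bop_apply T x \<in> cball 0 1"
        using M by (simp add: field_simps)
      then have "bop_apply A (inverse ?M *\<^sub>R bop_apply T x) \<in> ?K"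
        by (intro subsetD[OF closure_subset imageI])
      moreover have "bop_apply (A * T) x = ?M *\<^sub>R bop_apply A (inverse ?M *\<^sub>R bop_apply T x)"
        using M by (simp add: linear_scale[OF bounded_linear.linear[OF bounded_linear_bop_apply]])
      ultimately show "bop_apply (A * T) x \<in> (*\<^sub>R) ?M ` ?K"
        by (rule image_eqI[rotated])
    qed
    show "compact ((*\<^sub>R) ?M ` ?K)"
      using K by (rule compact_scaling)
  qed
qed

lemma weak_bound_mult:
  assumes "weak_bound C A"
  shows "weak_bound (norm T * C) (T * A)" "weak_bound (norm T * C) (A * T)"
proof -
  have left: "\<exists>R'. rank_le n R' \<and> norm (T * A - R') \<le> norm T * C / real (n + 1)"
    and right: "\<exists>R'. rank_le n R' \<and> norm (A * T - R') \<le> norm T * C / real (n + 1)" for n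
  proof -
    obtain R where R: "rank_le n R" "norm (A - R) \<le> C / real (n + 1)"
      using assms by (auto simp: weak_bound_def)
    have "norm (T * A - T * R) \<le> norm T * norm (A - R)"
      by (metis norm_bop_times right_diff_distrib)
    also have "\<dots> \<le> norm T * (C / real (n + 1))"
      using R by (intro mult_left_mono) auto
    finally show "\<exists>R'. rank_le n R' \<and> norm (T * A - R') \<le> norm T * C / real (n + 1)"
      using rank_le_mult(1)[OF R(1), of T] by (intro exI[of _ "T * R"]) auto
    have "norm (A * T - R * T) \<le> norm (A - R) * norm T"
      by (metis norm_bop_times left_diff_distrib)
    also have "\<dots> \<le> (C / real (n + 1)) * norm T"
      using R by (intro mult_right_mono) auto
    finally show "\<exists>R'. rank_le n R' \<and> norm (A * T - R') \<le> norm T * C / real (n + 1)"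
      using rank_le_mult(2)[OF R(1), of T] by (intro exI[of _ "R * T"]) (auto simp: mult.commute)
  qed
  have c: "compact_operator A"
    using assms by (simp add: weak_bound_def)
  show "weak_bound (norm T * C) (T * A)"
    unfolding weak_bound_def by (rule conjI[OF compact_operator_mult(1)[OF c] allI[OF left]])
  show "weak_bound (norm T * C) (A * T)"
    unfolding weak_bound_def by (rule conjI[OF compact_operator_mult(2)[OF c] allI[OF right]])
qed

lemma bounded_range_cnj: "bounded (range b) \<Longrightarrow> bounded (range (\<lambda>i. cnj (b i)))"
  by (simp add: bounded_iff)

lemma bounded_range_const: "bounded (range (\<lambda>i. c))"
  by simp

lemma cinner_basis_diag:
  assumes e: "orthonormal_basis e" "bounded (range b)"
  shows "cinner (e i) (bop_apply (diag_op e b) x) = b i * cinner (e i) x"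
proof -
  have "cinner (e i) (bop_apply (diag_op e b) x) = cinner (bop_apply (star (diag_op e b)) (e i)) x"
    by (simp add: cinner_star)
  also have "bop_apply (star (diag_op e b)) (e i) = cnj (b i) *\<^sub>C e i"
    by (simp only: diag_op_algebra(5)[OF e e(2)] diag_op_apply[OF e(1) bounded_range_cnj[OF e(2)]])
  finally show ?thesis by simp
qed

lemma bounded_range_truncation:
  assumes "bounded (range b)"
  shows "bounded (range (\<lambda>i. if P i then b i else (0::complex)))"
proof (rule bounded_subset)
  show "bounded (insert 0 (range b))"
    using assms by simp
qed auto

lemma diag_truncation:
  fixes e :: "nat \<Rightarrow> 'h::chilbert_space"
  assumes e: "orthonormal_basis e" and b: "bounded (range b)"
  shows "bop_apply (diag_op e (\<lambda>k. if k < n then b k else 0)) x =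
    (\<Sum>k<n. (b k * cinner (e k) x) *\<^sub>C e k)"
proof (rule cinner_basis_ext[OF e])
  fix i
  have "cinner (e i) (\<Sum>k<n. (b k * cinner (e k) x) *\<^sub>C e k) =
      (\<Sum>k<n. if k = i then b k * cinner (e k) x else 0)"
    by (subst cinner_sum_right, rule sum.cong[OF refl]) (simp add: orthonormal_basisD(1)[OF e])
  also have "\<dots> = (if i < n then b i * cinner (e i) x else 0)"
    by (simp add: sum.delta)
  also have "\<dots> = cinner (e i) (bop_apply (diag_op e (\<lambda>k. if k < n then b k else 0)) x)"
    by (simp only: cinner_basis_diag[OF e bounded_range_truncation[OF b, of "\<lambda>k. k < n"]]) simp
  finally show "cinner (e i) (bop_apply (diag_op e (\<lambda>k. if k < n then b k else 0)) x) =
      cinner (e i) (\<Sum>k<n. (b k * cinner (e k) x) *\<^sub>C e k)"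
    by (rule sym)
qed

text \<open>The box of all \<open>\<Sum>k<n. c k *\<^sub>C e k\<close> with coefficients of size at most \<open>M\<close> is compact
  as a sum of finitely many discs.\<close>

lemma compact_coefficient_box:
  fixes e :: "nat \<Rightarrow> 'h::chilbert_space"
  shows "compact {\<Sum>k<n. c k *\<^sub>C e k | c. \<forall>k. norm (c k) \<le> (M::real)}" (is "compact (?Z n)")
proof (cases "M \<ge> 0")
  case True
  show ?thesis
  proof (induction n)
    case 0
    have "?Z 0 = {0}"
      using True by (auto intro!: exI[of _ "\<lambda>_. 0"])
    then show ?case by simp
  next
    case (Suc n)
    have "compact ((\<lambda>c. c *\<^sub>C e n) ` cball 0 M)"
    proof (rule compact_continuous_image)
      show "continuous_on (cball 0 M) (\<lambda>c. c *\<^sub>C e n)"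
      proof (rule linear_continuous_on, rule bounded_linear_intro[where K = "norm (e n)"])
        show "(r *\<^sub>R c) *\<^sub>C e n = r *\<^sub>R (c *\<^sub>C e n)" for r c
          by (simp add: scaleR_scaleC scaleR_conv_of_real)
      qed (auto simp: scaleC_add_left)
    qed simp
    with Suc have "compact (\<Union>x\<in>?Z n. \<Union>y\<in>(\<lambda>c. c *\<^sub>C e n) ` cball 0 M. {x + y})"
      by (rule compact_sums')
    also have "(\<Union>x\<in>?Z n. \<Union>y\<in>(\<lambda>c. c *\<^sub>C e n) ` cball 0 M. {x + y}) = ?Z (Suc n)"
    proof (intro equalityI subsetI)
      fix z assume "z \<in> (\<Union>x\<in>?Z n. \<Union>y\<in>(\<lambda>c. c *\<^sub>C e n) ` cball 0 M. {x + y})"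
      then obtain c a where c: "\<forall>k. norm (c k) \<le> M" "norm a \<le> M"
        "z = (\<Sum>k<n. c k *\<^sub>C e k) + a *\<^sub>C e n"
        by auto
      then have "z = (\<Sum>k<Suc n. (c(n := a)) k *\<^sub>C e k)"
        by simp
      moreover have "\<forall>k. norm ((c(n := a)) k) \<le> M"
        using c by simp
      ultimately show "z \<in> ?Z (Suc n)"
        by blast
    next
      fix z assume "z \<in> ?Z (Suc n)"
      then obtain c where c: "\<forall>k. norm (c k) \<le> M" "z = (\<Sum>k<n. c k *\<^sub>C e k) + c n *\<^sub>C e n"
        by auto
      moreover have "(\<Sum>k<n. c k *\<^sub>C e k) \<in> ?Z n" "c n *\<^sub>C e n \<in> (\<lambda>c. c *\<^sub>C e n) ` cball 0 M"
        using c(1) by auto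
      ultimately show "z \<in> (\<Union>x\<in>?Z n. \<Union>y\<in>(\<lambda>c. c *\<^sub>C e n) ` cball 0 M. {x + y})"
        by blast
    qed
    finally show ?case .
  qed
next
  case False
  then have "?Z n = {}"
    by (auto dest!: spec[of _ 0]) (metis norm_ge_zero order_trans)
  then show ?thesis
    by (metis compact_empty)
qed

lemma diag_op_tail_bound:
  fixes e :: "nat \<Rightarrow> 'h::chilbert_space"
  assumes e: "orthonormal_basis e" and b: "\<And>k. real (k + 1) * norm (b k) \<le> C"
  shows "norm (diag_op e b - diag_op e (\<lambda>k. if k < n then b k else 0)) \<le> C / real (n + 1)"
    "bounded (range b)"
proof -
  have C: "0 \<le> C"
    using b[of 0] order_trans[OF norm_ge_zero, of "b 0" C] by simp
  have b': "norm (b k) \<le> C / real (k + 1)" for k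
    using b[of k] by (simp add: field_simps)
  have "C / real (k + 1) \<le> C" for k
    using C by (simp add: divide_le_eq mult_le_cancel_left1 algebra_simps)
  with b' have "norm (b k) \<le> C" for k
    using order_trans by blast
  then show bd: "bounded (range b)"
    by (auto simp: bounded_iff)
  have "diag_op e b - diag_op e (\<lambda>k. if k < n then b k else 0) =
      diag_op e (\<lambda>k. b k - (if k < n then b k else 0))"
    by (rule diag_op_algebra(3)[OF e bd bounded_range_truncation[OF bd]])
  also have "norm \<dots> \<le> C / real (n + 1)"
  proof (rule diag_op_basis(2)[OF e])
    fix k
    have "C / real (k + 1) \<le> C / real (n + 1)" if "n \<le> k"
      using that C by (intro divide_left_mono) auto
    with b'[of k] C show "norm (b k - (if k < n then b k else 0)) \<le> C / real (n + 1)"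
      by (auto simp: not_less)
  qed
  finally show "norm (diag_op e b - diag_op e (\<lambda>k. if k < n then b k else 0)) \<le> C / real (n + 1)" .
qed

text \<open>The image of the unit ball is within any prescribed distance of a compact coefficient box,
  hence totally bounded.\<close>

lemma compact_operator_diag:
  fixes e :: "nat \<Rightarrow> 'h::chilbert_space"
  assumes e: "orthonormal_basis e" and b: "\<And>k. real (k + 1) * norm (b k) \<le> C"
  shows "compact_operator (diag_op e b)"
proof -
  let ?A = "diag_op e b" and ?B = "bop_apply (diag_op e b) ` cball 0 1"
  note tail = diag_op_tail_bound[OF e b]
  obtain M where M: "\<And>k. norm (b k) \<le> M"
    using tail(2) by (auto simp: bounded_iff)
  have "\<exists>k. finite k \<and> closure ?B \<subseteq> (\<Union>x\<in>k. ball x \<epsilon>)" if \<epsilon>: "0 < \<epsilon>" for \<epsilon>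
  proof -
    obtain n :: nat where n: "C / real (n + 1) < \<epsilon> / 4"
    proof -
      have "(\<lambda>n. C / real (n + 1)) \<longlonglongrightarrow> 0"
        using LIMSEQ_Suc[OF lim_const_over_n[of C]] by simp
      then have "\<forall>\<^sub>F n in sequentially. C / real (n + 1) < \<epsilon> / 4"
        by (rule order_tendstoD) (use \<epsilon> in simp)
      then show ?thesis
        using that by (auto simp: eventually_sequentially)
    qed
    let ?R = "diag_op e (\<lambda>k. if k < n then b k else 0)"
    let ?Z = "{\<Sum>k<n. c k *\<^sub>C e k | c. \<forall>k. norm (c k) \<le> M}"
    have near: "dist (bop_apply ?R x) (bop_apply ?A x) < \<epsilon> / 4" and Z: "bop_apply ?R x \<in> ?Z"
      if "x \<in> cball 0 1" for x
    proof -
      have "dist (bop_apply ?R x) (bop_apply ?A x) = norm (bop_apply (?A - ?R) x)"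
        by (simp add: dist_norm norm_minus_commute)
      also have "\<dots> \<le> norm (?A - ?R) * norm x"
        by (rule norm_bop_apply)
      also have "\<dots> \<le> norm (?A - ?R) * 1"
        using that by (intro mult_left_mono) auto
      also have "\<dots> < \<epsilon> / 4"
        using order_le_less_trans[OF tail(1)[of n] n] by simp
      finally show "dist (bop_apply ?R x) (bop_apply ?A x) < \<epsilon> / 4" .
      have "norm (b k * cinner (e k) x) \<le> M" for k
      proof -
        have "norm (cinner (e k) x) \<le> 1"
          using cinner_cauchy_schwarz[of "e k" x] that orthonormal_basisD(3)[OF e, of k] by simp
        then have "norm (b k) * norm (cinner (e k) x) \<le> M * 1"
          using M[of k] by (intro mult_mono) (auto intro: order_trans[OF norm_ge_zero])
        then show ?thesis
          by (simp add: norm_mult)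
      qed
      then show "bop_apply ?R x \<in> ?Z"
        unfolding diag_truncation[OF e tail(2)]
        by (intro CollectI exI[of _ "\<lambda>k. b k * cinner (e k) x"]) auto
    qed
    have "compact ?Z"
      by (rule compact_coefficient_box)
    then obtain k where k: "finite k" "?Z \<subseteq> (\<Union>x\<in>k. ball x (\<epsilon> / 4))"
      using \<epsilon> unfolding compact_eq_totally_bounded by (meson divide_pos_pos zero_less_numeral)
    have "closure ?B \<subseteq> (\<Union>x\<in>k. ball x \<epsilon>)"
    proof
      fix y assume "y \<in> closure ?B"
      then obtain y' where "y' \<in> ?B" "dist y' y < \<epsilon> / 4"
        using \<epsilon> unfolding closure_approachable by (meson divide_pos_pos zero_less_numeral)
      then obtain x where x: "x \<in> cball 0 1" "dist (bop_apply ?A x) y < \<epsilon> / 4"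
        by blast
      obtain z where z: "z \<in> k" "dist z (bop_apply ?R x) < \<epsilon> / 4"
        using Z[OF x(1)] k(2) by auto
      have "dist z y \<le> dist z (bop_apply ?R x) + dist (bop_apply ?R x) (bop_apply ?A x)
          + dist (bop_apply ?A x) y"
        using dist_triangle[of z y "bop_apply ?R x"]
          dist_triangle[of "bop_apply ?R x" y "bop_apply ?A x"] by linarith
      also have "\<dots> < \<epsilon>"
        using z(2) near[OF x(1)] x(2) \<epsilon> by linarith
      finally show "y \<in> (\<Union>x\<in>k. ball x \<epsilon>)"
        using z(1) by auto
    qed
    with k(1) show ?thesis by blast
  qed
  then show ?thesis
    unfolding compact_operator_def compact_eq_totally_bounded
    by (auto intro: complete_eq_closed[THEN iffD2])
qed

lemma weak_bound_diag:
  fixes e :: "nat \<Rightarrow> 'h::chilbert_space"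
  assumes e: "orthonormal_basis e" and b: "\<And>k. real (k + 1) * norm (b k) \<le> C"
  shows "weak_bound C (diag_op e b)"
  unfolding weak_bound_def
proof (intro conjI allI exI)
  show "compact_operator (diag_op e b)"
    by (rule compact_operator_diag[OF e b])
  fix n
  show "norm (diag_op e b - diag_op e (\<lambda>k. if k < n then b k else 0)) \<le> C / real (n + 1)"
    by (rule diag_op_tail_bound(1)[OF e b])
  have "bop_apply (diag_op e (\<lambda>k. if k < n then b k else 0)) x \<in> cspan (e ` {..<n})" for x
    unfolding diag_truncation[OF e diag_op_tail_bound(2)[OF e b]]
    by (intro csubspace_sum csubspaceD(3) csubspace_cspan subsetD[OF cspan_superset]) auto
  moreover have "card (e ` {..<n}) \<le> n"
    using card_image_le[of "{..<n}" e] by simp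
  ultimately show "rank_le n (diag_op e (\<lambda>k. if k < n then b k else 0))"
    unfolding rank_le_def by (intro exI[of _ "e ` {..<n}"]) auto
qed


section \<open>Continuous traces on diagonal operators\<close>

locale weak_trace =
  fixes \<phi> :: "'h::chilbert_space bop \<Rightarrow> complex"
  assumes trace: "continuous_trace \<phi>"
begin

lemma trace_add:
  "A \<in> weak_trace_class \<Longrightarrow> B \<in> weak_trace_class \<Longrightarrow> \<phi> (A + B) = \<phi> A + \<phi> B"
  using trace by (simp add: continuous_trace_def)

lemma trace_scale: "A \<in> weak_trace_class \<Longrightarrow> \<phi> (a *\<^sub>C A) = a * \<phi> A"
  using trace by (simp add: continuous_trace_def)

lemma trace_commute:
  assumes "weak_bound C B"
  shows "\<phi> (A * B) = \<phi> (B * A)"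
proof -
  note W = weak_boundD(1)[OF weak_bound_mult(1)[OF assms, of A]]
    weak_boundD(1)[OF weak_bound_mult(2)[OF assms, of A]]
  \<comment> \<open>The axioms of a trace speak of sums and complex multiples, so the difference is treated as the
    sum with \<open>-1\<close> times \<open>B * A\<close>.\<close>
  have neg: "(-1) *\<^sub>C (B * A) = (- (B * A) :: 'h bop)"
    by (rule scaleC_minus_one)
  have "weak_bound (norm (- A) * C) (B * (- A))"
    by (rule weak_bound_mult[OF assms])
  then have "(-1) *\<^sub>C (B * A) \<in> weak_trace_class"
    using weak_boundD(1) by (simp add: scaleC_minus_one)
  then have "\<phi> (A * B + (-1) *\<^sub>C (B * A)) = \<phi> (A * B) - \<phi> (B * A)"
    using W by (simp add: trace_add trace_scale del: mult_scaleC_left mult_scaleC_right)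
  moreover have "\<phi> (A * B - B * A) = 0"
    using trace weak_boundD(1)[OF assms] by (simp add: continuous_trace_def)
  ultimately show ?thesis
    unfolding neg by simp
qed

lemma trace_bounded:
  "\<exists>K\<ge>0. \<forall>C B. weak_bound C B \<longrightarrow> norm (\<phi> B) \<le> K * C"
proof -
  have "\<exists>C. \<forall>B\<in>weak_trace_class. norm (\<phi> B) \<le> C * weak_norm B"
    using trace by (simp add: continuous_trace_def)
  then obtain C0 where C0: "\<And>B. B \<in> weak_trace_class \<Longrightarrow> norm (\<phi> B) \<le> C0 * weak_norm B"
    by blast
  show ?thesis
  proof (intro exI[of _ "\<bar>C0\<bar>"] conjI allI impI)
    fix C and B :: "'h bop" assume B: "weak_bound C B"
    have "norm (\<phi> B) \<le> C0 * weak_norm B"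
      by (rule C0[OF weak_boundD(1)[OF B]])
    also have "\<dots> \<le> \<bar>C0\<bar> * C"
      using weak_boundD[OF B] by (intro mult_mono) auto
    finally show "norm (\<phi> B) \<le> \<bar>C0\<bar> * C" .
  qed simp
qed

text \<open>Two diagonal operators with the same eigenvalues are conjugate by the invertible operator
  that exchanges the bases.\<close>

lemma trace_diag_basis_independent:
  fixes e e' :: "'i \<Rightarrow> 'h"
  assumes e: "orthonormal_basis e" "orthonormal_basis e'" and b: "bounded (range b)"
    and w: "weak_bound C (diag_op e b)"
  shows "\<phi> (diag_op e' b) = \<phi> (diag_op e b)"
proof -
  obtain U :: "'h bop" where U: "\<And>i. bop_apply U (e i) = e' i"
    by (rule basis_op_exists[OF e(1), of e' 1]) (auto simp: orthonormal_basisD[OF e(2)])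
  obtain V :: "'h bop" where V: "\<And>i. bop_apply V (e' i) = e i"
    by (rule basis_op_exists[OF e(2), of e 1]) (auto simp: orthonormal_basisD[OF e(1)])
  have "V * U = 1"
    by (rule bop_eq_on_basis[OF e(1)]) (simp add: U V)
  have "diag_op e' b = U * (diag_op e b * V)"
    by (rule diag_op_eqI[OF e(2) b]) (simp add: U V diag_op_apply e b)
  also have "\<phi> \<dots> = \<phi> (diag_op e b * V * U)"
    by (rule trace_commute[OF weak_bound_mult(2)[OF w]])
  also have "diag_op e b * V * U = diag_op e b"
    by (simp add: mult.assoc \<open>V * U = 1\<close>)
  finally show ?thesis .
qed

lemma finite_diag_bound:
  fixes b :: "nat \<Rightarrow> complex"
  shows "\<exists>C. \<forall>k. real (k + 1) * norm (if k < N then b k else 0) \<le> C"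
proof -
  let ?C = "\<Sum>j<N. real (j + 1) * norm (b j)"
  have "real (k + 1) * norm (if k < N then b k else 0) \<le> ?C" for k
  proof (cases "k < N")
    case True
    have "(\<lambda>j. real (j + 1) * norm (b j)) k \<le> sum (\<lambda>j. real (j + 1) * norm (b j)) {..<N}"
    proof (rule member_le_sum)
      show "k \<in> {..<N}"
        using True by simp
    qed (rule mult_nonneg_nonneg[OF of_nat_0_le_iff norm_ge_zero], rule finite_lessThan)
    with True show ?thesis
      by simp
  next
    case False
    have "0 \<le> ?C"
      by (intro sum_nonneg mult_nonneg_nonneg) auto
    with False show ?thesis
      by simp
  qed
  then show ?thesis
    by (intro exI allI)
qed

lemma trace_diag_truncation:
  fixes e :: "nat \<Rightarrow> 'h"
  assumes e: "orthonormal_basis e"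
  shows "\<phi> (diag_op e (\<lambda>k. if k < N then b k else 0)) =
    (\<Sum>k<N. b k) * \<phi> (diag_op e (\<lambda>k. if k = 0 then 1 else 0))"
proof (induction N)
  let ?E = "\<lambda>n. diag_op e (\<lambda>k. if k = n then 1 else 0)"
  have bdE: "bounded (range (\<lambda>k. if k = n then 1 else (0::complex)))" for n :: nat
    by (rule bounded_subset[of "{0, 1}"]) auto
  have wE: "weak_bound (real (n + 1)) (?E n)" for n
    by (rule weak_bound_diag[OF e]) auto
  have E: "\<phi> (?E n) = \<phi> (?E 0)" for n
  proof -
    \<comment> \<open>Exchanging two basis vectors moves the projection, but does not change the trace.\<close>
    define \<beta> :: "nat \<Rightarrow> nat" where "\<beta> = id(0 := n, n := 0)"
    have \<beta>: "bij \<beta>"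
      by (rule involuntory_imp_bij) (auto simp: \<beta>_def)
    have f: "(\<lambda>k. if k = n then 1 else 0) \<circ> \<beta> = (\<lambda>k. if k = 0 then 1 else (0::complex))"
      by (auto simp: \<beta>_def fun_eq_iff)
    have "?E n = diag_op (e \<circ> \<beta>) ((\<lambda>k. if k = n then 1 else 0) \<circ> \<beta>)"
      by (rule orthonormal_basis_reindex(2)[OF e \<beta>, symmetric])
    also have "\<phi> \<dots> = \<phi> (?E 0)"
      unfolding f by (rule trace_diag_basis_independent[OF e orthonormal_basis_reindex(1)[OF e \<beta>] bdE wE])
    finally show ?thesis .
  qed
  {
    case 0
    have "diag_op e (\<lambda>k. 0) = 0"
      by (rule diag_op_eqI[OF e]) auto
    moreover have "\<phi> 0 = 0"
      using trace_scale[of "?E 0" 0] weak_boundD(1)[OF wE] by simp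
    ultimately show ?case by simp
  next
    case (Suc N)
    obtain C where C: "\<And>k. real (k + 1) * norm (if k < N then b k else 0) \<le> C"
      using finite_diag_bound[of N b] by blast
    note wN = weak_bound_diag[OF e C]
    have "diag_op e (\<lambda>k. if k < Suc N then b k else 0) =
        diag_op e (\<lambda>k. (if k < N then b k else 0) + b N * (if k = N then 1 else 0))"
      by (intro arg_cong2[where f = diag_op]) (auto simp: fun_eq_iff less_Suc_eq)
    also have "\<dots> = diag_op e (\<lambda>k. if k < N then b k else 0) + b N *\<^sub>C ?E N"
      by (simp only: diag_op_algebra(4)[OF e bdE bdE] diag_op_algebra(2)[OF e
            diag_op_tail_bound(2)[OF e C] bounded_range_mult[OF bounded_range_const bdE]])
    also have "\<phi> \<dots> = \<phi> (diag_op e (\<lambda>k. if k < N then b k else 0)) + b N * \<phi> (?E N)"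
    proof -
      have "(b N *\<^sub>C 1) * ?E N \<in> weak_trace_class"
        by (rule weak_boundD(1)[OF weak_bound_mult(1)[OF wE]])
      then have "b N *\<^sub>C ?E N \<in> weak_trace_class"
        by simp
      then show ?thesis
        by (simp only: trace_add[OF weak_boundD(1)[OF wN]] trace_scale[OF weak_boundD(1)[OF wE]])
    qed
    finally show ?case
      by (simp only: Suc E[of N]) (simp add: algebra_simps)
  }
qed

text \<open>All rank-one projections \<open>E k\<close> of the basis have the same trace \<open>c\<close>.  The partial sums of
  \<open>\<Sum>k. E k / (k + 1)\<close> have weak norm at most one, whereas their traces are \<open>c\<close> times the
  harmonic numbers; hence \<open>c = 0\<close>.\<close>

lemma trace_diag_finite:
  fixes e :: "nat \<Rightarrow> 'h"
  assumes e: "orthonormal_basis e"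
  shows "\<phi> (diag_op e (\<lambda>k. if k < N then b k else 0)) = 0"
proof -
  define c where "c = \<phi> (diag_op e (\<lambda>k. if k = 0 then 1 else 0))"
  obtain K where K: "\<And>C B. weak_bound C B \<Longrightarrow> norm (\<phi> B) \<le> K * C"
    using trace_bounded by blast
  let ?h = "\<lambda>k. complex_of_real (1 / real (k + 1))"
  have bound: "norm c * (\<Sum>k<n. 1 / real (k + 1)) \<le> K" for n
  proof -
    have "norm ((\<Sum>k<n. ?h k) * c) = norm (\<phi> (diag_op e (\<lambda>k. if k < n then ?h k else 0)))"
      by (simp only: c_def trace_diag_truncation[OF e])
    also have "\<dots> \<le> K * 1"
      by (rule K[OF weak_bound_diag[OF e]]) (auto simp: norm_divide simp del: of_nat_Suc of_nat_add)
    also have "(\<Sum>k<n. ?h k) = complex_of_real (\<Sum>k<n. 1 / real (k + 1))"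
      by simp
    finally show ?thesis
      by (simp only: norm_mult norm_of_real) (simp add: sum_nonneg mult.commute)
  qed
  have "c = 0"
  proof (rule ccontr)
    assume "c \<noteq> 0"
    have "summable (\<lambda>k. 1 / real (k + 1))"
    proof (rule summableI_nonneg_bounded)
      show "(\<Sum>k<n. 1 / real (k + 1)) \<le> K / norm c" for n
        using bound[of n] \<open>c \<noteq> 0\<close> by (simp add: field_simps)
    qed auto
    then have "summable (\<lambda>k. inverse (real (Suc k)))"
      by (simp add: inverse_eq_divide)
    then show False
      using not_summable_harmonic summable_Suc_iff by blast
  qed
  then show ?thesis
    using trace_diag_truncation[OF e] by (simp add: c_def)
qed

text \<open>Cutting off finitely many eigenvalues does not change the trace, and makes the weak norm of
  the rest as small as desired.\<close>

lemma trace_diag_null: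
  fixes e :: "nat \<Rightarrow> 'h"
  assumes e: "orthonormal_basis e" and b: "(\<lambda>k. of_nat (k + 1) * b k) \<longlonglongrightarrow> (0::complex)"
  shows "\<phi> (diag_op e b) = 0"
proof -
  obtain K where K: "0 \<le> K" "\<And>C B. weak_bound C B \<Longrightarrow> norm (\<phi> B) \<le> K * C"
    using trace_bounded by blast
  have "norm (\<phi> (diag_op e b)) \<le> K * \<epsilon>" if \<epsilon>: "\<epsilon> > 0" for \<epsilon>
  proof -
    obtain N where N: "\<And>k. k \<ge> N \<Longrightarrow> norm (of_nat (k + 1) * b k) < \<epsilon>"
      using b \<epsilon> by (auto simp: LIMSEQ_iff)
    define b1 where "b1 = (\<lambda>k. if k < N then b k else 0)"
    define b2 where "b2 = (\<lambda>k. if k < N then 0 else b k)"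
    have C2: "real (k + 1) * norm (b2 k) \<le> \<epsilon>" for k
    proof (cases "k < N")
      case False
      then have "norm (of_nat (k + 1) * b k) < \<epsilon>"
        by (intro N) auto
      then show ?thesis
        using False by (simp add: b2_def norm_mult del: of_nat_add of_nat_Suc)
    qed (use \<epsilon> in \<open>simp add: b2_def\<close>)
    obtain C where C1: "\<And>k. real (k + 1) * norm (b1 k) \<le> C"
      unfolding b1_def using finite_diag_bound[of N b] by blast
    note bd = diag_op_tail_bound(2)[OF e C1] diag_op_tail_bound(2)[OF e C2]
    note w = weak_bound_diag[OF e C1] weak_bound_diag[OF e C2]
    have "diag_op e b = diag_op e (\<lambda>k. b1 k + b2 k)"
      by (intro arg_cong2[where f = diag_op]) (auto simp: b1_def b2_def fun_eq_iff)
    then have "\<phi> (diag_op e b) = \<phi> (diag_op e b1) + \<phi> (diag_op e b2)"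
      using w[THEN weak_boundD(1)] by (simp add: trace_add flip: diag_op_algebra(2)[OF e bd])
    also have "\<phi> (diag_op e b1) = 0"
      unfolding b1_def by (rule trace_diag_finite[OF e])
    finally show ?thesis
      using K(2)[OF w(2)] by simp
  qed
  then have "norm (\<phi> (diag_op e b)) \<le> 0 + \<delta>" if "\<delta> > 0" for \<delta>
  proof -
    have "norm (\<phi> (diag_op e b)) \<le> K * (\<delta> / (K + 1))"
      using that K(1) by (intro \<open>\<And>\<epsilon>. 0 < \<epsilon> \<Longrightarrow> _\<close>) auto
    also have "\<dots> \<le> \<delta>"
      using that K(1) by (simp add: field_simps)
    finally show ?thesis by simp
  qed
  then have "norm (\<phi> (diag_op e b)) \<le> 0"
    by (rule field_le_epsilon)
  then show ?thesis by simp
qed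

text \<open>The operator is compared with \<open>c\<close> times the diagonal operator with eigenvalues
  \<open>1 / (k + 1)\<close> in the enumerated basis; normalisation refers to some other basis, but the trace
  is the same in all of them.\<close>

lemma trace_diag_asymptotic:
  fixes e :: "'i \<Rightarrow> 'h" and \<beta> :: "nat \<Rightarrow> 'i"
  assumes norm: "normalised_trace \<phi>" and e: "orthonormal_basis e" and \<beta>: "bij \<beta>"
    and b: "(\<lambda>k. of_nat (k + 1) * b (\<beta> k)) \<longlonglongrightarrow> c"
  shows "\<exists>C. weak_bound C (diag_op e b)" "\<phi> (diag_op e b) = c" "bounded (range b)"
proof -
  define f where "f = e \<circ> \<beta>"
  define b' where "b' = b \<circ> \<beta>"
  have f: "orthonormal_basis f" and diag: "diag_op e b = diag_op f b'"
    using orthonormal_basis_reindex[OF e \<beta>] by (simp_all add: f_def b'_def)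
  have b': "(\<lambda>k. of_nat (k + 1) * b' k) \<longlonglongrightarrow> c"
    using b by (simp add: b'_def)
  have "Bseq (\<lambda>k. of_nat (k + 1) * b' k)"
    by (rule convergent_imp_Bseq[OF convergentI[OF b']])
  then obtain C where "\<And>k. norm (of_nat (k + 1) * b' k) \<le> C"
    by (auto simp: Bseq_def)
  then have C: "real (k + 1) * norm (b' k) \<le> C" for k
    by (simp only: norm_mult norm_of_nat)
  show "\<exists>C. weak_bound C (diag_op e b)"
    unfolding diag using weak_bound_diag[OF f C] by blast
  have "range b = range b'"
    using \<beta> by (metis b'_def bij_is_surj image_comp)
  then show "bounded (range b)"
    using diag_op_tail_bound(2)[OF f C] by simp
  let ?h = "\<lambda>k. complex_of_real (1 / real (k + 1))"
  have h: "real (k + 1) * norm (?h k) \<le> 1" for k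
    by (simp add: norm_divide del: of_nat_add of_nat_Suc)
  note bdh = diag_op_tail_bound(2)[OF f h]
  obtain e0 :: "nat \<Rightarrow> 'h" where e0: "orthonormal_basis e0" "\<phi> (diag_op e0 ?h) = 1"
    using norm by (auto simp: normalised_trace_def)
  have \<phi>h: "\<phi> (diag_op f ?h) = 1"
    using trace_diag_basis_independent[OF e0(1) f bdh weak_bound_diag[OF e0(1) h]] e0(2) by simp
  have wh: "diag_op f ?h \<in> weak_trace_class"
    by (rule weak_boundD(1)[OF weak_bound_diag[OF f h]])
  have "weak_bound (norm (c *\<^sub>C (1::'h bop)) * 1) ((c *\<^sub>C 1) * diag_op f ?h)"
    by (rule weak_bound_mult(1)[OF weak_bound_diag[OF f h]])
  then have wch: "c *\<^sub>C diag_op f ?h \<in> weak_trace_class"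
    using weak_boundD(1) by simp
  define d where "d k = b' k - c * ?h k" for k
  have "(\<lambda>k. of_nat (k + 1) * b' k - c) \<longlonglongrightarrow> c - c"
    by (intro tendsto_diff b' tendsto_const)
  moreover have "of_nat (k + 1) * d k = of_nat (k + 1) * b' k - c" for k
    unfolding d_def right_diff_distrib by (simp del: of_nat_add of_nat_Suc)
  ultimately have d: "(\<lambda>k. of_nat (k + 1) * d k) \<longlonglongrightarrow> 0"
    by (simp only:) simp
  have "Bseq (\<lambda>k. of_nat (k + 1) * d k)"
    by (rule convergent_imp_Bseq[OF convergentI[OF d]])
  then obtain D where "\<And>k. norm (of_nat (k + 1) * d k) \<le> D"
    by (auto simp: Bseq_def)
  then have D: "real (k + 1) * norm (d k) \<le> D" for k
    by (simp only: norm_mult norm_of_nat)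
  have bdch: "bounded (range (\<lambda>k. c * ?h k))"
    by (rule bounded_range_mult[OF _ bdh]) auto
  have "diag_op f b' = diag_op f (\<lambda>k. d k + c * ?h k)"
    by (simp add: d_def)
  also have "\<dots> = diag_op f d + c *\<^sub>C diag_op f ?h"
    by (simp only: diag_op_algebra(2)[OF f diag_op_tail_bound(2)[OF f D] bdch, symmetric]
        diag_op_algebra(4)[OF f bdh bdh])
  also have "\<phi> \<dots> = \<phi> (diag_op f d) + c * \<phi> (diag_op f ?h)"
    by (simp only: trace_add[OF weak_boundD(1)[OF weak_bound_diag[OF f D]] wch] trace_scale[OF wh])
  finally show "\<phi> (diag_op e b) = c"
    by (simp only: diag \<phi>h trace_diag_null[OF f d]) simp
qed

end


section \<open>Sorting a countable family\<close>

text \<open>Ties are broken by an arbitrary enumeration, and \<open>\<beta>\<close> inverts the function that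
  counts the predecessors of an index.\<close>

lemma sorting_enumeration:
  fixes q :: "'i::countable \<Rightarrow> real"
  assumes inf: "infinite (UNIV :: 'i set)" and fin: "\<And>t. finite {i. q i < t}"
  obtains \<beta> :: "nat \<Rightarrow> 'i" where "bij \<beta>" "\<And>k. card {i. q i < q (\<beta> k)} \<le> k"
    "\<And>k. k + 1 \<le> card {i. q i < q (\<beta> k) + 1}"
proof -
  define pred where "pred i j \<longleftrightarrow> q i < q j \<or> (q i = q j \<and> to_nat i < to_nat j)" for i j
  define r where "r j = card {i. pred i j}" for j
  have finp: "finite {i. pred i j}" for j
    by (rule finite_subset[OF _ fin[of "q j + 1"]]) (auto simp: pred_def)
  have mono: "r i < r j" if "pred i j" for i j
    unfolding r_def
  proof (rule psubset_card_mono[OF finp])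
    have "{k. pred k i} \<subseteq> {k. pred k j}" "i \<in> {k. pred k j}" "i \<notin> {k. pred k i}"
      using that by (auto simp: pred_def)
    then show "{k. pred k i} \<subset> {k. pred k j}" by blast
  qed
  have total: "pred i j \<or> pred j i" if "i \<noteq> j" for i j
    using that inj_to_nat[THEN injD, of i j] unfolding pred_def by linarith
  have inj: "inj r"
    by (rule injI) (metis mono total less_irrefl)
  have surj: "k \<in> range r" for k
  proof (rule ccontr)
    assume k: "k \<notin> range r"
    \<comment> \<open>An index with the least number \<open>r j\<close> of predecessors exceeding the missing value \<open>k\<close> would have
      all its more than \<open>k\<close> predecessors numbered injectively below \<open>k\<close>.\<close>
    have "infinite (range r)"
      using inf inj by (simp add: finite_image_iff)
    then have "\<exists>n. k < n \<and> n \<in> range r"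
      unfolding infinite_nat_iff_unbounded by blast
    then have "\<exists>j. k < r j" by blast
    then obtain j where j: "k < r j" "\<And>i. k < r i \<Longrightarrow> r j \<le> r i"
      using ex_has_least_nat[of "\<lambda>j. k < r j" _ r] by blast
    have "r ` {i. pred i j} \<subseteq> {..<k}"
    proof safe
      fix i assume "pred i j"
      then have "r i < r j" by (rule mono)
      then have "\<not> k < r i"
        using j(2)[of i] by linarith
      moreover have "r i \<noteq> k"
        using k by blast
      ultimately show "r i < k" by linarith
    qed
    then have "card (r ` {i. pred i j}) \<le> k"
      using card_mono[of "{..<k}"] by simp
    moreover have "card (r ` {i. pred i j}) = card {i. pred i j}"
      by (rule card_image[OF inj_on_subset[OF inj subset_UNIV]])
    ultimately have "r j \<le> k"
      unfolding r_def[of j] by (simp only:)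
    with j(1) show False by simp
  qed
  have "bij r"
    using inj surj by (auto simp: bij_def)
  define \<beta> where "\<beta> = inv r"
  have r\<beta>: "r (\<beta> k) = k" for k
    unfolding \<beta>_def by (rule f_inv_into_f[OF surj])
  show ?thesis
  proof
    show "bij \<beta>"
      unfolding \<beta>_def by (rule bij_imp_bij_inv) fact
    fix k
    have "card {i. q i < q (\<beta> k)} \<le> r (\<beta> k)"
      unfolding r_def by (rule card_mono[OF finp]) (auto simp: pred_def)
    then show "card {i. q i < q (\<beta> k)} \<le> k"
      by (simp add: r\<beta>)
    have "card (insert (\<beta> k) {i. pred i (\<beta> k)}) \<le> card {i. q i < q (\<beta> k) + 1}"
      by (rule card_mono[OF fin]) (auto simp: pred_def)
    moreover have "card (insert (\<beta> k) {i. pred i (\<beta> k)}) = r (\<beta> k) + 1"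
      using finp[of "\<beta> k"] by (simp add: r_def pred_def)
    ultimately show "k + 1 \<le> card {i. q i < q (\<beta> k) + 1}"
      by (simp add: r\<beta>)
  qed
qed

text \<open>The number \<open>k + 1\<close> of the \<open>k\<close>-th index lies between the counting function at
  \<open>q (\<beta> k)\<close> and at \<open>q (\<beta> k) + 1\<close>; the shift is negligible because \<open>q (\<beta> k)\<close> tends to infinity.\<close>

lemma sorting_asymptotics:
  fixes q :: "'i::countable \<Rightarrow> real"
  assumes inf: "infinite (UNIV :: 'i set)" and fin: "\<And>t. finite {i. q i < t}"
    and lim: "((\<lambda>t. real (card {i. q i < t}) / t) \<longlongrightarrow> V) at_top"
  obtains \<beta> :: "nat \<Rightarrow> 'i" where "bij \<beta>" "(\<lambda>k. real (k + 1) / q (\<beta> k)) \<longlonglongrightarrow> V"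
    "filterlim (\<lambda>k. q (\<beta> k)) at_top sequentially"
proof -
  obtain \<beta> :: "nat \<Rightarrow> 'i" where \<beta>: "bij \<beta>" "\<And>k. card {i. q i < q (\<beta> k)} \<le> k"
    "\<And>k. k + 1 \<le> card {i. q i < q (\<beta> k) + 1}"
    by (rule sorting_enumeration[OF inf fin]) (rule that)
  let ?N = "\<lambda>t. real (card {i. q i < t})"
  have top: "filterlim (\<lambda>k. q (\<beta> k)) at_top sequentially"
    unfolding filterlim_at_top
  proof
    fix Z
    have "finite {k. q (\<beta> k) < Z}"
      using finite_vimageI[OF fin bij_is_inj[OF \<beta>(1)], of Z] by (simp add: vimage_def)
    then show "\<forall>\<^sub>F k in sequentially. Z \<le> q (\<beta> k)"
      by (simp add: eventually_cofinite not_le flip: cofinite_eq_sequentially)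
  qed
  have pos: "\<forall>\<^sub>F k in sequentially. 0 < q (\<beta> k)"
    using top by (simp add: filterlim_at_top_dense)
  have "(\<lambda>k. real (k + 1) / q (\<beta> k)) \<longlonglongrightarrow> V"
  proof (rule tendsto_sandwich)
    show "(\<lambda>k. ?N (q (\<beta> k)) / q (\<beta> k)) \<longlonglongrightarrow> V"
      by (rule filterlim_compose[OF lim top])
    have top1: "filterlim (\<lambda>k. q (\<beta> k) + 1) at_top sequentially"
      by (rule filterlim_at_top_mono[OF top]) simp
    have "(\<lambda>k. 1 / q (\<beta> k)) \<longlonglongrightarrow> 0"
      by (rule real_tendsto_divide_at_top[OF tendsto_const top])
    then have "(\<lambda>k. ?N (q (\<beta> k) + 1) / (q (\<beta> k) + 1) * (1 + 1 / q (\<beta> k))) \<longlonglongrightarrow> V * (1 + 0)"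
      by (intro tendsto_mult tendsto_add tendsto_const filterlim_compose[OF lim top1])
    then show "(\<lambda>k. ?N (q (\<beta> k) + 1) / (q (\<beta> k) + 1) * (1 + 1 / q (\<beta> k))) \<longlonglongrightarrow> V"
      by simp
    show "\<forall>\<^sub>F k in sequentially. ?N (q (\<beta> k)) / q (\<beta> k) \<le> real (k + 1) / q (\<beta> k)"
      using pos
    proof eventually_elim
      case (elim k)
      then show ?case
        using \<beta>(2)[of k] by (intro divide_right_mono) auto
    qed
    show "\<forall>\<^sub>F k in sequentially. real (k + 1) / q (\<beta> k) \<le>
        ?N (q (\<beta> k) + 1) / (q (\<beta> k) + 1) * (1 + 1 / q (\<beta> k))"
      using pos
    proof eventually_elim
      case (elim k)
      have "real (k + 1) / q (\<beta> k) \<le> ?N (q (\<beta> k) + 1) / q (\<beta> k)"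
        using elim \<beta>(3)[of k] by (intro divide_right_mono) (auto simp del: of_nat_add)
      also have "\<dots> = ?N (q (\<beta> k) + 1) / (q (\<beta> k) + 1) * (1 + 1 / q (\<beta> k))"
        using elim by (simp add: divide_simps)
      finally show ?case .
    qed
  qed
  with \<beta>(1) top show ?thesis
    by (intro that)
qed


section \<open>Counting lattice points\<close>

lemma finite_int_vectors_bounded: "finite {m :: int ^ 'd::finite. \<forall>j. \<bar>m $ j\<bar> \<le> K}"
proof (rule finite_subset)
  show "finite ((\<lambda>f. \<chi> j. f j) ` (PiE (UNIV :: 'd set) (\<lambda>_. {-K..K})))"
    by (intro finite_imageI finite_PiE) auto
  show "{m :: int ^ 'd. \<forall>j. \<bar>m $ j\<bar> \<le> K} \<subseteq> (\<lambda>f. \<chi> j. f j) ` (PiE UNIV (\<lambda>_. {-K..K}))"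
  proof
    fix m :: "int ^ 'd" assume m: "m \<in> {m. \<forall>j. \<bar>m $ j\<bar> \<le> K}"
    have "m $ j \<in> {-K..K}" for j
      using m by (auto dest!: spec[of _ j])
    then have "(\<lambda>j. m $ j) \<in> PiE UNIV (\<lambda>_. {-K..K})"
      by (auto simp: PiE_def Pi_def extensional_def)
    moreover have "m = (\<chi> j. m $ j)"
      by simp
    ultimately show "m \<in> (\<lambda>f. \<chi> j. f j) ` (PiE UNIV (\<lambda>_. {-K..K}))"
      by (metis image_eqI)
  qed
qed

lemma real_vec_simps [simp]:
  "real_vec n $ j = real_of_int (n $ j)" "real_vec 0 = 0" "real_vec (n + m) = real_vec n + real_vec m"
  "real_vec n = 0 \<longleftrightarrow> n = 0"
  by (auto simp: real_vec_def vec_eq_iff)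

lemma finite_lattice_points:
  fixes E :: "(real ^ 'd::finite) set"
  assumes "bounded E" "R > 0"
  shows "finite {m. (1 / R) *\<^sub>R real_vec m \<in> E}"
proof -
  obtain K where K: "\<And>x. x \<in> E \<Longrightarrow> norm x \<le> K"
    using assms(1) by (auto simp: bounded_iff)
  have "{m. (1 / R) *\<^sub>R real_vec m \<in> E} \<subseteq> {m. \<forall>j. \<bar>m $ j\<bar> \<le> \<lceil>R * K\<rceil>}"
  proof safe
    fix m :: "int ^ 'd" and j
    assume "(1 / R) *\<^sub>R real_vec m \<in> E"
    then have "norm ((1 / R) *\<^sub>R real_vec m) \<le> K" by (rule K)
    then have "norm (real_vec m) \<le> R * K"
      using assms(2) by (simp add: field_simps)
    then have "\<bar>real_of_int (m $ j)\<bar> \<le> R * K"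
      using component_le_norm_cart[of "real_vec m" j] by simp
    then show "\<bar>m $ j\<bar> \<le> \<lceil>R * K\<rceil>"
      by linarith
  qed
  then show ?thesis
    by (rule finite_subset) (rule finite_int_vectors_bounded)
qed

definition lattice_cell :: "real \<Rightarrow> int ^ 'd::finite \<Rightarrow> (real ^ 'd) set" where
  "lattice_cell R m = {x. \<forall>j. real_of_int (m $ j) \<le> R * x $ j \<and> R * x $ j < real_of_int (m $ j) + 1}"

lemma lattice_cell_iff: "x \<in> lattice_cell R m \<longleftrightarrow> m = (\<chi> j. \<lfloor>R * x $ j\<rfloor>)"
  by (auto simp: lattice_cell_def vec_eq_iff floor_eq_iff eq_commute[of "m $ _"])

lemma lattice_cell_borel [measurable]: "lattice_cell R m \<in> sets borel"
proof -
  have "lattice_cell R m = (\<Inter>j. {x. real_of_int (m $ j) \<le> R * x $ j} \<inter> {x. R * x $ j < real_of_int (m $ j) + 1})"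
    by (auto simp: lattice_cell_def)
  also have "\<dots> \<in> sets borel"
    by (intro sets.countable_INT'' sets.Int borel_closed borel_open closed_Collect_le open_Collect_less
        continuous_intros) auto
  finally show ?thesis .
qed

lemma emeasure_lattice_cell:
  fixes m :: "int ^ 'd::finite"
  assumes R: "R > 0"
  shows "emeasure lborel (lattice_cell R m) = ennreal ((1 / R) ^ CARD('d))"
proof (rule antisym)
  define a b :: "real ^ 'd" where "a = (\<chi> j. m $ j / R)" and "b = (\<chi> j. (m $ j + 1) / R)"
  have ab: "(b - a) \<bullet> i = 1 / R" "a \<bullet> i \<le> b \<bullet> i" if "i \<in> Basis" for i
    using that R by (auto simp: a_def b_def Basis_vec_def inner_axis divide_right_mono field_simps)
  have vol: "(\<Prod>i\<in>(Basis :: (real ^ 'd) set). (b - a) \<bullet> i) = (1 / R) ^ CARD('d)"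
    using ab(1) by (simp cong: prod.cong)
  have "emeasure lborel (lattice_cell R m) \<le> emeasure lborel (cbox a b)"
    using R by (intro emeasure_mono)
      (auto simp: lattice_cell_def mem_box_cart a_def b_def field_simps less_imp_le)
  also have "emeasure lborel (cbox a b) = ennreal ((1 / R) ^ CARD('d))"
    using ab(2) by (simp add: emeasure_lborel_cbox_eq vol)
  finally show "emeasure lborel (lattice_cell R m) \<le> ennreal ((1 / R) ^ CARD('d))" .
  have "ennreal ((1 / R) ^ CARD('d)) = emeasure lborel (box a b)"
    using ab(2) by (simp add: emeasure_lborel_box_eq vol)
  also have "\<dots> \<le> emeasure lborel (lattice_cell R m)"
    using R by (intro emeasure_mono)
      (auto simp: lattice_cell_def mem_box_cart a_def b_def field_simps less_imp_le)
  finally show "ennreal ((1 / R) ^ CARD('d)) \<le> emeasure lborel (lattice_cell R m)" .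
qed

text \<open>The number of lattice points times the volume of a cell is the integral of the step
  function that rounds the indicator of \<open>E\<close> down to the lattice.  Away from the frontier of
  \<open>E\<close> these step functions converge to the indicator.\<close>

lemma lattice_point_asymptotics:
  fixes E :: "(real ^ 'd::finite) set"
  assumes bd: "bounded E" and E: "E \<in> sets borel" and front: "negligible (frontier E)"
  shows "((\<lambda>R. real (card {m. (1 / R) *\<^sub>R real_vec m \<in> E}) / R ^ CARD('d)) \<longlongrightarrow> measure lborel E) at_top"
proof -
  define M where "M R = {m :: int ^ 'd. (1 / R) *\<^sub>R real_vec m \<in> E}" for R
  define s :: "real \<Rightarrow> real ^ 'd \<Rightarrow> real"
    where "s R x = (\<Sum>m\<in>M R. indicator (lattice_cell R m) x)" for R x
  define y where "y R x = (1 / R) *\<^sub>R real_vec (\<chi> j. \<lfloor>R * x $ j\<rfloor>)" for R and x :: "real ^ 'd"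
  have s_eq: "s R x = indicator E (y R x)" if "R > 0" for R x
  proof -
    have "s R x = (\<Sum>m\<in>M R. if m = (\<chi> j. \<lfloor>R * x $ j\<rfloor>) then 1 else 0)"
      unfolding s_def by (intro sum.cong) (auto simp: indicator_def lattice_cell_iff)
    also have "\<dots> = indicator E (y R x)"
      using finite_lattice_points[OF bd that]
      by (simp add: sum.delta M_def indicator_def y_def)
    finally show ?thesis .
  qed
  have comp: "\<bar>y R x $ j - x $ j\<bar> \<le> 1 / R" if R: "R > 0" for R x j
  proof -
    have "\<bar>real_of_int \<lfloor>R * x $ j\<rfloor> - R * x $ j\<bar> \<le> 1"
      by linarith
    then have "\<bar>(real_of_int \<lfloor>R * x $ j\<rfloor> - R * x $ j) / R\<bar> \<le> 1 / R"
      using R by (simp add: divide_right_mono)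
    also have "(real_of_int \<lfloor>R * x $ j\<rfloor> - R * x $ j) / R = y R x $ j - x $ j"
      using R by (simp add: y_def field_simps)
    finally show ?thesis .
  qed
  have lim: "((\<lambda>R. y R x) \<longlongrightarrow> x) at_top" for x
  proof (rule vec_tendstoI)
    fix j
    have "((\<lambda>R. y R x $ j - x $ j) \<longlongrightarrow> 0) at_top"
    proof (rule Lim_null_comparison)
      show "\<forall>\<^sub>F R in at_top. norm (y R x $ j - x $ j) \<le> 1 / R"
        using eventually_gt_at_top[of 0] by eventually_elim (simp only: real_norm_def comp)
      show "((\<lambda>R::real. 1 / R) \<longlongrightarrow> 0) at_top"
        by (rule real_tendsto_divide_at_top[OF tendsto_const filterlim_ident])
    qed
    then show "((\<lambda>R. y R x $ j) \<longlongrightarrow> x $ j) at_top"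
      by (simp add: LIM_zero_iff)
  qed
  obtain K where K: "\<And>x. x \<in> E \<Longrightarrow> norm x \<le> K"
    using bd by (auto simp: bounded_iff)
  have int: "((\<lambda>R. integral\<^sup>L lborel (s R)) \<longlongrightarrow> integral\<^sup>L lborel (indicator E :: _ \<Rightarrow> real)) at_top"
  proof (rule integral_dominated_convergence_at_top)
    show "(indicator E :: _ \<Rightarrow> real) \<in> borel_measurable lborel"
      using E by simp
    show "s R \<in> borel_measurable lborel" for R
      unfolding s_def by measurable
    \<comment> \<open>For \<open>R \<ge> 1\<close> rounding moves each coordinate by at most one, hence a point by at most \<open>d\<close>.\<close>
    show "integrable lborel (indicator (cball (0 :: real ^ 'd) (K + CARD('d))) :: _ \<Rightarrow> real)"
      by (intro integrable_real_indicator emeasure_compact_finite) auto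
    have "AE x in completion lborel. x \<notin> frontier E"
      using front by (intro AE_not_in) (simp add: negligible_iff_null_sets)
    then have "AE x in lborel. x \<notin> frontier E"
      by (simp add: AE_completion_iff)
    then show "AE x in lborel. ((\<lambda>R. s R x) \<longlongrightarrow> indicator E x) at_top"
    proof eventually_elim
      fix x assume "x \<notin> frontier E"
      then consider "x \<in> interior E" | "x \<in> interior (- E)"
        by (auto simp: frontier_def interior_closure)
      then have "\<forall>\<^sub>F R in at_top. indicator E (y R x) = (indicator E x :: real)"
      proof cases
        case 1
        then have "\<forall>\<^sub>F R in at_top. y R x \<in> interior E"
          by (intro topological_tendstoD[OF lim]) auto
        then show ?thesis
          using 1 interior_subset[of E] by (auto elim!: eventually_mono simp: indicator_def)
      next
        case 2
        then have "\<forall>\<^sub>F R in at_top. y R x \<in> interior (- E)"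
          by (intro topological_tendstoD[OF lim]) auto
        then show ?thesis
          using 2 interior_subset[of "- E"] by (auto elim!: eventually_mono simp: indicator_def)
      qed
      with eventually_gt_at_top[of 0] have "\<forall>\<^sub>F R in at_top. indicator E x = s R x"
        by eventually_elim (simp add: s_eq)
      then show "((\<lambda>R. s R x) \<longlongrightarrow> indicator E x) at_top"
        by (rule Lim_transform_eventually[OF tendsto_const])
    qed
    show "\<forall>\<^sub>F R in at_top. AE x in lborel. norm (s R x) \<le> indicator (cball 0 (K + CARD('d))) x"
      using eventually_ge_at_top[of 1]
    proof eventually_elim
      fix R :: real assume R: "1 \<le> R"
      have "x \<in> cball 0 (K + CARD('d))" if "y R x \<in> E" for x
      proof -
        have "\<bar>(x - y R x) $ j\<bar> \<le> 1" for j
          using comp[of R x j] R by (simp add: abs_minus_commute) (smt (verit) divide_le_eq_1)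
        then have "(\<Sum>j\<in>UNIV. \<bar>(x - y R x) $ j\<bar>) \<le> (\<Sum>j\<in>(UNIV :: 'd set). 1)"
          by (intro sum_mono)
        then have "norm (x - y R x) \<le> CARD('d)"
          using norm_le_l1_cart[of "x - y R x"] by simp
        then show ?thesis
          using K[OF that] norm_triangle_ineq[of "x - y R x" "y R x"] by simp
      qed
      then show "AE x in lborel. norm (s R x) \<le> indicator (cball 0 (K + CARD('d))) x"
        using R by (intro AE_I2) (auto simp: s_eq indicator_def)
    qed
  qed
  have "integral\<^sup>L lborel (s R) = real (card (M R)) / R ^ CARD('d)" if R: "R > 0" for R
  proof -
    have cell: "measure lborel (lattice_cell R m) = (1 / R) ^ CARD('d)" for m :: "int ^ 'd"
      using R by (simp add: measure_def emeasure_lattice_cell)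
    have "integral\<^sup>L lborel (s R) = (\<Sum>m\<in>M R. integral\<^sup>L lborel (indicator (lattice_cell R m)))"
      unfolding s_def using R
      by (intro Bochner_Integration.integral_sum integrable_real_indicator)
         (auto simp: emeasure_lattice_cell)
    also have "\<dots> = (\<Sum>m\<in>M R. (1 / R) ^ CARD('d))"
      by (simp add: cell)
    finally show ?thesis
      by (simp add: power_one_over field_simps)
  qed
  then have "\<forall>\<^sub>F R in at_top. integral\<^sup>L lborel (s R) = real (card (M R)) / R ^ CARD('d)"
    by (intro eventually_mono[OF eventually_gt_at_top[of 0]])
  with int have "((\<lambda>R. real (card (M R)) / R ^ CARD('d)) \<longlongrightarrow> integral\<^sup>L lborel (indicator E :: _ \<Rightarrow> real)) at_top"
    by (rule Lim_transform_eventually)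
  then show ?thesis
    by (simp add: M_def)
qed


section \<open>The solid below a positive homogeneous function\<close>

lemma Rep_direction: "x \<noteq> 0 \<Longrightarrow> Rep_sphere (direction x) = x /\<^sub>R norm x"
  unfolding direction_def by (rule Abs_sphere_inverse) simp

lemma direction_scaleR: "c > 0 \<Longrightarrow> direction (c *\<^sub>R x) = direction x"
proof -
  assume "c > 0"
  then have *: "inverse (\<bar>c\<bar> * norm x) * c = inverse (norm x)"
    by (simp add: field_simps)
  show ?thesis
    by (simp only: direction_def norm_scaleR scaleR_scaleR *)
qed

lemma continuous_on_direction: "continuous_on (- {0}) direction"
proof (rule continuous_onI)
  fix x :: "real ^ 'd" and \<epsilon> :: real
  assume x: "x \<in> - {0}" and \<epsilon>: "0 < \<epsilon>"
  have "continuous_on (- {0 :: real ^ 'd}) (\<lambda>x. x /\<^sub>R norm x)"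
    by (intro continuous_intros) auto
  then obtain \<delta> where \<delta>: "\<delta> > 0" "\<And>x'. x' \<in> - {0} \<Longrightarrow> dist x' x < \<delta> \<Longrightarrow>
      dist (x' /\<^sub>R norm x') (x /\<^sub>R norm x) < \<epsilon>"
    using x \<epsilon> unfolding continuous_on_iff by meson
  have "dist (direction x') (direction x) \<le> \<epsilon>" if "x' \<in> - {0}" "dist x' x < \<delta>" for x'
    using \<delta>(2)[OF that] that x by (simp add: dist_sphere_def Rep_direction less_imp_le)
  with \<delta>(1) show "\<exists>d>0. \<forall>x'\<in>- {0}. dist x' x < d \<longrightarrow> dist (direction x') (direction x) \<le> \<epsilon>"
    by blast
qed

lemma borel_measurable_direction [measurable]: "direction \<in> borel_measurable borel"
  by (rule borel_measurable_continuous_countable_exceptions[of "{0}"])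
     (auto intro: continuous_on_direction)

lemma nn_integral_scaleR:
  fixes f :: "'a::euclidean_space \<Rightarrow> ennreal"
  assumes [measurable]: "f \<in> borel_measurable borel" and c: "c > 0"
  shows "(\<integral>\<^sup>+x. f x \<partial>lborel) = (\<integral>\<^sup>+x. ennreal (c ^ DIM('a)) * f (c *\<^sub>R x) \<partial>lborel)"
proof -
  have "(\<integral>\<^sup>+x. f x \<partial>lborel) =
      (\<integral>\<^sup>+x. f x \<partial>density (distr lborel borel (\<lambda>x. 0 + c *\<^sub>R x)) (\<lambda>_. \<bar>c\<bar> ^ DIM('a)))"
    using lborel_affine[of c "0::'a"] c by simp
  also have "\<dots> = (\<integral>\<^sup>+x. ennreal (c ^ DIM('a)) * f (c *\<^sub>R x) \<partial>lborel)"
    using c by (simp add: nn_integral_density nn_integral_distr)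
  finally show ?thesis .
qed

text \<open>At the origin \<open>direction\<close> has some unspecified value, where \<open>g\<close> is positive; hence the
  solid below a positive \<open>g\<close> contains the origin.\<close>

definition radial_solid :: "('d::finite sphere \<Rightarrow> real) \<Rightarrow> (real ^ 'd) set" where
  "radial_solid g = {x. norm x ^ CARD('d) < g (direction x)}"

lemma borel_measurable_radial [measurable]:
  assumes "continuous_on UNIV g"
  shows "(\<lambda>x. g (direction x) :: real) \<in> borel_measurable borel"
  using borel_measurable_continuous_onI[OF assms] by (rule measurable_compose[OF borel_measurable_direction])

lemma radial_solid_borel:
  assumes "continuous_on UNIV g"
  shows "radial_solid g \<in> sets borel"
  unfolding radial_solid_def using borel_measurable_radial[OF assms] by measurable

text \<open>Polar coordinates in disguise.  For \<open>x \<noteq> 0\<close> the integral of \<open>norm x ^ d / t ^ 2\<close> over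
  \<open>t > norm x ^ d\<close> is one; inserted into the volume, it turns the volume into a double integral.
  Exchanging the integrals and replacing \<open>x\<close> by \<open>t powr (1/d)\<close> times \<open>x\<close> changes the condition
  \<open>norm x ^ d < t\<close> into \<open>norm x < 1\<close>, and the integral over \<open>t\<close> becomes \<open>g (direction x)\<close>.\<close>

lemma emeasure_radial_solid:
  fixes g :: "'d::finite sphere \<Rightarrow> real"
  assumes g: "continuous_on UNIV g" "\<And>s. 0 < g s"
  shows "emeasure lborel (radial_solid g) =
    (\<integral>\<^sup>+x. ennreal (g (direction x)) * indicator (ball 0 1 - {0}) x \<partial>lborel)"
proof -
  note [measurable] = borel_measurable_radial[OF g(1)] radial_solid_borel[OF g(1)]
  let ?d = "CARD('d)"
  define F :: "real \<Rightarrow> real ^ 'd \<Rightarrow> ennreal" where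
    "F t x = (if x \<noteq> 0 \<and> norm x < 1 \<and> 0 < t \<and> norm x ^ ?d * t < g (direction x)
       then ennreal (norm x ^ ?d) else 0)" for t x
  define H :: "real \<Rightarrow> real ^ 'd \<Rightarrow> ennreal" where
    "H t x = (if x \<noteq> 0 \<and> x \<in> radial_solid g \<and> norm x ^ ?d < t
       then ennreal (norm x ^ ?d / t\<^sup>2) else 0)" for t x
  have [measurable]: "(\<lambda>(x, t). F t x) \<in> borel_measurable (lborel \<Otimes>\<^sub>M lborel)"
    "(\<lambda>(t, x). H t x) \<in> borel_measurable (lborel \<Otimes>\<^sub>M lborel)"
    "(\<lambda>(x, t). H t x) \<in> borel_measurable (lborel \<Otimes>\<^sub>M lborel)"
    "(\<lambda>x. F t x) \<in> borel_measurable borel" for t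
    unfolding F_def H_def by measurable
  have slice: "(\<integral>\<^sup>+t. F t x \<partial>lborel) = ennreal (g (direction x)) * indicator (ball 0 1 - {0}) x" for x
  proof (cases "x \<noteq> 0 \<and> norm x < 1")
    case True
    let ?a = "norm x ^ ?d"
    have a: "?a > 0"
      using True by simp
    have "(\<integral>\<^sup>+t. F t x \<partial>lborel) = (\<integral>\<^sup>+t. ennreal ?a * indicator {0<..<g (direction x) / ?a} t \<partial>lborel)"
      using True a by (intro nn_integral_cong) (auto simp: F_def indicator_def field_simps)
    also have "\<dots> = ennreal ?a * ennreal (g (direction x) / ?a)"
      using a g(2)[of "direction x"] by (subst nn_integral_cmult_indicator) (auto simp: less_imp_le)
    also have "\<dots> = ennreal (g (direction x))"
      using True g(2)[of "direction x"] by (subst ennreal_mult[symmetric]) (auto simp: less_imp_le)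
    finally show ?thesis
      using True by simp
  next
    case False
    then have "F t x = 0" for t
      by (auto simp: F_def)
    with False show ?thesis
      by (auto simp: indicator_def)
  qed
  have rescale: "(\<integral>\<^sup>+x. F t x \<partial>lborel) = (\<integral>\<^sup>+x. H t x \<partial>lborel)" for t
  proof (cases "t > 0")
    case True
    define c where "c = 1 / root ?d t"
    have c: "c > 0" "c ^ ?d = 1 / t"
      using True by (auto simp: c_def power_divide)
    have "ennreal (c ^ DIM(real ^ 'd)) * F t (c *\<^sub>R x) = H t x" for x
    proof -
      have norm: "norm (c *\<^sub>R x) ^ ?d = norm x ^ ?d / t"
        using c by (simp add: power_mult_distrib)
      have "norm (c *\<^sub>R x) < 1 \<longleftrightarrow> norm (c *\<^sub>R x) ^ ?d < 1"
        using power_less_one_iff[of "norm (c *\<^sub>R x)" ?d] by simp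
      also have "\<dots> \<longleftrightarrow> norm x ^ ?d < t"
        unfolding norm using True by simp
      finally have lt: "norm (c *\<^sub>R x) < 1 \<longleftrightarrow> norm x ^ ?d < t" .
      have "c *\<^sub>R x \<noteq> 0 \<longleftrightarrow> x \<noteq> 0"
        using c by simp
      then show ?thesis
        using True c(2) unfolding F_def H_def lt norm direction_scaleR[OF c(1)] radial_solid_def
        by (auto simp: power2_eq_square ennreal_mult[symmetric])
    qed
    then show ?thesis
      using nn_integral_scaleR[of "F t" c] c by simp
  next
    case False
    have "norm x ^ ?d < t \<Longrightarrow> 0 < t" for x :: "real ^ 'd"
      by (erule order.strict_trans1[rotated]) simp
    then have "F t x = 0" "H t x = 0" for x
      using False by (auto simp: F_def H_def)
    then show ?thesis by simp
  qed
  have shell: "(\<integral>\<^sup>+t. H t x \<partial>lborel) = indicator (radial_solid g - {0}) x" for x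
  proof (cases "x \<in> radial_solid g - {0}")
    case True
    let ?a = "norm x ^ ?d"
    have a: "?a > 0"
      using True by simp
    have "(\<integral>\<^sup>+t. H t x \<partial>lborel) = (\<integral>\<^sup>+t. ennreal (?a / t\<^sup>2) * indicator {?a..} t \<partial>lborel)"
    proof (rule nn_integral_cong_AE)
      have "AE t in lborel. t \<noteq> ?a"
        by (rule AE_lborel_singleton)
      then show "AE t in lborel. H t x = ennreal (?a / t\<^sup>2) * indicator {?a..} t"
        by eventually_elim (use True in \<open>auto simp: H_def indicator_def\<close>)
    qed
    also have "\<dots> = ennreal (0 - (- ?a / ?a))"
    proof (rule nn_integral_FTC_atLeast[where F = "\<lambda>t. - ?a / t"])
      show "((\<lambda>t. - ?a / t) \<longlongrightarrow> 0) at_top"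
        by (rule real_tendsto_divide_at_top[OF tendsto_const filterlim_ident])
      show "((\<lambda>t. - ?a / t) has_real_derivative ?a / t\<^sup>2) (at t)" if "?a \<le> t" for t
        using that a by (auto intro!: derivative_eq_intros simp: power2_eq_square)
    qed auto
    finally show ?thesis
      using True a by simp
  qed (auto simp: H_def)
  have "(\<integral>\<^sup>+x. ennreal (g (direction x)) * indicator (ball 0 1 - {0}) x \<partial>lborel) =
      (\<integral>\<^sup>+x. (\<integral>\<^sup>+t. F t x \<partial>lborel) \<partial>lborel)"
    by (simp add: slice)
  also have "\<dots> = (\<integral>\<^sup>+t. (\<integral>\<^sup>+x. F t x \<partial>lborel) \<partial>lborel)"
    by (rule lborel_pair.Fubini'[symmetric]) measurable
  also have "\<dots> = (\<integral>\<^sup>+t. (\<integral>\<^sup>+x. H t x \<partial>lborel) \<partial>lborel)"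
    by (simp add: rescale)
  also have "\<dots> = (\<integral>\<^sup>+x. (\<integral>\<^sup>+t. H t x \<partial>lborel) \<partial>lborel)"
    by (rule lborel_pair.Fubini') measurable
  also have "\<dots> = emeasure lborel (radial_solid g - {0})"
    by (simp add: shell)
  also have "\<dots> = emeasure lborel (radial_solid g)"
    by (rule emeasure_Diff_null_set) (auto simp: null_sets_def)
  finally show ?thesis ..
qed

text \<open>Away from the origin the frontier lies on the graph \<open>norm x ^ d = g (direction x)\<close>, which
  meets every ray only once.\<close>

lemma negligible_frontier_radial_solid:
  fixes g :: "'d::finite sphere \<Rightarrow> real"
  assumes g: "continuous_on UNIV g" "\<And>s. \<alpha> \<le> g s" "0 < \<alpha>"
  shows "negligible (frontier (radial_solid g))"
proof -
  let ?d = "CARD('d)"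
  let ?S = "{x :: real ^ 'd. norm x ^ ?d = g (direction x)}"
  have cont: "continuous_on (- {0}) (\<lambda>x :: real ^ 'd. g (direction x))"
    by (rule continuous_on_compose2[OF g(1) continuous_on_direction]) auto
  have lt: "open {x \<in> - {0 :: real ^ 'd}. norm x ^ ?d < g (direction x)}"
    and gt: "open {x \<in> - {0 :: real ^ 'd}. g (direction x) < norm x ^ ?d}"
  proof -
    let ?h = "\<lambda>x :: real ^ 'd. g (direction x) - norm x ^ ?d"
    have h: "continuous_on (- {0}) ?h"
      by (intro continuous_intros cont)
    have "open (- {0} \<inter> ?h -` {0<..})"
      by (intro continuous_open_preimage h) auto
    moreover have "open (- {0} \<inter> ?h -` {..<0})"
      by (intro continuous_open_preimage h) auto
    moreover have "- {0} \<inter> ?h -` {0<..} = {x \<in> - {0}. norm x ^ ?d < g (direction x)}"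
      "- {0} \<inter> ?h -` {..<0} = {x \<in> - {0}. g (direction x) < norm x ^ ?d}"
      by auto
    ultimately show "open {x \<in> - {0 :: real ^ 'd}. norm x ^ ?d < g (direction x)}"
      "open {x \<in> - {0 :: real ^ 'd}. g (direction x) < norm x ^ ?d}"
      by simp_all
  qed
  have "?S \<subseteq> {x. x \<noteq> 0}"
    using g(2,3) by (auto simp: power_0_left) (metis less_le_not_le order_less_le_trans)
  have "closed ?S"
  proof -
    have "closed {x :: real ^ 'd. norm x ^ ?d \<ge> \<alpha>}"
      by (intro closed_Collect_le continuous_intros)
    moreover have "{x :: real ^ 'd. norm x ^ ?d \<ge> \<alpha>} \<subseteq> - {0}"
      using g(3) by (auto simp: power_0_left)
    then have "continuous_on {x :: real ^ 'd. norm x ^ ?d \<ge> \<alpha>} (\<lambda>x. norm x ^ ?d - g (direction x))"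
      by (intro continuous_intros continuous_on_subset[OF cont])
    ultimately have "closed ({x :: real ^ 'd. norm x ^ ?d \<ge> \<alpha>} \<inter> (\<lambda>x. norm x ^ ?d - g (direction x)) -` {0})"
      by (intro continuous_closed_preimage) auto
    also have "\<dots> = ?S"
      using g(2) by auto
    finally show ?thesis .
  qed
  then have "negligible ?S"
  proof (rule starlike_negligible[where a = 0])
    fix c and x :: "real ^ 'd"
    assume cx: "0 + c *\<^sub>R x \<in> ?S" and c: "0 \<le> c" and x: "0 + x \<in> ?S"
    have "c \<noteq> 0"
      using subsetD[OF \<open>?S \<subseteq> {x. x \<noteq> 0}\<close> cx] by auto
    with c have c: "c > 0" by simp
    have "x \<noteq> 0"
      using subsetD[OF \<open>?S \<subseteq> {x. x \<noteq> 0}\<close> x] by auto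
    have "c ^ ?d * norm x ^ ?d = norm x ^ ?d"
      using cx x c by (simp add: direction_scaleR power_mult_distrib)
    then have "c ^ ?d = 1"
      using \<open>x \<noteq> 0\<close> by simp
    then show "c = 1"
      using power_eq_imp_eq_base[of c ?d 1] c by simp
  qed
  then have "negligible (insert 0 ?S)"
    by simp
  moreover have "frontier (radial_solid g) \<subseteq> insert 0 ?S"
  proof
    fix x assume x: "x \<in> frontier (radial_solid g)"
    show "x \<in> insert 0 ?S"
    proof (rule ccontr)
      assume "x \<notin> insert 0 ?S"
      then consider "x \<in> {x \<in> - {0}. norm x ^ ?d < g (direction x)}"
        | "x \<in> {x \<in> - {0}. g (direction x) < norm x ^ ?d}"
        by (auto simp: neq_iff)
      then show False
      proof cases
        case 1
        have "{x \<in> - {0}. norm x ^ ?d < g (direction x)} \<subseteq> radial_solid g"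
          by (auto simp: radial_solid_def)
        with 1 lt have "x \<in> interior (radial_solid g)"
          by (meson interiorI)
        with x show False
          by (simp add: frontier_def)
      next
        case 2
        have "{x \<in> - {0}. g (direction x) < norm x ^ ?d} \<subseteq> - radial_solid g"
          by (auto simp: radial_solid_def)
        with 2 gt have "x \<in> interior (- radial_solid g)"
          by (meson interiorI)
        with x show False
          by (simp add: frontier_def interior_closure)
      qed
    qed
  qed
  ultimately show ?thesis
    by (rule negligible_subset)
qed

lemma bounded_radial_solid:
  fixes g :: "'d::finite sphere \<Rightarrow> real"
  assumes "\<And>s. g s \<le> b"
  shows "bounded (radial_solid g)"
  unfolding bounded_iff
proof (intro exI ballI)
  fix x assume "x \<in> radial_solid g"
  then have *: "norm x ^ CARD('d) < b"
    using assms[of "direction x"] by (auto simp: radial_solid_def)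
  show "norm x \<le> max 1 b"
  proof (cases "norm x \<le> 1")
    case False
    then have "norm x ^ 1 \<le> norm x ^ CARD('d)"
      by (intro power_increasing) (auto simp: Suc_le_eq)
    with * show ?thesis by simp
  qed simp
qed

section \<open>Integration over the sphere\<close>

lemma sets_surface_measure [measurable_cong, simp]: "sets surface_measure = sets borel"
  by (simp add: surface_measure_def)

lemma direction_measurable_ball:
  "direction \<in> borel_measurable (restrict_space lborel (ball 0 1 - {0 :: real ^ 'd::finite}))"
  by (rule measurable_restrict_space1) simp

lemma nn_integral_surface_measure:
  fixes f :: "'d::finite sphere \<Rightarrow> ennreal"
  assumes f: "f \<in> borel_measurable borel"
  shows "(\<integral>\<^sup>+s. f s \<partial>surface_measure) =
    of_nat CARD('d) * (\<integral>\<^sup>+x. f (direction x) * indicator (ball 0 1 - {0}) x \<partial>lborel)"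
proof -
  have "(\<integral>\<^sup>+s. f s \<partial>surface_measure) =
      of_nat CARD('d) * (\<integral>\<^sup>+x. f (direction x) \<partial>restrict_space lborel (ball 0 1 - {0}))"
    unfolding surface_measure_def using f
    by (simp add: nn_integral_scale_measure nn_integral_distr[OF direction_measurable_ball])
  also have "(\<integral>\<^sup>+x. f (direction x) \<partial>restrict_space lborel (ball 0 1 - {0})) =
      (\<integral>\<^sup>+x. f (direction x) * indicator (ball 0 1 - {0}) x \<partial>lborel)"
    by (rule nn_integral_restrict_space) simp
  finally show ?thesis .
qed

lemma finite_surface_measure: "finite_measure (surface_measure :: 'd::finite sphere measure)"
proof
  have "emeasure surface_measure (space surface_measure :: 'd sphere set) =
      (\<integral>\<^sup>+s. 1 \<partial>(surface_measure :: 'd sphere measure))"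
    by simp
  also have "\<dots> = of_nat CARD('d) * emeasure lborel (ball (0 :: real ^ 'd) 1 - {0})"
    by (subst nn_integral_surface_measure) auto
  also have "\<dots> \<le> of_nat CARD('d) * emeasure lborel (ball (0 :: real ^ 'd) 1)"
    by (intro mult_left_mono emeasure_mono) auto
  also have "\<dots> < \<infinity>"
    using emeasure_lborel_ball_finite[of "0 :: real ^ 'd" 1]
    by (auto simp: ennreal_mult_less_top of_nat_less_top)
  finally show "emeasure surface_measure (space surface_measure :: 'd sphere set) \<noteq> \<infinity>"
    by simp
qed

lemma measure_radial_solid:
  fixes g :: "'d::finite sphere \<Rightarrow> real"
  assumes g: "continuous_on UNIV g" "\<And>s. 0 < g s"
  shows "measure lborel (radial_solid g) = 1 / CARD('d) * (LINT s|surface_measure. g s)"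
proof -
  have m: "g \<in> borel_measurable borel"
    by (rule borel_measurable_continuous_onI[OF g(1)])
  have "(LINT s|surface_measure. g s) = enn2real (\<integral>\<^sup>+s. ennreal (g s) \<partial>surface_measure)"
    using g(2) m by (intro integral_eq_nn_integral) (auto intro!: AE_I2 less_imp_le)
  also have "\<dots> = enn2real (of_nat CARD('d) * emeasure lborel (radial_solid g))"
    using m by (subst nn_integral_surface_measure) (auto simp: emeasure_radial_solid[OF g])
  also have "\<dots> = CARD('d) * measure lborel (radial_solid g)"
    by (simp add: enn2real_mult measure_def)
  finally show ?thesis by simp
qed


section \<open>Generated subalgebras\<close>

lemma star_subalgebraD:
  assumes "star_subalgebra S"
  shows "0 \<in> S" "x \<in> S \<Longrightarrow> y \<in> S \<Longrightarrow> x + y \<in> S" "x \<in> S \<Longrightarrow> y \<in> S \<Longrightarrow> x * y \<in> S"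
    "x \<in> S \<Longrightarrow> a *\<^sub>C x \<in> S" "x \<in> S \<Longrightarrow> star x \<in> S"
  using assms by (auto simp: star_subalgebra_def)

lemma star_subalgebra_closure:
  assumes S: "star_subalgebra S"
  shows "star_subalgebra (closure S)"
proof -
  have "csubspace S"
    using S by (simp add: star_subalgebra_def csubspace_def)
  note sp = csubspaceD[OF csubspace_closure[OF this]]
  have mult: "x * y \<in> closure S" if xy: "x \<in> closure S" "y \<in> closure S" for x y
  proof -
    obtain f where f: "\<And>n. f n \<in> S" "f \<longlonglongrightarrow> x"
      using xy(1) unfolding closure_sequential by blast
    obtain g where g: "\<And>n. g n \<in> S" "g \<longlonglongrightarrow> y"
      using xy(2) unfolding closure_sequential by blast
    have "f n * g n \<in> S" for n
      using star_subalgebraD(3)[OF S f(1) g(1)] .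
    moreover have "(\<lambda>n. f n * g n) \<longlonglongrightarrow> x * y"
      by (intro tendsto_mult f g)
    ultimately show ?thesis
      unfolding closure_sequential by (intro exI[of _ "\<lambda>n. f n * g n"]) blast
  qed
  have st: "star x \<in> closure S" if x: "x \<in> closure S" for x
  proof -
    obtain f where f: "\<And>n. f n \<in> S" "f \<longlonglongrightarrow> x"
      using x unfolding closure_sequential by blast
    have "star (f n) \<in> S" for n
      using star_subalgebraD(5)[OF S f(1)] .
    moreover have "(\<lambda>n. star (f n)) \<longlonglongrightarrow> star x"
      by (intro bounded_linear.tendsto[OF bounded_linear_star] f)
    ultimately show ?thesis
      unfolding closure_sequential by (intro exI[of _ "\<lambda>n. star (f n)"]) blast
  qed
  show ?thesis
    by (simp add: star_subalgebra_def sp mult st)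
qed

lemma star_zero [simp]: "star (0 :: 'a::cstar_algebra) = 0"
  using star_scaleC[of 0 "0::'a"] by simp

lemma star_subalgebra_cspan:
  assumes mult: "\<And>x y. x \<in> X \<Longrightarrow> y \<in> X \<Longrightarrow> x * y \<in> cspan X"
    and star: "\<And>x. x \<in> X \<Longrightarrow> star x \<in> cspan X"
  shows "star_subalgebra (cspan X)"
proof -
  note sp = csubspaceD[OF csubspace_cspan]
  have m1: "x * y \<in> cspan X" if "x \<in> X" "y \<in> cspan X" for x y
    using that(2)
    by (induction rule: cspan_induct) (auto intro: mult that(1) sp simp: distrib_left)
  have m2: "x * y \<in> cspan X" if "x \<in> cspan X" "y \<in> cspan X" for x y
    using that(1)
    by (induction rule: cspan_induct) (auto intro: m1 that(2) sp simp: distrib_right)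
  have st: "star x \<in> cspan X" if "x \<in> cspan X" for x
    using that
    by (induction rule: cspan_induct) (auto intro: star sp simp: star_add star_scaleC)
  show ?thesis
    by (simp add: star_subalgebra_def sp m2 st)
qed

lemma star_subalgebra_cstar_generated: "star_subalgebra (cstar_generated X)"
  unfolding star_subalgebra_def[of "cstar_generated X"]
proof (intro conjI ballI allI)
  show "0 \<in> cstar_generated X"
    by (auto simp: cstar_generated_def star_subalgebraD)
  fix x y a assume "x \<in> cstar_generated X"
  then have x: "x \<in> S" if "X \<subseteq> S" "star_subalgebra S" "closed S" for S
    using that by (auto simp: cstar_generated_def)
  show "a *\<^sub>C x \<in> cstar_generated X" "star x \<in> cstar_generated X"
    using x by (auto simp: cstar_generated_def star_subalgebraD)
  assume "y \<in> cstar_generated X"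
  then have y: "y \<in> S" if "X \<subseteq> S" "star_subalgebra S" "closed S" for S
    using that by (auto simp: cstar_generated_def)
  show "x + y \<in> cstar_generated X" "x * y \<in> cstar_generated X"
    using x y by (auto simp: cstar_generated_def star_subalgebraD)
qed

lemma cstar_generated_superset: "X \<subseteq> cstar_generated X"
  by (auto simp: cstar_generated_def)

lemma cstar_generated_minimal:
  "X \<subseteq> closure S \<Longrightarrow> star_subalgebra S \<Longrightarrow> cstar_generated X \<subseteq> closure S"
  unfolding cstar_generated_def by (rule Inter_lower) (simp add: star_subalgebra_closure)


section \<open>The GNS representation of the noncommutative torus\<close>

lemma twist_nonzero [simp]: "twist \<theta> n m \<noteq> 0"
  by (simp add: twist_def)

text \<open>The quotients \<open>a n / (b * H ^ 2 ^ n)\<close> are bounded, but each is at least the square of its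
  predecessor; so the first one cannot exceed one.\<close>

lemma dyadic_iteration_bound:
  fixes a :: "nat \<Rightarrow> real"
  assumes a: "\<And>n. 0 \<le> a n" "\<And>n. (a n)\<^sup>2 \<le> b * a (Suc n)" "\<And>n. a n \<le> K * H ^ (2 ^ n)"
    and b: "0 \<le> b" and H: "0 \<le> H"
  shows "a 0 \<le> H * b"
proof -
  consider "b = 0" | "H = 0" | "0 < b" "0 < H"
    using b H by linarith
  then show ?thesis
  proof cases
    case 1
    then have "(a 0)\<^sup>2 \<le> 0"
      using a(2)[of 0] by simp
    then show ?thesis
      using 1 by simp
  next
    case 2
    then show ?thesis
      using a(3)[of 0] by simp
  next
    case 3
    define r where "r = a 0 / (b * H)"
    have r0: "0 \<le> r"
      using 3 a(1)[of 0] by (simp add: r_def)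
    have step: "r ^ (2 ^ n) \<le> a n / (b * H ^ (2 ^ n))" for n
    proof (induction n)
      case (Suc n)
      have "r ^ (2 ^ Suc n) = (r ^ (2 ^ n))\<^sup>2"
        by (simp add: power_mult[symmetric] mult.commute)
      also have "\<dots> \<le> (a n / (b * H ^ (2 ^ n)))\<^sup>2"
        by (intro power_mono Suc) (simp add: r0)
      also have "\<dots> = (a n)\<^sup>2 / (b\<^sup>2 * H ^ (2 ^ Suc n))"
        by (simp add: power_divide power_mult_distrib power_mult[symmetric] mult.commute)
      also have "\<dots> \<le> (b * a (Suc n)) / (b\<^sup>2 * H ^ (2 ^ Suc n))"
        using 3 by (intro divide_right_mono a(2)) auto
      also have "\<dots> = a (Suc n) / (b * H ^ (2 ^ Suc n))"
        using 3 by (simp add: power2_eq_square)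
      finally show ?case .
    qed (simp add: r_def)
    have bound: "r ^ (2 ^ n) \<le> K / b" for n
    proof -
      have "a n / (b * H ^ (2 ^ n)) \<le> (K * H ^ (2 ^ n)) / (b * H ^ (2 ^ n))"
        using 3 by (intro divide_right_mono a(3)) auto
      with step[of n] 3 show ?thesis
        by simp
    qed
    have "r \<le> 1"
    proof (rule ccontr)
      assume "\<not> r \<le> 1"
      then obtain n where n: "K / b < r ^ n"
        using real_arch_pow[of r "K / b"] by auto
      also have "\<dots> \<le> r ^ (2 ^ n)"
        using \<open>\<not> r \<le> 1\<close> by (intro power_increasing) (auto simp: less_imp_le)
      finally show False
        using bound[of n] by simp
    qed
    then show ?thesis
      using 3 by (simp add: r_def mult.commute)
  qed
qed

locale torus_representation =
  fixes \<theta> :: "real ^ 'd::finite ^ 'd"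
    and u :: "int ^ 'd \<Rightarrow> 'a::cstar_algebra"
    and \<tau> :: "'a \<Rightarrow> complex"
    and \<Lambda> :: "'a \<Rightarrow> 'h::chilbert_space"
  assumes torus: "noncommutative_torus \<theta> u"
    and torus_tr: "torus_trace u \<tau>"
    and gns: "gns_space \<tau> \<Lambda>"
begin

lemma u_mult: "u n * u m = twist \<theta> n m *\<^sub>C u (n + m)"
  using torus by (simp add: noncommutative_torus_def)

lemma u_unitary: "star (u n) * u n = 1" "u n * star (u n) = 1"
  using torus by (auto simp: noncommutative_torus_def unitary_element_def)

lemma u_zero: "u 0 = 1"
proof -
  have "u 0 * u 0 = u 0"
    using u_mult[of 0 0] by (simp add: twist_def)
  then have "star (u 0) * u 0 * u 0 = star (u 0) * u 0"
    by (simp only: mult.assoc)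
  then show ?thesis
    by (simp add: u_unitary)
qed

lemma star_u: "star (u n) = inverse (twist \<theta> n (- n)) *\<^sub>C u (- n)"
proof -
  have "star (u n) * (u n * u (- n)) = twist \<theta> n (- n) *\<^sub>C star (u n)"
    by (simp add: u_mult u_zero)
  then have "u (- n) = twist \<theta> n (- n) *\<^sub>C star (u n)"
    by (simp add: u_unitary flip: mult.assoc)
  then show ?thesis
    by simp
qed

lemma u_dense: "closure (cspan (range u)) = UNIV"
proof -
  have in_span: "u n \<in> cspan (range u)" for n
    by (rule subsetD[OF cspan_superset]) simp
  have "star_subalgebra (cspan (range u))"
    by (rule star_subalgebra_cspan)
       (auto simp: u_mult star_u intro!: csubspaceD(3)[OF csubspace_cspan] in_span)
  then have "cstar_generated (range u) \<subseteq> closure (cspan (range u))"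
    by (intro cstar_generated_minimal order_trans[OF cspan_superset closure_subset])
  then show ?thesis
    using torus by (auto simp: noncommutative_torus_def)
qed

lemma trace_simps:
  "\<tau> (x + y) = \<tau> x + \<tau> y" "\<tau> (a *\<^sub>C x) = a * \<tau> x" "\<tau> 1 = 1"
  using torus_tr by (auto simp: torus_trace_def tracial_state_def)

lemma trace_u: "\<tau> (u n) = (if n = 0 then 1 else 0)"
proof -
  let ?a = "\<lambda>k. if k = n then 1 else 0 :: complex"
  have "finite_support ?a"
    unfolding finite_support_def by (rule finite_subset[of _ "{n}"]) auto
  then have "\<tau> (torus_poly u ?a) = ?a 0"
    using torus_tr unfolding torus_trace_def by blast
  moreover have "{k. ?a k \<noteq> 0} = {n}"
    by auto
  then have "torus_poly u ?a = u n"
    unfolding torus_poly_def by simp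
  ultimately show ?thesis
    by auto
qed

lemma trace_bound: "\<exists>K\<ge>0. \<forall>x. norm (\<tau> x) \<le> K * norm x"
proof -
  obtain K where K: "\<And>x. norm (\<tau> x) \<le> K * norm x"
    using torus_tr unfolding torus_trace_def bounded_clinear_def by blast
  have "norm (\<tau> x) \<le> \<bar>K\<bar> * norm x" for x
    by (rule order_trans[OF K]) (simp add: mult_right_mono)
  then show ?thesis
    by (intro exI[of _ "\<bar>K\<bar>"]) auto
qed

lemma bounded_linear_trace: "bounded_linear \<tau>"
proof -
  obtain K where K: "\<And>x. norm (\<tau> x) \<le> K * norm x"
    using trace_bound by blast
  show ?thesis
    by (rule bounded_linear_intro[where K = K])
       (use K in \<open>auto simp: trace_simps scaleR_scaleC scaleR_conv_of_real mult.commute\<close>)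
qed

lemma \<Lambda>_simps:
  "\<Lambda> (x + y) = \<Lambda> x + \<Lambda> y" "\<Lambda> (a *\<^sub>C x) = a *\<^sub>C \<Lambda> x" "cinner (\<Lambda> x) (\<Lambda> y) = \<tau> (star x * y)"
  "closure (range \<Lambda>) = UNIV"
  using gns by (auto simp: gns_space_def clinear_def)

lemma \<Lambda>_diff: "\<Lambda> (x - y) = \<Lambda> x - \<Lambda> y"
  using \<Lambda>_simps(1)[of "x - y" y] by simp

lemma \<Lambda>_bound: "\<exists>K\<ge>0. \<forall>x. norm (\<Lambda> x) \<le> K * norm x"
proof -
  obtain K where K: "K \<ge> 0" "\<And>x. norm (\<tau> x) \<le> K * norm x"
    using trace_bound by blast
  have "norm (\<Lambda> x) \<le> sqrt K * norm x" for x
  proof (rule power2_le_imp_le)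
    have "(norm (\<Lambda> x))\<^sup>2 = norm (cinner (\<Lambda> x) (\<Lambda> x))"
      by (simp add: cinner_same norm_power)
    also have "\<dots> \<le> K * norm (star x * x)"
      unfolding \<Lambda>_simps by (rule K)
    also have "\<dots> = (sqrt K * norm x)\<^sup>2"
      using K(1) by (simp add: cstar_identity power_mult_distrib)
    finally show "(norm (\<Lambda> x))\<^sup>2 \<le> (sqrt K * norm x)\<^sup>2" .
  qed (simp add: K)
  then show ?thesis
    using K(1) by (intro exI[of _ "sqrt K"]) auto
qed

lemma bounded_linear_\<Lambda>: "bounded_linear \<Lambda>"
proof -
  obtain K where K: "\<And>x. norm (\<Lambda> x) \<le> K * norm x"
    using \<Lambda>_bound by blast
  show ?thesis
    by (rule bounded_linear_intro[where K = K])
       (use K in \<open>auto simp: \<Lambda>_simps scaleR_scaleC mult.commute\<close>)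
qed

lemma fourier_basis: "orthonormal_basis (\<lambda>n. \<Lambda> (u n))"
  unfolding orthonormal_basis_def
proof (intro conjI allI)
  fix n m
  show "cinner (\<Lambda> (u n)) (\<Lambda> (u m)) = (if n = m then 1 else 0)"
  proof (cases "n = m")
    case False
    then show ?thesis
      by (simp add: \<Lambda>_simps star_u u_mult trace_simps trace_u)
  qed (simp add: \<Lambda>_simps u_unitary trace_simps)
next
  let ?S = "cspan (range (\<lambda>n. \<Lambda> (u n)))"
  have span: "\<Lambda> x \<in> ?S" if "x \<in> cspan (range u)" for x
    using that
  proof (induction rule: cspan_induct)
    case (base x)
    then show ?case
      by (auto intro!: subsetD[OF cspan_superset])
  next
    case zero
    show ?case
      using csubspaceD(1)[OF csubspace_cspan] bounded_linear.linear[OF bounded_linear_\<Lambda>, THEN linear_0]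
      by simp
  qed (auto simp: \<Lambda>_simps intro: csubspaceD[OF csubspace_cspan])
  have "\<Lambda> x \<in> closure ?S" for x
  proof -
    have "x \<in> closure (cspan (range u))"
      by (simp add: u_dense)
    then obtain X where X: "\<And>n. X n \<in> cspan (range u)" "X \<longlonglongrightarrow> x"
      unfolding closure_sequential by blast
    have "(\<lambda>n. \<Lambda> (X n)) \<longlonglongrightarrow> \<Lambda> x"
      by (rule bounded_linear.tendsto[OF bounded_linear_\<Lambda> X(2)])
    then show ?thesis
      unfolding closure_sequential using span[OF X(1)] by (intro exI[of _ "\<lambda>n. \<Lambda> (X n)"]) blast
  qed
  then have "closure (range \<Lambda>) \<subseteq> closure ?S"
    by (intro closure_minimal) auto
  then show "closure ?S = UNIV"
    by (auto simp: \<Lambda>_simps)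
qed

text \<open>For \<open>h = star x * x\<close> the Cauchy-Schwarz inequality gives
  \<open>norm (\<Lambda> (h ^ k * y)) ^ 2 \<le> norm (\<Lambda> y) * norm (\<Lambda> (h ^ (2 * k) * y))\<close>.  Iterated along the
  powers of two, this turns the crude bound \<open>norm (\<Lambda> z) \<le> K * norm z\<close> into the sharp one.\<close>

lemma norm_\<Lambda>_mult: "norm (\<Lambda> (x * y)) \<le> norm x * norm (\<Lambda> y)"
proof -
  define h where "h = star x * x"
  have h: "star h = h"
    by (simp add: h_def star_mult)
  have star_pow: "star (h ^ k * y) = star y * h ^ k" for k
  proof -
    have "star (h ^ k * z) = star z * h ^ k" for z
    proof (induction k arbitrary: z)
      case (Suc k)
      have "star (h ^ Suc k * z) = star (h ^ k * (h * z))"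
        by (simp only: power_Suc2 mult.assoc)
      also have "\<dots> = star z * (h * h ^ k)"
        by (subst Suc) (simp only: star_mult h mult.assoc)
      finally show ?case by simp
    qed simp
    then show ?thesis .
  qed
  have norm_pow: "norm (h ^ k * y) \<le> norm h ^ k * norm y" for k
  proof (induction k)
    case (Suc k)
    have "norm (h ^ Suc k * y) \<le> norm h * norm (h ^ k * y)"
      using norm_mult_ineq[of h "h ^ k * y"] by (simp add: mult.assoc)
    also have "\<dots> \<le> norm h * (norm h ^ k * norm y)"
      by (intro mult_left_mono Suc) auto
    finally show ?case
      by (simp add: mult.assoc)
  qed simp
  obtain K where K: "K \<ge> 0" "\<And>x. norm (\<Lambda> x) \<le> K * norm x"
    using \<Lambda>_bound by blast
  have sq: "(norm (\<Lambda> (v * y)))\<^sup>2 \<le> norm (\<Lambda> y) * norm (\<Lambda> (w * y))"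
    if "star (v * y) * (v * y) = star y * (w * y)" for v w
  proof -
    have "(norm (\<Lambda> (v * y)))\<^sup>2 = norm (cinner (\<Lambda> (v * y)) (\<Lambda> (v * y)))"
      by (simp add: cinner_same norm_power)
    also have "\<dots> = norm (cinner (\<Lambda> y) (\<Lambda> (w * y)))"
      by (simp only: \<Lambda>_simps that)
    also have "\<dots> \<le> norm (\<Lambda> y) * norm (\<Lambda> (w * y))"
      by (rule cinner_cauchy_schwarz)
    finally show ?thesis .
  qed
  have "norm (\<Lambda> (h ^ (2 ^ 0) * y)) \<le> norm h * norm (\<Lambda> y)"
  proof (rule dyadic_iteration_bound[where K = "K * norm y" and a = "\<lambda>n. norm (\<Lambda> (h ^ (2 ^ n) * y))"])
    fix n
    show "(norm (\<Lambda> (h ^ (2 ^ n) * y)))\<^sup>2 \<le> norm (\<Lambda> y) * norm (\<Lambda> (h ^ (2 ^ Suc n) * y))"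
    proof (rule sq)
      have "h ^ (2 ^ Suc n) = h ^ (2 ^ n) * h ^ (2 ^ n)"
        by (simp add: mult_2 power_add)
      then show "star (h ^ (2 ^ n) * y) * (h ^ (2 ^ n) * y) = star y * (h ^ (2 ^ Suc n) * y)"
        by (simp only: star_pow mult.assoc)
    qed
    have "norm (\<Lambda> (h ^ (2 ^ n) * y)) \<le> K * norm (h ^ (2 ^ n) * y)"
      by (rule K)
    also have "\<dots> \<le> K * (norm h ^ (2 ^ n) * norm y)"
      by (intro mult_left_mono norm_pow K)
    finally show "norm (\<Lambda> (h ^ (2 ^ n) * y)) \<le> K * norm y * norm h ^ (2 ^ n)"
      by (simp add: mult_ac)
  qed auto
  then have hy: "norm (\<Lambda> (h * y)) \<le> (norm x)\<^sup>2 * norm (\<Lambda> y)"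
    by (simp add: h_def cstar_identity)
  have "(norm (\<Lambda> (x * y)))\<^sup>2 \<le> norm (\<Lambda> y) * norm (\<Lambda> (h * y))"
    by (rule sq) (simp add: h_def star_mult mult.assoc)
  also have "\<dots> \<le> norm (\<Lambda> y) * ((norm x)\<^sup>2 * norm (\<Lambda> y))"
    by (intro mult_left_mono hy) auto
  also have "\<dots> = (norm x * norm (\<Lambda> y))\<^sup>2"
    by (simp add: power2_eq_square)
  finally show ?thesis
    by (rule power2_le_imp_le) auto
qed

text \<open>By the sharp bound, \<open>\<Lambda> (x * y)\<close> depends only on \<open>\<Lambda> y\<close>, so that any preimage may be chosen.\<close>

lemma left_mult_op_exists: "\<exists>A. (\<forall>y. bop_apply A (\<Lambda> y) = \<Lambda> (x * y)) \<and> norm A \<le> norm x"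
proof -
  have wd: "\<Lambda> (x * y) = \<Lambda> (x * y')" if "\<Lambda> y = \<Lambda> y'" for y y'
    using norm_\<Lambda>_mult[of x "y - y'"] that by (simp add: \<Lambda>_diff right_diff_distrib)
  define f where "f v = \<Lambda> (x * (SOME y. \<Lambda> y = v))" for v
  have f: "f (\<Lambda> y) = \<Lambda> (x * y)" for y
    unfolding f_def by (rule wd) (rule someI[of "\<lambda>z. \<Lambda> z = \<Lambda> y" y], rule refl)
  have sub: "csubspace (range \<Lambda>)"
    unfolding csubspace_def
  proof (intro conjI ballI allI)
    show "0 \<in> range \<Lambda>"
      using \<Lambda>_simps(2)[of 0 0] by (metis rangeI scaleC_zero_left)
  qed (auto simp flip: \<Lambda>_simps(1,2))
  show ?thesis
  proof (rule bop_extension[OF sub \<Lambda>_simps(4), of f "norm x"])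
    fix A assume A: "\<And>v. v \<in> range \<Lambda> \<Longrightarrow> bop_apply A v = f v" "norm A \<le> norm x"
    then show "\<exists>A. (\<forall>y. bop_apply A (\<Lambda> y) = \<Lambda> (x * y)) \<and> norm A \<le> norm x"
      by (intro exI[of _ A]) (auto simp: f)
  qed (auto simp: f distrib_left norm_\<Lambda>_mult simp flip: \<Lambda>_simps(1,2))
qed

lemma left_mult_op_apply: "bop_apply (left_mult_op \<Lambda> x) (\<Lambda> y) = \<Lambda> (x * y)"
  and norm_left_mult_op: "norm (left_mult_op \<Lambda> x) \<le> norm x"
proof -
  obtain A where A: "\<forall>y. bop_apply A (\<Lambda> y) = \<Lambda> (x * y)" "norm A \<le> norm x"
    using left_mult_op_exists by blast
  have "left_mult_op \<Lambda> x = A"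
    unfolding left_mult_op_def
  proof (rule the_equality)
    show "B = A" if B: "\<forall>y. bop_apply B (\<Lambda> y) = \<Lambda> (x * y)" for B
      by (rule bop_eq_on_dense[OF \<Lambda>_simps(4)]) (use A B in auto)
  qed (rule A)
  with A show "bop_apply (left_mult_op \<Lambda> x) (\<Lambda> y) = \<Lambda> (x * y)" "norm (left_mult_op \<Lambda> x) \<le> norm x"
    by auto
qed

lemma left_mult_op_algebra:
  "left_mult_op \<Lambda> (x + y) = left_mult_op \<Lambda> x + left_mult_op \<Lambda> y"
  "left_mult_op \<Lambda> (a *\<^sub>C x) = a *\<^sub>C left_mult_op \<Lambda> x"
  "left_mult_op \<Lambda> (x * y) = left_mult_op \<Lambda> x * left_mult_op \<Lambda> y"
  "left_mult_op \<Lambda> 1 = 1"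
  "left_mult_op \<Lambda> (star x) = star (left_mult_op \<Lambda> x)"
proof -
  note eqI = bop_eq_on_dense[OF \<Lambda>_simps(4)]
  show "left_mult_op \<Lambda> (x + y) = left_mult_op \<Lambda> x + left_mult_op \<Lambda> y"
    by (rule eqI) (auto simp: left_mult_op_apply distrib_right \<Lambda>_simps)
  show "left_mult_op \<Lambda> (a *\<^sub>C x) = a *\<^sub>C left_mult_op \<Lambda> x"
    by (rule eqI) (auto simp: left_mult_op_apply \<Lambda>_simps)
  show "left_mult_op \<Lambda> (x * y) = left_mult_op \<Lambda> x * left_mult_op \<Lambda> y"
    by (rule eqI) (auto simp: left_mult_op_apply mult.assoc)
  show "left_mult_op \<Lambda> 1 = 1"
    by (rule eqI) (auto simp: left_mult_op_apply)
  show "left_mult_op \<Lambda> (star x) = star (left_mult_op \<Lambda> x)"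
  proof (rule eqI)
    fix v assume "v \<in> range \<Lambda>"
    then obtain y where y: "v = \<Lambda> y" by blast
    show "bop_apply (left_mult_op \<Lambda> (star x)) v = bop_apply (star (left_mult_op \<Lambda> x)) v"
      by (rule cinner_basis_ext[OF fourier_basis])
         (simp add: y left_mult_op_apply cinner_star_right \<Lambda>_simps star_mult mult.assoc)
  qed
qed

lemma bounded_linear_left_mult_op: "bounded_linear (left_mult_op \<Lambda>)"
  by (rule bounded_linear_intro[where K = 1])
     (auto simp: left_mult_op_algebra scaleR_scaleC norm_left_mult_op)

lemma left_mult_op_u_basis:
  "bop_apply (left_mult_op \<Lambda> (u n)) (\<Lambda> (u m)) = twist \<theta> n m *\<^sub>C \<Lambda> (u (n + m))"
  by (simp add: left_mult_op_apply u_mult \<Lambda>_simps)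

end

section \<open>Directions of distant lattice points\<close>

lemma compact_sphere_UNIV: "compact (UNIV :: 'd::finite sphere set)"
proof -
  have "compact (direction ` sphere (0 :: real ^ 'd) 1)"
    by (intro compact_continuous_image continuous_on_subset[OF continuous_on_direction]) auto
  also have "direction ` sphere (0 :: real ^ 'd) 1 = UNIV"
  proof -
    have "s = direction (Rep_sphere s)" for s :: "'d sphere"
      using Rep_sphere[of s] by (simp add: direction_def Rep_sphere_inverse)
    moreover have "Rep_sphere s \<in> sphere 0 1" for s :: "'d sphere"
      using Rep_sphere[of s] by simp
    ultimately show ?thesis
      by (metis UNIV_eq_I image_eqI)
  qed
  finally show ?thesis .
qed

lemma dist_direction_le:
  fixes x y :: "real ^ 'd::finite"
  assumes "x \<noteq> 0" "y \<noteq> 0"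
  shows "dist (direction x) (direction y) \<le> 2 * norm (x - y) / norm x"
proof -
  have "norm x *\<^sub>R (x /\<^sub>R norm x - y /\<^sub>R norm y) = (x - y) + (1 - norm x / norm y) *\<^sub>R y"
    using assms by (simp add: scaleR_diff_right scaleR_diff_left divide_inverse)
  then have "norm x * norm (x /\<^sub>R norm x - y /\<^sub>R norm y) = norm ((x - y) + (1 - norm x / norm y) *\<^sub>R y)"
    by (metis abs_norm_cancel norm_scaleR)
  also have "\<dots> \<le> norm (x - y) + norm ((1 - norm x / norm y) *\<^sub>R y)"
    by (rule norm_triangle_ineq)
  also have "norm ((1 - norm x / norm y) *\<^sub>R y) = \<bar>(1 - norm x / norm y) * norm y\<bar>"
    by (simp add: abs_mult)
  also have "(1 - norm x / norm y) * norm y = norm y - norm x"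
    using assms by (simp add: field_simps)
  also have "\<bar>norm y - norm x\<bar> \<le> norm (x - y)"
    using norm_triangle_ineq3[of x y] by (simp add: abs_minus_commute)
  finally have "norm (x /\<^sub>R norm x - y /\<^sub>R norm y) * norm x \<le> 2 * norm (x - y)"
    by (simp add: mult.commute)
  then show ?thesis
    using assms by (simp add: dist_sphere_def Rep_direction dist_norm field_simps)
qed

lemma finite_int_vectors_norm: "finite {m :: int ^ 'd::finite. norm (real_vec m) \<le> K}"
  using finite_lattice_points[of "cball 0 K" 1] by simp

text \<open>A shift by a fixed lattice vector changes the direction of a distant lattice point by
  little, and a continuous function on the compact sphere is uniformly continuous.\<close>

lemma direction_shift_null:
  fixes g :: "'d::finite csphere" and n :: "int ^ 'd" and \<omega>\<^sub>0 :: "'d sphere"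
  assumes \<epsilon>: "\<epsilon> > 0"
  defines "f \<equiv> \<lambda>\<xi>. apply_bcontfun g (if \<xi> = 0 then \<omega>\<^sub>0 else direction \<xi>)"
  shows "finite {m. \<epsilon> \<le> norm (f (real_vec (n + m)) - f (real_vec m))}"
proof -
  have "uniformly_continuous_on UNIV (apply_bcontfun g)"
    by (rule compact_uniformly_continuous[OF _ compact_sphere_UNIV]) simp
  then obtain \<delta> where \<delta>: "\<delta> > 0"
    "\<And>s s'. dist s' s < \<delta> \<Longrightarrow> dist (apply_bcontfun g s') (apply_bcontfun g s) < \<epsilon>"
    using \<epsilon> unfolding uniformly_continuous_on_def by (metis UNIV_I)
  define R where "R = norm (real_vec n) + 2 * norm (real_vec n) / \<delta>"
  have "{m. \<epsilon> \<le> norm (f (real_vec (n + m)) - f (real_vec m))} \<subseteq> {m. norm (real_vec m) \<le> R}"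
  proof safe
    fix m assume m: "\<epsilon> \<le> norm (f (real_vec (n + m)) - f (real_vec m))"
    show "norm (real_vec m) \<le> R"
    proof (rule ccontr)
      assume "\<not> norm (real_vec m) \<le> R"
      then have R: "R < norm (real_vec m)" by simp
      have "0 \<le> 2 * norm (real_vec n) / \<delta>"
        using \<delta>(1) by simp
      with R have gt: "norm (real_vec n) < norm (real_vec m)" "2 * norm (real_vec n) / \<delta> < norm (real_vec m)"
        unfolding R_def using norm_ge_zero[of "real_vec n"] by linarith+
      have m0: "real_vec m \<noteq> 0"
        using gt(1) norm_ge_zero[of "real_vec n"] by (metis norm_zero not_less)
      have nm0: "real_vec (n + m) \<noteq> 0"
      proof
        assume "real_vec (n + m) = 0"
        then have "real_vec n = - real_vec m"
          by (simp only: real_vec_simps eq_neg_iff_add_eq_0)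
        then show False
          using gt(1) by simp
      qed
      have "dist (direction (real_vec m)) (direction (real_vec (n + m))) \<le>
          2 * norm (real_vec m - real_vec (n + m)) / norm (real_vec m)"
        by (rule dist_direction_le[OF m0 nm0])
      also have "norm (real_vec m - real_vec (n + m)) = norm (real_vec n)"
        by simp
      also have "2 * norm (real_vec n) / norm (real_vec m) < \<delta>"
        using gt(2) \<delta>(1) m0 by (simp add: field_simps)
      finally have "dist (direction (real_vec (n + m))) (direction (real_vec m)) < \<delta>"
        by (simp add: dist_commute)
      from \<delta>(2)[OF this] m show False
        using m0 nm0 by (simp add: f_def dist_norm del: real_vec_simps)
    qed
  qed
  then show ?thesis
    by (rule finite_subset) (rule finite_int_vectors_norm)
qed


section \<open>The trace on functions of the gradient\<close>

definition bessel_weight :: "real ^ 'd::finite \<Rightarrow> real" where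
  "bessel_weight \<xi> = (1 + (\<Sum>j\<in>UNIV. (\<xi> $ j)\<^sup>2)) powr (- real CARD('d) / 2)"

lemma bessel_weight_norm: "bessel_weight (\<xi> :: real ^ 'd::finite) = (1 + (norm \<xi>)\<^sup>2) powr (- real CARD('d) / 2)"
proof -
  have "(\<Sum>j\<in>UNIV. (\<xi> $ j)\<^sup>2) = (norm \<xi>)\<^sup>2"
    unfolding power2_norm_eq_inner inner_vec_def by (simp add: power2_eq_square)
  then show ?thesis
    by (simp add: bessel_weight_def)
qed

lemma bessel_weight_asymptotics:
  "((\<lambda>s::real. s ^ d * (1 + s\<^sup>2) powr (- real d / 2)) \<longlongrightarrow> 1) at_top"
proof -
  have "((\<lambda>s::real. 1 - 1 / (1 + s\<^sup>2)) \<longlongrightarrow> 1 - 0) at_top"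
  proof (rule tendsto_diff[OF tendsto_const real_tendsto_divide_at_top[OF tendsto_const]])
    have "filterlim (\<lambda>s::real. s\<^sup>2) at_top at_top"
      by (intro filterlim_pow_at_top filterlim_ident) simp
    then show "filterlim (\<lambda>s::real. 1 + s\<^sup>2) at_top at_top"
      by (rule filterlim_tendsto_add_at_top[OF tendsto_const])
  qed
  then have lim: "((\<lambda>s::real. (1 - 1 / (1 + s\<^sup>2)) powr (real d / 2)) \<longlongrightarrow> 1 powr (real d / 2)) at_top"
    by (intro tendsto_powr tendsto_const) simp_all
  have eq: "(1 - 1 / (1 + s\<^sup>2)) powr (real d / 2) = s ^ d * (1 + s\<^sup>2) powr (- real d / 2)" if s: "s > 0" for s :: real
  proof -
    have pos: "1 + s\<^sup>2 > 0"
      using s by (simp add: add_pos_pos)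
    have "1 - 1 / (1 + s\<^sup>2) = s\<^sup>2 / (1 + s\<^sup>2)"
      using pos by (simp add: field_simps)
    also have "\<dots> powr (real d / 2) = (s\<^sup>2) powr (real d / 2) / (1 + s\<^sup>2) powr (real d / 2)"
      by (rule powr_divide)
    also have "(s\<^sup>2) powr (real d / 2) = s powr (real d)"
    proof -
      have "(s\<^sup>2) powr (real d / 2) = (s powr 2) powr (real d / 2)"
        using s by (simp add: powr_numeral)
      also have "\<dots> = s powr real d"
        by (simp add: powr_powr)
      finally show ?thesis .
    qed
    also have "s powr real d = s ^ d"
      using s by (rule powr_realpow)
    moreover have "(1 + s\<^sup>2) powr (- real d / 2) = inverse ((1 + s\<^sup>2) powr (real d / 2))"
      unfolding powr_minus[symmetric] minus_divide_left ..
    ultimately show ?thesis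
      by (simp only: divide_inverse)
  qed
  have "\<forall>\<^sub>F s in at_top. (1 - 1 / (1 + s\<^sup>2)) powr (real d / 2) = s ^ d * (1 + s\<^sup>2) powr (- real d / 2)"
    by (rule eventually_mono[OF eventually_gt_at_top[of 0]]) (rule eq)
  then have "((\<lambda>s::real. s ^ d * (1 + s\<^sup>2) powr (- real d / 2)) \<longlongrightarrow> 1 powr (real d / 2)) at_top"
    by (rule Lim_transform_eventually[OF lim])
  then show ?thesis
    by (simp only: powr_one_eq_one)
qed

lemma norm_real_vec_at_top:
  fixes \<beta> :: "nat \<Rightarrow> int ^ 'd::finite"
  assumes "inj \<beta>"
  shows "filterlim (\<lambda>k. norm (real_vec (\<beta> k))) at_top sequentially"
  unfolding filterlim_at_top_dense
proof
  fix K
  have "finite {k. norm (real_vec (\<beta> k)) \<le> K}"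
    using finite_vimageI[OF finite_int_vectors_norm[of K] assms] by (simp add: vimage_def)
  then show "\<forall>\<^sub>F k in sequentially. K < norm (real_vec (\<beta> k))"
    by (simp add: eventually_cofinite not_less flip: cofinite_eq_sequentially)
qed

lemma infinite_int_vectors: "infinite (UNIV :: (int ^ 'd::finite) set)"
proof
  assume fin: "finite (UNIV :: (int ^ 'd) set)"
  have "inj (\<lambda>k::int. \<chi> j::'d. k)"
    by (rule injI) (simp add: vec_eq_iff)
  then have "finite (UNIV :: int set)"
    by (rule finite_imageD[rotated]) (rule finite_subset[OF subset_UNIV fin])
  then show False
    by simp
qed

text \<open>Lattice points are listed by increasing \<open>norm m ^ d / g (m / norm m)\<close>.  The sublevel sets
  are the lattice points of dilations of the solid below \<open>g\<close>, so the eigenvalue with number \<open>k\<close>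
  is asymptotically the volume of that solid divided by \<open>k\<close>.\<close>

lemma homogeneous_eigenvalue_asymptotics:
  fixes g :: "'d::finite sphere \<Rightarrow> real" and \<omega>\<^sub>0 :: "'d sphere"
  assumes g: "continuous_on UNIV g" "\<And>s. \<alpha> \<le> g s" "\<And>s. g s \<le> b" and \<alpha>: "0 < \<alpha>"
  obtains \<beta> :: "nat \<Rightarrow> int ^ 'd" where "bij \<beta>"
    "(\<lambda>k. real (k + 1) * (g (if real_vec (\<beta> k) = 0 then \<omega>\<^sub>0 else direction (real_vec (\<beta> k)))
        * bessel_weight (real_vec (\<beta> k)))) \<longlonglongrightarrow> 1 / CARD('d) * (LINT s|surface_measure. g s)"
proof -
  let ?d = "CARD('d)"
  define V where "V = measure lborel (radial_solid g)"
  define q where "q m = norm (real_vec m) ^ ?d / g (direction (real_vec m))" for m :: "int ^ 'd"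
  have gpos: "0 < g s" for s
    using g(2)[of s] \<alpha> by linarith
  have V: "V = 1 / CARD('d) * (LINT s|surface_measure. g s)"
    unfolding V_def by (rule measure_radial_solid[OF g(1) gpos])
  have bd: "bounded (radial_solid g)"
    by (rule bounded_radial_solid[OF g(3)])
  have sublevel: "{m. q m < t} = {m. (1 / root ?d t) *\<^sub>R real_vec m \<in> radial_solid g}" if t: "t > 0" for t
  proof -
    have R: "root ?d t > 0"
      using t by simp
    have "q m < t \<longleftrightarrow> (1 / root ?d t) *\<^sub>R real_vec m \<in> radial_solid g" for m
    proof -
      have "(norm ((1 / root ?d t) *\<^sub>R real_vec m)) ^ ?d = norm (real_vec m) ^ ?d / t"
        using t R by (simp add: power_mult_distrib power_divide)
      moreover have "direction ((1 / root ?d t) *\<^sub>R real_vec m) = direction (real_vec m)"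
        using R by (intro direction_scaleR) simp
      ultimately show ?thesis
        using t gpos[of "direction (real_vec m)"] by (simp add: radial_solid_def q_def field_simps)
    qed
    then show ?thesis by blast
  qed
  have q0: "0 \<le> q m" for m
    unfolding q_def using gpos[of "direction (real_vec m)"] by simp
  have fin: "finite {m. q m < t}" for t
  proof (cases "t > 0")
    case True
    show ?thesis
      unfolding sublevel[OF True] by (rule finite_lattice_points[OF bd]) (use True in simp)
  next
    case False
    then have "{m. q m < t} = {}"
      using q0 by (auto simp: not_less intro: order_trans)
    then show ?thesis
      by (simp only: finite.emptyI)
  qed
  have "((\<lambda>R. real (card {m. (1 / R) *\<^sub>R real_vec m \<in> radial_solid g}) / R ^ ?d) \<longlongrightarrow> V) at_top"
    unfolding V_def
    by (rule lattice_point_asymptotics[OF bd radial_solid_borel[OF g(1)]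
          negligible_frontier_radial_solid[OF g(1,2) \<alpha>]])
  moreover have "filterlim (root ?d) at_top at_top"
  proof (unfold filterlim_at_top_gt[of _ _ 0], intro allI impI)
    fix Z :: real assume "0 < Z"
    have "Z \<le> root ?d t" if "Z ^ ?d \<le> t" for t
    proof -
      have "root ?d (Z ^ ?d) \<le> root ?d t"
        using that by simp
      then show ?thesis
        using \<open>0 < Z\<close> by (simp add: real_root_power_cancel)
    qed
    then show "\<forall>\<^sub>F t in at_top. Z \<le> root ?d t"
      by (intro eventually_mono[OF eventually_ge_at_top[of "Z ^ ?d"]])
  qed
  ultimately have "((\<lambda>t. real (card {m. (1 / root ?d t) *\<^sub>R real_vec m \<in> radial_solid g}) / root ?d t ^ ?d)
      \<longlongrightarrow> V) at_top"
    by (rule filterlim_compose)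
  moreover have "\<forall>\<^sub>F t in at_top. real (card {m. (1 / root ?d t) *\<^sub>R real_vec m \<in> radial_solid g}) / root ?d t ^ ?d
      = real (card {m. q m < t}) / t"
    by (intro eventually_mono[OF eventually_gt_at_top[of 0]]) (simp add: sublevel)
  ultimately have lim: "((\<lambda>t. real (card {m. q m < t}) / t) \<longlongrightarrow> V) at_top"
    by (rule Lim_transform_eventually)
  obtain \<beta> :: "nat \<Rightarrow> int ^ 'd" where \<beta>: "bij \<beta>" "(\<lambda>k. real (k + 1) / q (\<beta> k)) \<longlonglongrightarrow> V"
    by (rule sorting_asymptotics[OF infinite_int_vectors fin lim]) (rule that)
  have top: "filterlim (\<lambda>k. norm (real_vec (\<beta> k))) at_top sequentially"
    by (rule norm_real_vec_at_top) (rule bij_is_inj[OF \<beta>(1)])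
  have "(\<lambda>k. norm (real_vec (\<beta> k)) ^ ?d * (1 + (norm (real_vec (\<beta> k)))\<^sup>2) powr (- real ?d / 2)) \<longlonglongrightarrow> 1"
    by (rule filterlim_compose[OF bessel_weight_asymptotics top])
  then have "(\<lambda>k. real (k + 1) / q (\<beta> k) * (norm (real_vec (\<beta> k)) ^ ?d * bessel_weight (real_vec (\<beta> k)))) \<longlonglongrightarrow> V * 1"
    unfolding bessel_weight_norm by (intro tendsto_mult \<beta>(2))
  moreover have "\<forall>\<^sub>F k in sequentially. real (k + 1) / q (\<beta> k) * (norm (real_vec (\<beta> k)) ^ ?d * bessel_weight (real_vec (\<beta> k)))
      = real (k + 1) * (g (if real_vec (\<beta> k) = 0 then \<omega>\<^sub>0 else direction (real_vec (\<beta> k))) * bessel_weight (real_vec (\<beta> k)))"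
  proof -
    have "\<forall>\<^sub>F k in sequentially. 0 < norm (real_vec (\<beta> k))"
      using top by (simp only: filterlim_at_top_dense)
    then show ?thesis
    proof eventually_elim
      case (elim k)
      then show ?case
        using gpos[of "direction (real_vec (\<beta> k))"] by (simp add: q_def del: real_vec_simps)
    qed
  qed
  ultimately have "(\<lambda>k. real (k + 1) * (g (if real_vec (\<beta> k) = 0 then \<omega>\<^sub>0 else direction (real_vec (\<beta> k)))
      * bessel_weight (real_vec (\<beta> k)))) \<longlonglongrightarrow> V * 1"
    by (rule Lim_transform_eventually)
  then show ?thesis
    using \<beta>(1) by (intro that[of \<beta>]) (simp_all add: V)
qed

lemma bounded_bcontfun_range: "bounded (range (\<lambda>i. apply_bcontfun (g :: _ \<Rightarrow>\<^sub>C complex) (f i)))"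
  by (rule boundedI[where B = "norm g"]) (auto simp: norm_bounded)

locale torus_weak_trace =
  torus_representation \<theta> u \<tau> \<Lambda> + weak_trace \<phi>
  for \<theta> :: "real ^ 'd::finite ^ 'd"
    and u :: "int ^ 'd \<Rightarrow> 'a::cstar_algebra"
    and \<tau> :: "'a \<Rightarrow> complex"
    and \<Lambda> :: "'a \<Rightarrow> 'h::chilbert_space"
    and \<phi> :: "'h bop \<Rightarrow> complex" +
  fixes \<omega>\<^sub>0 :: "'d sphere"
  assumes normalised: "normalised_trace \<phi>"
begin

definition lattice_direction :: "int ^ 'd \<Rightarrow> 'd sphere" where
  "lattice_direction m = (if real_vec m = 0 then \<omega>\<^sub>0 else direction (real_vec m))"

abbreviation fourier :: "int ^ 'd \<Rightarrow> 'h" where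
  "fourier m \<equiv> \<Lambda> (u m)"

lemma homogeneous_op_diag:
  "homogeneous_op \<Lambda> u \<omega>\<^sub>0 g = diag_op fourier (\<lambda>m. apply_bcontfun g (lattice_direction m))"
  by (simp add: homogeneous_op_def nabla_calculus_def lattice_direction_def)

lemma homogeneous_op_basis:
  "bop_apply (homogeneous_op \<Lambda> u \<omega>\<^sub>0 g) (fourier m) = apply_bcontfun g (lattice_direction m) *\<^sub>C fourier m"
  unfolding homogeneous_op_diag by (rule diag_op_apply[OF fourier_basis bounded_bcontfun_range])

lemma homogeneous_op_algebra:
  "homogeneous_op \<Lambda> u \<omega>\<^sub>0 (g * h) = homogeneous_op \<Lambda> u \<omega>\<^sub>0 g * homogeneous_op \<Lambda> u \<omega>\<^sub>0 h"
  "homogeneous_op \<Lambda> u \<omega>\<^sub>0 1 = 1"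
  "homogeneous_op \<Lambda> u \<omega>\<^sub>0 (star g) = star (homogeneous_op \<Lambda> u \<omega>\<^sub>0 g)"
proof -
  note bd = bounded_bcontfun_range[of _ lattice_direction]
  show "homogeneous_op \<Lambda> u \<omega>\<^sub>0 (g * h) = homogeneous_op \<Lambda> u \<omega>\<^sub>0 g * homogeneous_op \<Lambda> u \<omega>\<^sub>0 h"
    unfolding homogeneous_op_diag diag_op_algebra(1)[OF fourier_basis bd bd] by simp
  show "homogeneous_op \<Lambda> u \<omega>\<^sub>0 1 = 1"
    unfolding homogeneous_op_diag by (simp add: diag_op_one[OF fourier_basis])
  show "homogeneous_op \<Lambda> u \<omega>\<^sub>0 (star g) = star (homogeneous_op \<Lambda> u \<omega>\<^sub>0 g)"
    unfolding homogeneous_op_diag diag_op_algebra(5)[OF fourier_basis bd bd]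
    by (simp add: star_complex_def)
qed

lemma bessel_op_diag:
  "bessel_op \<Lambda> u = diag_op fourier (\<lambda>m. complex_of_real (bessel_weight (real_vec m)))"
  by (simp add: bessel_op_def nabla_calculus_def bessel_weight_def)

lemma trace_positive_multiplier:
  fixes g :: "'d sphere \<Rightarrow> real"
  assumes g: "continuous_on UNIV g" "\<And>s. \<alpha> \<le> g s" "\<And>s. g s \<le> b" and \<alpha>: "0 < \<alpha>"
  defines "f \<equiv> \<lambda>m. complex_of_real (g (lattice_direction m) * bessel_weight (real_vec m))"
  shows "\<exists>C. weak_bound C (diag_op fourier f)" "bounded (range f)"
    "\<phi> (diag_op fourier f) = complex_of_real (1 / CARD('d) * (LINT s|surface_measure. g s))"
proof -
  let ?c = "1 / CARD('d) * (LINT s|surface_measure. g s)"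
  obtain \<beta> :: "nat \<Rightarrow> int ^ 'd" where \<beta>: "bij \<beta>"
    "(\<lambda>k. real (k + 1) * (g (lattice_direction (\<beta> k)) * bessel_weight (real_vec (\<beta> k)))) \<longlonglongrightarrow> ?c"
    by (rule homogeneous_eigenvalue_asymptotics[OF g \<alpha>, of \<omega>\<^sub>0, folded lattice_direction_def]) (rule that)
  have "(\<lambda>k. complex_of_real (real (k + 1) * (g (lattice_direction (\<beta> k)) * bessel_weight (real_vec (\<beta> k)))))
      \<longlonglongrightarrow> complex_of_real ?c"
    by (rule tendsto_of_real[OF \<beta>(2)])
  then have lim: "(\<lambda>k. of_nat (k + 1) * f (\<beta> k)) \<longlonglongrightarrow> complex_of_real ?c"
    by (simp only: f_def of_real_mult of_real_of_nat_eq)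
  note asym = trace_diag_asymptotic[OF normalised fourier_basis \<beta>(1) lim]
  show "\<exists>C. weak_bound C (diag_op fourier f)" "bounded (range f)"
    "\<phi> (diag_op fourier f) = complex_of_real ?c"
    by (rule asym)+
qed

lemma bounded_bessel_weight: "bounded (range (\<lambda>m. complex_of_real (bessel_weight (real_vec m :: real ^ 'd))))"
  and weak_bound_bessel: "\<exists>C. weak_bound C (bessel_op \<Lambda> u)"
  using trace_positive_multiplier(1,2)[of "\<lambda>_. 1" 1 1] by (simp_all add: bessel_op_diag)

definition bessel_trace :: "'h bop \<Rightarrow> complex" where
  "bessel_trace T = \<phi> (T * bessel_op \<Lambda> u)"

lemma bessel_mult_weak: "\<exists>C. weak_bound C (T * bessel_op \<Lambda> u)"
  using weak_bound_bessel weak_bound_mult(1) by blast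

lemma bessel_mult_weak_trace_class: "T * bessel_op \<Lambda> u \<in> weak_trace_class"
  using bessel_mult_weak weak_boundD(1) by blast

lemma bessel_trace_add: "bessel_trace (S + T) = bessel_trace S + bessel_trace T"
  unfolding bessel_trace_def distrib_right
  by (rule trace_add[OF bessel_mult_weak_trace_class bessel_mult_weak_trace_class])

lemma bessel_trace_scale: "bessel_trace (a *\<^sub>C T) = a * bessel_trace T"
  unfolding bessel_trace_def mult_scaleC_left
  by (rule trace_scale[OF bessel_mult_weak_trace_class])

lemma bounded_linear_bessel_trace: "bounded_linear bessel_trace"
proof -
  obtain K where K: "0 \<le> K" "\<And>C B. weak_bound C B \<Longrightarrow> norm (\<phi> B) \<le> K * C"
    using trace_bounded by blast
  obtain C where C: "weak_bound C (bessel_op \<Lambda> u)"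
    using weak_bound_bessel by blast
  have "norm (bessel_trace T) \<le> norm T * (K * C)" for T
    using K(2)[OF weak_bound_mult(1)[OF C, of T]] by (simp add: bessel_trace_def mult_ac)
  then show ?thesis
    by (intro bounded_linear_intro[where K = "K * C"])
       (simp_all add: bessel_trace_add bessel_trace_scale scaleR_scaleC scaleR_conv_of_real)
qed

lemma bessel_trace_positive:
  fixes g :: "'d sphere \<Rightarrow> real"
  assumes g: "continuous_on UNIV g" "\<And>s. \<alpha> \<le> g s" "\<And>s. g s \<le> b" and \<alpha>: "0 < \<alpha>"
  shows "bessel_trace (diag_op fourier (\<lambda>m. complex_of_real (g (lattice_direction m)))) =
    complex_of_real (1 / CARD('d) * (LINT s|surface_measure. g s))"
    "bounded (range (\<lambda>m. complex_of_real (g (lattice_direction m))))"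
proof -
  have "norm (complex_of_real (g s)) \<le> b" for s
    using g(2,3)[of s] \<alpha> by simp
  then show bd: "bounded (range (\<lambda>m. complex_of_real (g (lattice_direction m))))"
    by (auto simp: bounded_iff)
  have "diag_op fourier (\<lambda>m. complex_of_real (g (lattice_direction m))) * bessel_op \<Lambda> u =
      diag_op fourier (\<lambda>m. complex_of_real (g (lattice_direction m) * bessel_weight (real_vec m)))"
    unfolding bessel_op_diag diag_op_algebra(1)[OF fourier_basis bd bounded_bessel_weight] by simp
  then show "bessel_trace (diag_op fourier (\<lambda>m. complex_of_real (g (lattice_direction m)))) =
      complex_of_real (1 / CARD('d) * (LINT s|surface_measure. g s))"
    unfolding bessel_trace_def by (simp only: trace_positive_multiplier(3)[OF g \<alpha>])
qed

text \<open>A complex function is a combination of positive ones, since adding a large constant makes its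
  real and imaginary parts positive.\<close>

lemma bessel_trace_homogeneous:
  "bessel_trace (homogeneous_op \<Lambda> u \<omega>\<^sub>0 g) =
    1 / of_nat CARD('d) * (LINT s|surface_measure. apply_bcontfun g s)"
proof -
  interpret finite_measure "surface_measure :: 'd sphere measure"
    by (rule finite_surface_measure)
  define B where "B = norm g + 1"
  define r where "r s = Re (apply_bcontfun g s) + B" for s
  define i where "i s = Im (apply_bcontfun g s) + B" for s
  have absg: "\<bar>Re (apply_bcontfun g s)\<bar> \<le> norm g" "\<bar>Im (apply_bcontfun g s)\<bar> \<le> norm g" for s
    using norm_bounded[of g s] abs_Re_le_cmod abs_Im_le_cmod order_trans by blast+
  have r: "continuous_on UNIV r" "\<And>s. 1 \<le> r s" "\<And>s. r s \<le> 2 * B"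
    and i: "continuous_on UNIV i" "\<And>s. 1 \<le> i s" "\<And>s. i s \<le> 2 * B"
    using absg by (auto simp: r_def i_def B_def abs_le_iff intro!: continuous_intros)
       (smt (verit))+
  note R = bessel_trace_positive[OF r zero_less_one]
  note I = bessel_trace_positive[OF i zero_less_one]
  note O = bessel_trace_positive[OF continuous_on_const order_refl order_refl zero_less_one]
  let ?D = "\<lambda>f. diag_op fourier (\<lambda>m. complex_of_real (f (lattice_direction m)))"
  let ?k = "- complex_of_real B * (1 + \<i>)"
  have eq: "apply_bcontfun g s = complex_of_real (r s) + (\<i> * complex_of_real (i s) + ?k * complex_of_real 1)" for s
    by (simp add: complex_eq_iff r_def i_def)
  have bI: "bounded (range (\<lambda>m. \<i> * complex_of_real (i (lattice_direction m))))"
    by (rule bounded_range_mult[OF bounded_range_const I(2)])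
  have bO: "bounded (range (\<lambda>m :: int ^ 'd. ?k * complex_of_real 1))"
    by (rule bounded_range_const)
  have "homogeneous_op \<Lambda> u \<omega>\<^sub>0 g = ?D r + (\<i> *\<^sub>C ?D i + ?k *\<^sub>C ?D (\<lambda>_. 1))"
    unfolding homogeneous_op_diag eq
    by (simp only: diag_op_algebra(4)[OF fourier_basis I(2) I(2)] diag_op_algebra(4)[OF fourier_basis O(2) O(2)]
        diag_op_algebra(2)[OF fourier_basis bI bO]
        diag_op_algebra(2)[OF fourier_basis R(2) bounded_plus_comp[OF bI bO]])
  then have lhs: "bessel_trace (homogeneous_op \<Lambda> u \<omega>\<^sub>0 g) =
      bessel_trace (?D r) + (\<i> * bessel_trace (?D i) + ?k * bessel_trace (?D (\<lambda>_. 1)))"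
    by (simp only: bessel_trace_add bessel_trace_scale)
  have int: "integrable surface_measure f" if "continuous_on UNIV f" "\<And>s. \<bar>f s\<bar> \<le> 2 * B" for f :: "'d sphere \<Rightarrow> real"
  proof (rule integrable_const_bound[where B = "2 * B"])
    have "f \<in> borel_measurable borel"
      by (rule borel_measurable_continuous_onI[OF that(1)])
    then show "f \<in> borel_measurable surface_measure"
      by simp
  qed (use that(2) in auto)
  have "2 * B \<ge> 1"
    by (simp add: B_def)
  then have int': "integrable surface_measure (\<lambda>s :: 'd sphere. complex_of_real (r s))"
    "integrable surface_measure (\<lambda>s :: 'd sphere. complex_of_real (i s))"
    "integrable surface_measure (\<lambda>s :: 'd sphere. complex_of_real 1)"
    using r(2,3) i(2,3)
    by (intro integrable_of_real int r i continuous_on_const; smt (verit))+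
  have "(LINT s|surface_measure. apply_bcontfun g s) =
      (LINT s|surface_measure. complex_of_real (r s)) + (\<i> * (LINT s|surface_measure. complex_of_real (i s))
        + ?k * (LINT s|(surface_measure :: 'd sphere measure). complex_of_real (1 :: real)))"
    unfolding eq using int'
    by (subst Bochner_Integration.integral_add, simp, simp, subst Bochner_Integration.integral_add,
        simp, simp) (simp add: integral_mult_right_zero del: integral_complex_of_real)
  then show ?thesis
    unfolding lhs R(1) I(1) O(1) integral_complex_of_real
    by (simp only: of_real_mult of_real_divide of_real_of_nat_eq of_real_1) (simp only: algebra_simps)
qed


section \<open>Vanishing of the off-diagonal Fourier modes\<close>

text \<open>The diagonal unitary \<open>V\<close> with eigenvalues \<open>exp (i pi (m, n) / (n, n))\<close> commutes with all
  functions of the gradient and anticommutes with \<open>u n\<close>, so the trace is equal to its negative.\<close>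

lemma bessel_trace_off_diagonal:
  assumes n: "n \<noteq> 0"
  shows "bessel_trace (left_mult_op \<Lambda> (u n) * homogeneous_op \<Lambda> u \<omega>\<^sub>0 g) = 0"
proof -
  define \<zeta> where "\<zeta> m = cis (pi * (real_vec m \<bullet> real_vec n) / (real_vec n \<bullet> real_vec n))" for m :: "int ^ 'd"
  have n0: "real_vec n \<bullet> real_vec n \<noteq> 0"
    using n by simp
  have shift: "\<zeta> (n + m) = - \<zeta> m" for m
  proof -
    have "pi * (real_vec (n + m) \<bullet> real_vec n) / (real_vec n \<bullet> real_vec n) =
        pi + pi * (real_vec m \<bullet> real_vec n) / (real_vec n \<bullet> real_vec n)"
      using n0 by (simp only: real_vec_simps inner_add_left) (simp add: field_simps)
    then show ?thesis
      unfolding \<zeta>_def by (simp add: cis_mult[symmetric])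
  qed
  have bd: "bounded (range \<zeta>)"
    by (auto simp: bounded_iff \<zeta>_def intro!: exI[of _ 1])
  define V where "V = diag_op fourier \<zeta>"
  define V' where "V' = diag_op fourier (\<lambda>m. cnj (\<zeta> m))"
  have V: "bop_apply V (fourier m) = \<zeta> m *\<^sub>C fourier m" for m
    unfolding V_def by (rule diag_op_apply[OF fourier_basis bd])
  have unit: "\<zeta> m * cnj (\<zeta> m) = 1" for m
    by (simp add: \<zeta>_def cis_cnj cis_mult)
  have "V * V' = 1" "V' * V = 1"
    unfolding V_def V'_def
    by (simp_all add: diag_op_algebra(1)[OF fourier_basis] bd bounded_range_cnj unit
        mult.commute[of "cnj _"] diag_op_one[OF fourier_basis])
  define X where "X = left_mult_op \<Lambda> (u n) * homogeneous_op \<Lambda> u \<omega>\<^sub>0 g * bessel_op \<Lambda> u"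
  have "V * X = (-1) *\<^sub>C (X * V)"
    by (rule bop_eq_on_basis[OF fourier_basis])
       (simp add: X_def V homogeneous_op_basis bessel_op_diag left_mult_op_u_basis shift mult_ac
        diag_op_apply[OF fourier_basis bounded_bessel_weight] scaleC_minus_one
        del: scaleC_minus_one)
  obtain C where C: "weak_bound C X"
    using bessel_mult_weak unfolding X_def by blast
  have "\<phi> X = \<phi> (X * V * V')"
    by (simp add: mult.assoc \<open>V * V' = 1\<close>)
  also have "\<dots> = \<phi> (V' * (X * V))"
    by (rule trace_commute[OF weak_bound_mult(2)[OF C], symmetric])
  also have "X * V = (-1) *\<^sub>C (V * X)"
    unfolding \<open>V * X = (-1) *\<^sub>C (X * V)\<close> by simp
  also have "V' * ((-1) *\<^sub>C (V * X)) = (-1) *\<^sub>C X"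
    by (simp only: mult_scaleC_right mult.assoc[symmetric] \<open>V' * V = 1\<close>) simp
  also have "\<phi> ((-1) *\<^sub>C X) = - \<phi> X"
    using trace_scale[OF weak_boundD(1)[OF C], of "-1"] by simp
  finally have "\<phi> X = 0"
    by simp
  then show ?thesis
    by (simp add: bessel_trace_def X_def)
qed

lemma torus_dense_induct:
  assumes "csubspace S" "closed S" "\<And>n. u n \<in> S"
  shows "x \<in> S"
proof -
  have "range u \<subseteq> S"
    using assms(3) by (rule image_subsetI)
  then have "cspan (range u) \<subseteq> S"
    by (rule cspan_minimal[OF _ assms(1)])
  then have "closure (cspan (range u)) \<subseteq> S"
    by (rule closure_minimal[OF _ assms(2)])
  then show ?thesis
    unfolding u_dense by (rule subsetD) simp
qed

lemma bessel_trace_product: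
  "bessel_trace (left_mult_op \<Lambda> x * homogeneous_op \<Lambda> u \<omega>\<^sub>0 g) =
    1 / of_nat CARD('d) * (\<tau> x * (LINT s|surface_measure. apply_bcontfun g s))"
proof -
  let ?I = "LINT s|surface_measure. apply_bcontfun g s"
  let ?H = "homogeneous_op \<Lambda> u \<omega>\<^sub>0 g"
  let ?S = "{x. bessel_trace (left_mult_op \<Lambda> x * ?H) = 1 / of_nat CARD('d) * (\<tau> x * ?I)}"
  have "x \<in> ?S"
  proof (rule torus_dense_induct)
    have "bessel_trace 0 = 0" "\<tau> 0 = 0" "left_mult_op \<Lambda> 0 = 0"
      using bessel_trace_scale[of 0 0] trace_simps(2)[of 0 0] left_mult_op_algebra(2)[of 0 0] by simp_all
    then show "csubspace ?S"
      by (auto simp: csubspace_def left_mult_op_algebra trace_simps distrib_right distrib_left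
          bessel_trace_add bessel_trace_scale add_divide_distrib)
    have "bounded_linear (\<lambda>x. bessel_trace (left_mult_op \<Lambda> x * ?H))"
      by (intro bounded_linear_compose[OF bounded_linear_bessel_trace]
          bounded_linear_compose[OF bounded_linear_mult_left] bounded_linear_left_mult_op)
    then show "closed ?S"
      by (intro closed_Collect_eq continuous_intros linear_continuous_on bounded_linear_trace)
    fix n
    show "u n \<in> ?S"
    proof (cases "n = 0")
      case True
      then show ?thesis
        by (simp add: u_zero left_mult_op_algebra trace_simps bessel_trace_homogeneous)
    next
      case False
      then show ?thesis
        by (simp add: bessel_trace_off_diagonal trace_u)
    qed
  qed
  then show ?thesis by simp
qed


section \<open>An ideal on which the trace vanishes\<close>

text \<open>Quantifying over all bounded \<open>A\<close> and \<open>B\<close> makes this a two-sided ideal of the algebra of all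
  bounded operators; it is closed, and contains the compact diagonal operators.\<close>

definition null_ideal :: "'h bop set" where
  "null_ideal = {T. \<forall>A B. bessel_trace (A * T * B) = 0}"

lemma null_ideal_csubspace: "csubspace null_ideal"
proof -
  have "bessel_trace 0 = 0"
    using bessel_trace_scale[of 0 0] by simp
  then show ?thesis
    by (auto simp: csubspace_def null_ideal_def distrib_left distrib_right
        bessel_trace_add bessel_trace_scale)
qed

lemma null_ideal_closed: "closed null_ideal"
proof -
  have "null_ideal = (\<Inter>A. \<Inter>B. {T. bessel_trace (A * T * B) = 0})"
    by (auto simp: null_ideal_def)
  moreover have "closed {T. bessel_trace (A * T * B) = 0}" for A B
  proof -
    have "bounded_linear (\<lambda>T. bessel_trace (A * T * B))"
      by (intro bounded_linear_compose[OF bounded_linear_bessel_trace]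
          bounded_linear_compose[OF bounded_linear_mult_left] bounded_linear_mult_right)
    then show ?thesis
      by (intro closed_Collect_eq continuous_on_const linear_continuous_on)
  qed
  ultimately show ?thesis
    by (simp add: closed_INT)
qed

lemma null_ideal_mult:
  assumes "T \<in> null_ideal"
  shows "A * T \<in> null_ideal" "T * A \<in> null_ideal"
proof -
  have T: "bessel_trace (B * T * C) = 0" for B C
    using assms by (simp add: null_ideal_def)
  have "bessel_trace (B * (A * T) * C) = 0" "bessel_trace (B * (T * A) * C) = 0" for B C
    using T[of "B * A" C] T[of B "A * C"] by (simp_all add: mult.assoc)
  then show "A * T \<in> null_ideal" "T * A \<in> null_ideal"
    by (simp_all add: null_ideal_def)
qed

abbreviation mode_projection :: "int ^ 'd \<Rightarrow> 'h bop" where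
  "mode_projection m \<equiv> diag_op fourier (\<lambda>i. if i = m then 1 else 0)"

lemma bounded_mode: "bounded (range (\<lambda>i. if i = m then 1 else (0::complex)))"
  by (rule bounded_subset[of "{0, 1}"]) auto

lemma trace_mode_projection:
  "\<phi> (mode_projection m) = 0" "\<exists>C. weak_bound C (mode_projection m)"
proof -
  obtain \<beta> :: "nat \<Rightarrow> int ^ 'd" where \<beta>: "bij \<beta>"
    using homogeneous_eigenvalue_asymptotics[of "\<lambda>_. 1" 1 1] by (metis continuous_on_const order_refl zero_less_one)
  obtain k0 where k0: "\<beta> k0 = m"
    using \<beta> by (metis bij_pointE)
  have "\<forall>\<^sub>F k in sequentially. 0 = of_nat (k + 1) * (if \<beta> k = m then 1 else (0::complex))"
    using eventually_gt_at_top[of k0]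
  proof eventually_elim
    case (elim k)
    then have "\<beta> k \<noteq> \<beta> k0"
      using bij_is_inj[OF \<beta>] by (auto dest: injD)
    then show ?case
      by (simp add: k0)
  qed
  then have lim: "(\<lambda>k. of_nat (k + 1) * (if \<beta> k = m then 1 else 0)) \<longlonglongrightarrow> (0::complex)"
    by (rule Lim_transform_eventually[OF tendsto_const])
  show "\<phi> (mode_projection m) = 0" "\<exists>C. weak_bound C (mode_projection m)"
    by (rule trace_diag_asymptotic[OF normalised fourier_basis \<beta> lim])+
qed

text \<open>For a rank-one projection \<open>E\<close> and bounded operators \<open>A\<close>, \<open>C\<close> the trace of \<open>A * E * C\<close> is that of
  \<open>E * C * A * E\<close>, a multiple of \<open>E\<close>.\<close>

lemma mode_projection_null_ideal: "mode_projection m \<in> null_ideal"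
proof -
  let ?E = "mode_projection m"
  have EE: "?E * ?E = ?E"
    by (simp add: diag_op_algebra(1)[OF fourier_basis bounded_mode bounded_mode] if_distrib cong: if_cong)
  obtain C where C: "weak_bound C ?E"
    using trace_mode_projection(2) by blast
  have "bessel_trace (A * ?E * B) = 0" for A B
  proof -
    let ?Z = "B * bessel_op \<Lambda> u * A"
    let ?z = "cinner (fourier m) (bop_apply ?Z (fourier m))"
    have E: "bop_apply ?E v = cinner (fourier m) v *\<^sub>C fourier m" for v
      by (rule cinner_basis_ext[OF fourier_basis])
         (simp add: cinner_basis_diag[OF fourier_basis bounded_mode] orthonormal_basisD(1)[OF fourier_basis])
    have "bessel_trace (A * ?E * B) = \<phi> (A * (?E * (B * bessel_op \<Lambda> u)))"
      by (simp add: bessel_trace_def mult.assoc)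
    also have "\<dots> = \<phi> (?E * (B * bessel_op \<Lambda> u) * A)"
      by (rule trace_commute[OF weak_bound_mult(2)[OF C]])
    also have "?E * (B * bessel_op \<Lambda> u) * A = ?E * (?E * ?Z)"
      by (simp only: mult.assoc[symmetric] EE)
    also have "\<phi> (?E * (?E * ?Z)) = \<phi> (?E * ?Z * ?E)"
      by (rule trace_commute[OF weak_bound_mult(2)[OF C]])
    also have "?E * ?Z * ?E = ?z *\<^sub>C ?E"
      by (rule bop_eqI) (simp add: E mult.commute)
    also have "\<phi> (?z *\<^sub>C ?E) = 0"
      using trace_scale[OF weak_boundD(1)[OF C]] trace_mode_projection(1) by simp
    finally show ?thesis .
  qed
  then show ?thesis
    by (simp add: null_ideal_def)
qed

lemma vanishing_diag_null_ideal:
  assumes bd: "bounded (range h)" and fin: "\<And>\<epsilon>. \<epsilon> > 0 \<Longrightarrow> finite {m. \<epsilon> \<le> norm (h m)}"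
  shows "diag_op fourier h \<in> null_ideal"
proof -
  have "diag_op fourier h \<in> closure null_ideal"
    unfolding closure_approachable
  proof (intro allI impI)
    fix \<epsilon> :: real assume \<epsilon>: "0 < \<epsilon>"
    define F where "F = {m. \<epsilon> / 2 \<le> norm (h m)}"
    have F: "finite F"
      unfolding F_def by (rule fin) (use \<epsilon> in simp)
    have bF: "bounded (range (\<lambda>m. if m \<in> F then h m else 0))"
      by (rule bounded_range_truncation[OF bd])
    let ?T = "diag_op fourier (\<lambda>m. if m \<in> F then h m else 0)"
    have "?T = (\<Sum>m\<in>F. h m *\<^sub>C mode_projection m)"
    proof (rule diag_op_eqI[OF fourier_basis bF])
      fix i
      have "bop_apply (\<Sum>m\<in>F. h m *\<^sub>C mode_projection m) (fourier i) =
          (\<Sum>m\<in>F. if m = i then h m *\<^sub>C fourier i else 0)"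
        unfolding bop_apply_sum_left
        by (rule sum.cong[OF refl]) (simp add: diag_op_apply[OF fourier_basis bounded_mode])
      then show "bop_apply (\<Sum>m\<in>F. h m *\<^sub>C mode_projection m) (fourier i) =
          (if i \<in> F then h i else 0) *\<^sub>C fourier i"
        using F by (simp add: sum.delta)
    qed
    also have "\<dots> \<in> null_ideal"
      by (intro csubspace_sum csubspaceD(3) null_ideal_csubspace mode_projection_null_ideal)
    finally have "?T \<in> null_ideal" .
    moreover have "dist ?T (diag_op fourier h) \<le> \<epsilon> / 2"
      unfolding dist_norm diag_op_algebra(3)[OF fourier_basis bF bd]
      by (rule diag_op_basis(2)[OF fourier_basis]) (use \<epsilon> in \<open>auto simp: F_def less_imp_le\<close>)
    ultimately show "\<exists>T\<in>null_ideal. dist T (diag_op fourier h) < \<epsilon>"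
      using \<epsilon> by (intro bexI[of _ ?T]) auto
  qed
  then show ?thesis
    by (simp add: null_ideal_closed)
qed

text \<open>For \<open>x = u n\<close> the commutator is \<open>u n\<close> times the diagonal operator with eigenvalues
  \<open>h m = g ((n + m) / |n + m|) - g (m / |m|)\<close>, which tend to zero; the ideal is closed, and the \<open>u n\<close>
  span a dense subspace.\<close>

lemma commutator_null_ideal:
  "homogeneous_op \<Lambda> u \<omega>\<^sub>0 g * left_mult_op \<Lambda> x - left_mult_op \<Lambda> x * homogeneous_op \<Lambda> u \<omega>\<^sub>0 g \<in> null_ideal"
proof -
  let ?H = "homogeneous_op \<Lambda> u \<omega>\<^sub>0 g"
  let ?f = "\<lambda>x. ?H * left_mult_op \<Lambda> x - left_mult_op \<Lambda> x * ?H"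
  have "x \<in> {x. ?f x \<in> null_ideal}"
  proof (rule torus_dense_induct)
    have "?f (x + y) = ?f x + ?f y" "?f (a *\<^sub>C x) = a *\<^sub>C ?f x" for x y a
      by (simp_all add: left_mult_op_algebra distrib_left distrib_right scaleC_diff_right)
    moreover have "?f 0 = 0"
      using left_mult_op_algebra(2)[of 0 0] by simp
    ultimately show "csubspace {x. ?f x \<in> null_ideal}"
      unfolding csubspace_def by (simp add: csubspaceD[OF null_ideal_csubspace])
    have "bounded_linear ?f"
      by (intro bounded_linear_sub bounded_linear_compose[OF bounded_linear_mult_left]
          bounded_linear_compose[OF bounded_linear_mult_right] bounded_linear_left_mult_op)
    then have "closed (?f -` null_ideal)"
      by (intro continuous_closed_vimage null_ideal_closed linear_continuous_at)
    then show "closed {x. ?f x \<in> null_ideal}"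
      by (simp add: vimage_def)
    fix n
    define h where "h m = apply_bcontfun g (lattice_direction (n + m)) - apply_bcontfun g (lattice_direction m)" for m
    have bd: "bounded (range h)"
      unfolding h_def by (intro bounded_minus_comp bounded_bcontfun_range)
    have "?f (u n) = left_mult_op \<Lambda> (u n) * diag_op fourier h"
      by (rule bop_eq_on_basis[OF fourier_basis])
         (simp add: homogeneous_op_basis left_mult_op_u_basis diag_op_apply[OF fourier_basis bd]
          h_def scaleC_diff_left mult.commute right_diff_distrib)
    also have "\<dots> \<in> null_ideal"
    proof (intro null_ideal_mult vanishing_diag_null_ideal[OF bd])
      fix \<epsilon> :: real assume "\<epsilon> > 0"
      then show "finite {m. \<epsilon> \<le> norm (h m)}"
        unfolding h_def lattice_direction_def by (rule direction_shift_null)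
    qed
    finally show "u n \<in> {x. ?f x \<in> null_ideal}"
      by simp
  qed
  then show ?thesis by simp
qed

end


section \<open>The principal symbol computes the trace\<close>

locale torus_symbol = torus_weak_trace \<theta> u \<tau> \<Lambda> \<phi> \<omega>\<^sub>0
  for \<theta> :: "real ^ 'd::finite ^ 'd"
    and u :: "int ^ 'd \<Rightarrow> 'a::cstar_algebra"
    and \<tau> :: "'a \<Rightarrow> complex"
    and \<Lambda> :: "'a \<Rightarrow> 'h::chilbert_space"
    and \<phi> :: "'h bop \<Rightarrow> complex"
    and \<omega>\<^sub>0 :: "'d sphere" +
  fixes t :: "'a \<Rightarrow> 'd csphere \<Rightarrow> 'b::cstar_algebra"
    and symb :: "'h bop \<Rightarrow> 'b"
    and \<Phi> :: "'b \<Rightarrow> complex"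
  assumes tensor: "min_tensor_product t"
    and symb: "principal_symbol \<Lambda> u \<omega>\<^sub>0 t symb"
    and functional: "trace_tensor_integral \<tau> t \<Phi>"
begin

abbreviation symbols :: "'h bop set" where
  "symbols \<equiv> symbol_algebra \<Lambda> u \<omega>\<^sub>0"

abbreviation L :: "'a \<Rightarrow> 'h bop" where
  "L \<equiv> left_mult_op \<Lambda>"

abbreviation H :: "'d csphere \<Rightarrow> 'h bop" where
  "H \<equiv> homogeneous_op \<Lambda> u \<omega>\<^sub>0"

lemma symbols_simps:
  "0 \<in> symbols" "S \<in> symbols \<Longrightarrow> T \<in> symbols \<Longrightarrow> S + T \<in> symbols" "S \<in> symbols \<Longrightarrow> T \<in> symbols \<Longrightarrow> S * T \<in> symbols"
  "S \<in> symbols \<Longrightarrow> a *\<^sub>C S \<in> symbols" "S \<in> symbols \<Longrightarrow> star S \<in> symbols" "L x \<in> symbols" "H g \<in> symbols"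
proof -
  note alg = star_subalgebraD[OF star_subalgebra_cstar_generated[of "range L \<union> range H"], folded symbol_algebra_def]
  show "0 \<in> symbols" "S \<in> symbols \<Longrightarrow> T \<in> symbols \<Longrightarrow> S + T \<in> symbols" "S \<in> symbols \<Longrightarrow> T \<in> symbols \<Longrightarrow> S * T \<in> symbols"
    "S \<in> symbols \<Longrightarrow> a *\<^sub>C S \<in> symbols" "S \<in> symbols \<Longrightarrow> star S \<in> symbols"
    by (rule alg; assumption)+
  have "range L \<union> range H \<subseteq> symbols"
    unfolding symbol_algebra_def by (rule cstar_generated_superset)
  then show "L x \<in> symbols" "H g \<in> symbols"
    by auto
qed

lemma symbols_diff: "S \<in> symbols \<Longrightarrow> T \<in> symbols \<Longrightarrow> S - T \<in> symbols"
  using symbols_simps(2)[of S "(-1) *\<^sub>C T"] symbols_simps(4)[of T "-1"] by (simp add: scaleC_minus_one)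

lemma symb_simps:
  "S \<in> symbols \<Longrightarrow> T \<in> symbols \<Longrightarrow> symb (S + T) = symb S + symb T"
  "S \<in> symbols \<Longrightarrow> T \<in> symbols \<Longrightarrow> symb (S * T) = symb S * symb T"
  "S \<in> symbols \<Longrightarrow> symb (a *\<^sub>C S) = a *\<^sub>C symb S"
  "S \<in> symbols \<Longrightarrow> symb (star S) = star (symb S)"
  "symb (L x) = t x 1" "symb (H g) = t 1 g" "continuous_on symbols symb"
  using symb by (simp_all add: principal_symbol_def star_hom_on_def)

lemma symb_zero: "symb 0 = 0"
  using symb_simps(3)[OF symbols_simps(1), of 0] by simp

lemma symb_diff: "S \<in> symbols \<Longrightarrow> T \<in> symbols \<Longrightarrow> symb (S - T) = symb S - symb T"
  using symb_simps(1)[of "S - T" T] symbols_diff[of S T] by (simp add: algebra_simps)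

lemma tensor_mult: "t x g * t y h = t (x * y) (g * h)"
  using tensor by (simp add: min_tensor_product_def)

lemma functional_simps:
  "\<Phi> (x + y) = \<Phi> x + \<Phi> y" "\<Phi> (a *\<^sub>C x) = a * \<Phi> x"
  "\<Phi> (t z g) = \<tau> z * (LINT s|surface_measure. apply_bcontfun g s)"
  using functional by (simp_all add: trace_tensor_integral_def bounded_clinear_def clinear_def)

lemma functional_zero: "\<Phi> 0 = 0"
  using functional_simps(2)[of 0 0] by simp

lemma bounded_linear_functional: "bounded_linear \<Phi>"
proof -
  obtain K where "\<And>x. norm (\<Phi> x) \<le> K * norm x"
    using functional by (auto simp: trace_tensor_integral_def bounded_clinear_def)
  then show ?thesis
    by (intro bounded_linear_intro[where K = K])
       (auto simp: functional_simps scaleR_scaleC scaleR_conv_of_real mult.commute)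
qed

text \<open>Operators that contribute to neither side of the trace formula, even when multiplied by
  elements of the symbol algebra.\<close>

definition negligible_ops :: "'h bop set" where
  "negligible_ops = {K \<in> symbols. symb K = 0 \<and> K \<in> null_ideal \<and> star K \<in> null_ideal}"

lemma negligible_ops_mult:
  assumes K: "K \<in> negligible_ops" and T: "T \<in> symbols"
  shows "T * K \<in> negligible_ops" "K * T \<in> negligible_ops" "star K \<in> negligible_ops"
  using assms by (auto simp: negligible_ops_def symbols_simps symb_simps star_mult null_ideal_mult)

lemma commutator_negligible: "H g * L x - L x * H g \<in> negligible_ops"
proof -
  have "star (H g * L x - L x * H g) = (-1) *\<^sub>C (H (star g) * L (star x) - L (star x) * H (star g))"
    using bounded_linear.linear[OF bounded_linear_star, THEN linear_diff, of "H g * L x" "L x * H g"]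
    by (simp add: star_mult homogeneous_op_algebra left_mult_op_algebra scaleC_minus_one)
  moreover have "(-1) *\<^sub>C (H (star g) * L (star x) - L (star x) * H (star g)) \<in> null_ideal"
    by (intro csubspaceD(3)[OF null_ideal_csubspace] commutator_null_ideal)
  moreover have "symb (H g * L x - L x * H g) = 0"
    by (simp add: symb_diff symbols_simps symb_simps tensor_mult)
  ultimately show ?thesis
    by (simp only: negligible_ops_def mem_Collect_eq commutator_null_ideal symbols_diff symbols_simps)
qed

definition symbol_core :: "'h bop set" where
  "symbol_core = cspan ({L x * H g | x g. True} \<union> negligible_ops)"

text \<open>Products and adjoints of \<open>L x * H g\<close> are again of this form once the factors are put in order,
  which costs a commutator.\<close>

lemma symbol_core_star_subalgebra: "star_subalgebra symbol_core"
  unfolding symbol_core_def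
proof (rule star_subalgebra_cspan)
  let ?X = "{L x * H g | x g. True}"
  note sp = csubspaceD[OF csubspace_cspan]
  have base: "L x * H g \<in> cspan (?X \<union> negligible_ops)" for x g
    by (rule subsetD[OF cspan_superset]) blast
  have negl: "K \<in> cspan (?X \<union> negligible_ops)" if "K \<in> negligible_ops" for K
    by (rule subsetD[OF cspan_superset]) (use that in blast)
  have sub: "T \<in> symbols" if "T \<in> ?X \<union> negligible_ops" for T
    using that by (auto simp: negligible_ops_def symbols_simps)
  fix S T assume S: "S \<in> ?X \<union> negligible_ops"
  show "star S \<in> cspan (?X \<union> negligible_ops)"
  proof (cases "S \<in> negligible_ops")
    case True
    then show ?thesis
      by (intro negl negligible_ops_mult(3)[OF _ sub[OF S]])
  next
    case False
    with S obtain x g where "S = L x * H g" by blast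
    then have "star S = L (star x) * H (star g) + (H (star g) * L (star x) - L (star x) * H (star g))"
      by (simp add: star_mult homogeneous_op_algebra left_mult_op_algebra)
    then show ?thesis
      by (simp only:) (intro sp base negl commutator_negligible)
  qed
  assume T: "T \<in> ?X \<union> negligible_ops"
  show "S * T \<in> cspan (?X \<union> negligible_ops)"
  proof (cases "S \<in> negligible_ops \<or> T \<in> negligible_ops")
    case True
    then have "S * T \<in> negligible_ops"
      using negligible_ops_mult(1)[OF _ sub[OF S]] negligible_ops_mult(2)[OF _ sub[OF T]] by auto
    then show ?thesis
      by (rule negl)
  next
    case False
    with S T obtain x g y h where "S = L x * H g" "T = L y * H h" by blast
    then have "S * T = L (x * y) * H (g * h) + L x * (H g * L y - L y * H g) * H h"
      by (simp add: homogeneous_op_algebra left_mult_op_algebra distrib_left distrib_right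
          left_diff_distrib right_diff_distrib mult.assoc)
    then show ?thesis
      by (simp only:) (intro sp base negl negligible_ops_mult commutator_negligible symbols_simps)
  qed
qed

lemma symbol_core_dense: "symbols \<subseteq> closure symbol_core"
  unfolding symbol_algebra_def
proof (rule cstar_generated_minimal[OF _ symbol_core_star_subalgebra])
  have "L x * H g \<in> symbol_core" for x g
    unfolding symbol_core_def by (rule subsetD[OF cspan_superset]) blast
  from this[of _ 1] this[of 1] have "L x \<in> symbol_core" "H g \<in> symbol_core" for x g
    by (simp_all add: homogeneous_op_algebra left_mult_op_algebra)
  then show "range L \<union> range H \<subseteq> closure symbol_core"
    using closure_subset by fastforce
qed

lemma trace_formula_core:
  assumes "T \<in> symbol_core"
  shows "T \<in> symbols \<and> bessel_trace T = 1 / of_nat CARD('d) * \<Phi> (symb T)"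
  using assms unfolding symbol_core_def
proof (induction rule: cspan_induct)
  case (base T)
  show ?case
  proof (cases "T \<in> negligible_ops")
    case True
    then have "bessel_trace (1 * T * 1) = 0"
      unfolding negligible_ops_def null_ideal_def by blast
    with True show ?thesis
      by (simp add: negligible_ops_def functional_zero)
  next
    case False
    with base obtain x g where "T = L x * H g" by blast
    then show ?thesis
      by (simp add: symbols_simps symb_simps tensor_mult functional_simps bessel_trace_product)
  qed
next
  case zero
  show ?case
    using bessel_trace_scale[of 0 0] by (simp add: symbols_simps symb_zero functional_zero)
next
  case (add S T)
  then show ?case
    by (simp add: symbols_simps symb_simps functional_simps bessel_trace_add add_divide_distrib)
next
  case (scale a T)
  then show ?case
    by (simp add: symbols_simps symb_simps functional_simps bessel_trace_scale)
qed

lemma trace_formula: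
  assumes T: "T \<in> symbols"
  shows "bessel_trace T = 1 / of_nat CARD('d) * \<Phi> (symb T)"
proof -
  obtain S where S: "\<And>n. S n \<in> symbol_core" "S \<longlonglongrightarrow> T"
    using subsetD[OF symbol_core_dense T] unfolding closure_sequential by blast
  have lim: "(\<lambda>n. bessel_trace (S n)) \<longlonglongrightarrow> bessel_trace T"
    by (rule bounded_linear.tendsto[OF bounded_linear_bessel_trace S(2)])
  have "(\<lambda>n. symb (S n)) \<longlonglongrightarrow> symb T"
    using symb_simps(7) T S(2) trace_formula_core[OF S(1)]
    unfolding continuous_on_sequentially by (auto simp: comp_def)
  then have "(\<lambda>n. 1 / of_nat CARD('d) * \<Phi> (symb (S n))) \<longlonglongrightarrow> 1 / of_nat CARD('d) * \<Phi> (symb T)"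
    by (intro tendsto_mult tendsto_const bounded_linear.tendsto[OF bounded_linear_functional])
  then have "(\<lambda>n. bessel_trace (S n)) \<longlonglongrightarrow> 1 / of_nat CARD('d) * \<Phi> (symb T)"
    using trace_formula_core[OF S(1)] by simp
  with lim show ?thesis
    by (rule LIMSEQ_unique)
qed

end

theorem theorem6p5:
  fixes \<theta> :: "real ^ 'd::finite ^ 'd"
    and u :: "int ^ 'd \<Rightarrow> 'a::cstar_algebra"
    and \<tau> :: "'a \<Rightarrow> complex"
    and \<Lambda> :: "'a \<Rightarrow> 'h::chilbert_space"
    and \<omega>\<^sub>0 :: "'d sphere"
    and t :: "'a \<Rightarrow> 'd csphere \<Rightarrow> 'b::cstar_algebra"
    and symb :: "'h bop \<Rightarrow> 'b"
    and \<Phi> :: "'b \<Rightarrow> complex"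
    and \<phi> :: "'h bop \<Rightarrow> complex"
    and T :: "'h bop"
  assumes "CARD('d) \<ge> 2"
    and "transpose \<theta> = - \<theta>"
    and "noncommutative_torus \<theta> u"
    and "torus_trace u \<tau>"
    and "gns_space \<tau> \<Lambda>"
    and "min_tensor_product t"
    and "principal_symbol \<Lambda> u \<omega>\<^sub>0 t symb"
    and "trace_tensor_integral \<tau> t \<Phi>"
    and "T \<in> symbol_algebra \<Lambda> u \<omega>\<^sub>0"
    and "continuous_trace \<phi>"
    and "normalised_trace \<phi>"
  shows "T * bessel_op \<Lambda> u \<in> weak_trace_class \<and>
    \<phi> (T * bessel_op \<Lambda> u) = 1 / of_nat CARD('d) * \<Phi> (symb T)"
proof -
  interpret torus_symbol \<theta> u \<tau> \<Lambda> \<phi> \<omega>\<^sub>0 t symb \<Phi>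
    by unfold_locales (fact assms)+
  show ?thesis
    using bessel_mult_weak_trace_class[of T] trace_formula[OF assms(9)]
    by (simp only: bessel_trace_def simp_thms)
qed

end
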